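(* Let $\mathfrak g$ be a complex simple Lie algebra and $\sigma\in\mathrm{Aut}(\mathfrak g)$ an automorphism leaving invariant some compact real form $\mathfrak u$ of $\mathfrak g$, and let $\hat{\mathfrak G}=\hat L(\mathfrak g,\sigma)$ and $\hat{\mathfrak U}=\hat L(\mathfrak u,\sigma)=L(\mathfrak u,\sigma)\oplus\mathbb Rc\oplus\mathbb Rd\subset\hat{\mathfrak G}$. Then: (i) $\hat{\mathfrak U}$ is a real form of $\hat{\mathfrak G}$, and for any two $\sigma$-invariant compact real forms $\mathfrak u_1,\mathfrak u_2$ of $\mathfrak g$ the real forms $\hat L(\mathfrak u_1,\sigma)$ and $\hat L(\mathfrak u_2,\sigma)$ are conjugate under $\mathrm{Aut}(\hat{\mathfrak G})$ (so the compact real form is unique up to conjugation). (ii) The conjugacy classes of noncompact real forms of $\hat{\mathfrak G}$ are in bijection with the conjugacy classes of involutions of $\hat{\mathfrak U}$, and also with the conjugacy classes of ($\mathbb C$-linear) involutions of $\hat{\mathfrak G}$. (iii) Every noncompact real form of $\hat{\mathfrak G}$ has a Cartan decomposition, and any two Cartan decompositions of it are conjugate by an automorphism of the real form.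
   Context: $L(\mathfrak g,\sigma)=\{u:\mathbb R\to\mathfrak g\text{ smooth}:u(t+2\pi)=\sigma(u(t))\}$ with pointwise bracket; $\hat L(\mathfrak g,\sigma)=L(\mathfrak g,\sigma)\oplus\mathbb Cc\oplus\mathbb Cd$ with $[u,v]=[u,v]_0+(u',v)c$, $[d,u]=u'$, $c$ central, where $(u,v)=\int_0^{2\pi}(u(t),v(t))_0dt$ with $(\cdot,\cdot)_0$ the Killing form; $L(\mathfrak u,\sigma)$ is the subset of loops with values in $\mathfrak u$. A real form of a complex Lie algebra $\mathfrak G$ is a real subalgebra $\mathfrak G_{\mathbb R}$ with $\mathfrak G=\mathfrak G_{\mathbb R}\oplus i\mathfrak G_{\mathbb R}$ (equivalently, the fixed point set of an antilinear involutive automorphism); two real forms are conjugate if some $\mathbb C$-linear automorphism of $\mathfrak G$ maps one onto the other. A compact real form of $\hat{\mathfrak G}$ is a real form conjugate to $\hat{\mathfrak U}$; a noncompact real form is one that is not compact. An involution is an automorphism of order exactly $2$. A Cartan decomposition of a real form $\mathfrak R$ is a decomposition $\mathfrak R=\mathfrak K\oplus\mathfrak M$ into the $(+1)$- and $(-1)$-eigenspaces of an involutive automorphism of $\mathfrak R$ such that $\mathfrak K\oplus i\mathfrak M$ is a compact real form of $\hat{\mathfrak G}$. *)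

theory Defs
  imports "HOL-Analysis.Analysis"
begin

text \<open>The complex Lie algebra g is modelled (up to isomorphism) on the complex vector
space complex^'n with an arbitrary Lie bracket br.\<close>

type_synonym 'n gv = "complex^'n"
type_synonym 'n aff = "(real \<Rightarrow> complex^'n) \<times> complex \<times> complex"

definition lie_alg :: "('n::finite gv \<Rightarrow> 'n gv \<Rightarrow> 'n gv) \<Rightarrow> bool" where
  "lie_alg br \<longleftrightarrow>
     (\<forall>x y z. br (x + y) z = br x z + br y z) \<and>
     (\<forall>x y z. br x (y + z) = br x y + br x z) \<and>
     (\<forall>c x y. br (c *s x) y = c *s br x y) \<and>
     (\<forall>c x y. br x (c *s y) = c *s br x y) \<and>
     (\<forall>x. br x x = 0) \<and>
     (\<forall>x y z. br x (br y z) + br y (br z x) + br z (br x y) = 0)"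

definition csubspace :: "'n::finite gv set \<Rightarrow> bool" where
  "csubspace I \<longleftrightarrow> 0 \<in> I \<and> (\<forall>x\<in>I. \<forall>y\<in>I. x + y \<in> I) \<and> (\<forall>c. \<forall>x\<in>I. c *s x \<in> I)"

definition lie_ideal :: "('n::finite gv \<Rightarrow> 'n gv \<Rightarrow> 'n gv) \<Rightarrow> 'n gv set \<Rightarrow> bool" where
  "lie_ideal br I \<longleftrightarrow> csubspace I \<and> (\<forall>x\<in>I. \<forall>y. br y x \<in> I)"

definition simple_lie :: "('n::finite gv \<Rightarrow> 'n gv \<Rightarrow> 'n gv) \<Rightarrow> bool" where
  "simple_lie br \<longleftrightarrow> lie_alg br \<and> (\<exists>x y. br x y \<noteq> 0) \<and>
     (\<forall>I. lie_ideal br I \<longrightarrow> I = {0} \<or> I = UNIV)"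

definition lie_aut :: "('n::finite gv \<Rightarrow> 'n gv \<Rightarrow> 'n gv) \<Rightarrow> ('n gv \<Rightarrow> 'n gv) \<Rightarrow> bool" where
  "lie_aut br \<sigma> \<longleftrightarrow> bij \<sigma> \<and> (\<forall>x y. \<sigma> (x + y) = \<sigma> x + \<sigma> y) \<and>
     (\<forall>c x. \<sigma> (c *s x) = c *s \<sigma> x) \<and> (\<forall>x y. \<sigma> (br x y) = br (\<sigma> x) (\<sigma> y))"

text \<open>Killing form (x,y)_0 = tr(ad x ad y), trace computed in the standard basis.\<close>
definition killing :: "('n::finite gv \<Rightarrow> 'n gv \<Rightarrow> 'n gv) \<Rightarrow> 'n gv \<Rightarrow> 'n gv \<Rightarrow> complex" where
  "killing br x y = (\<Sum>i\<in>UNIV. (br x (br y (axis i 1))) $ i)"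

definition real_form_g :: "('n::finite gv \<Rightarrow> 'n gv \<Rightarrow> 'n gv) \<Rightarrow> 'n gv set \<Rightarrow> bool" where
  "real_form_g br U \<longleftrightarrow> 0 \<in> U \<and> (\<forall>x\<in>U. \<forall>y\<in>U. x + y \<in> U) \<and>
     (\<forall>r::real. \<forall>x\<in>U. complex_of_real r *s x \<in> U) \<and>
     (\<forall>x\<in>U. \<forall>y\<in>U. br x y \<in> U) \<and>
     (\<forall>x. \<exists>!pq. fst pq \<in> U \<and> snd pq \<in> U \<and> x = fst pq + \<i> *s snd pq)"

definition compact_rf_g :: "('n::finite gv \<Rightarrow> 'n gv \<Rightarrow> 'n gv) \<Rightarrow> 'n gv set \<Rightarrow> bool" where
  "compact_rf_g br U \<longleftrightarrow> real_form_g br U \<and>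
     (\<forall>x\<in>U. x \<noteq> 0 \<longrightarrow> killing br x x \<in> \<real> \<and> Re (killing br x x) < 0)"

fun hder :: "nat \<Rightarrow> (real \<Rightarrow> 'a::real_normed_vector) \<Rightarrow> real \<Rightarrow> 'a" where
  "hder 0 u = u"
| "hder (Suc k) u = (\<lambda>t. vector_derivative (hder k u) (at t))"

definition smooth :: "(real \<Rightarrow> 'a::real_normed_vector) \<Rightarrow> bool" where
  "smooth u \<longleftrightarrow> (\<forall>k t. hder k u differentiable (at t))"

definition loop_alg :: "('n::finite gv \<Rightarrow> 'n gv) \<Rightarrow> (real \<Rightarrow> 'n gv) set" where
  "loop_alg \<sigma> = {u. smooth u \<and> (\<forall>t. u (t + 2 * pi) = \<sigma> (u t))}"

text \<open>hat L(g,sigma): elements (u,a,b) stand for u + a c + b d.\<close>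
definition LGhat :: "('n::finite gv \<Rightarrow> 'n gv) \<Rightarrow> 'n aff set" where
  "LGhat \<sigma> = loop_alg \<sigma> \<times> UNIV \<times> UNIV"

definition aadd :: "'n::finite aff \<Rightarrow> 'n aff \<Rightarrow> 'n aff" where
  "aadd x y = ((\<lambda>t. fst x t + fst y t), fst (snd x) + fst (snd y), snd (snd x) + snd (snd y))"

definition ascale :: "complex \<Rightarrow> 'n::finite aff \<Rightarrow> 'n aff" where
  "ascale z x = ((\<lambda>t. z *s fst x t), z * fst (snd x), z * snd (snd x))"

definition azero :: "'n::finite aff" where
  "azero = ((\<lambda>t. 0), 0, 0)"

definition ldot :: "('n::finite gv \<Rightarrow> 'n gv \<Rightarrow> 'n gv) \<Rightarrow> (real \<Rightarrow> 'n gv) \<Rightarrow> (real \<Rightarrow> 'n gv) \<Rightarrow> complex" where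
  "ldot br u v = integral {0..2 * pi} (\<lambda>t. killing br (u t) (v t))"

definition abr :: "('n::finite gv \<Rightarrow> 'n gv \<Rightarrow> 'n gv) \<Rightarrow> 'n aff \<Rightarrow> 'n aff \<Rightarrow> 'n aff" where
  "abr br x y =
     ((\<lambda>t. br (fst x t) (fst y t) + snd (snd x) *s vector_derivative (fst y) (at t)
            - snd (snd y) *s vector_derivative (fst x) (at t)),
      ldot br (\<lambda>t. vector_derivative (fst x) (at t)) (fst y),
      0)"

definition Uhat :: "('n::finite gv \<Rightarrow> 'n gv) \<Rightarrow> 'n gv set \<Rightarrow> 'n aff set" where
  "Uhat \<sigma> U = {x \<in> LGhat \<sigma>. (\<forall>t. fst x t \<in> U) \<and> fst (snd x) \<in> \<real> \<and> snd (snd x) \<in> \<real>}"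

definition aut_hat :: "('n::finite gv \<Rightarrow> 'n gv \<Rightarrow> 'n gv) \<Rightarrow> ('n gv \<Rightarrow> 'n gv) \<Rightarrow> ('n aff \<Rightarrow> 'n aff) \<Rightarrow> bool" where
  "aut_hat br \<sigma> \<phi> \<longleftrightarrow> bij_betw \<phi> (LGhat \<sigma>) (LGhat \<sigma>) \<and>
     (\<forall>x\<in>LGhat \<sigma>. \<forall>y\<in>LGhat \<sigma>. \<phi> (aadd x y) = aadd (\<phi> x) (\<phi> y)) \<and>
     (\<forall>z. \<forall>x\<in>LGhat \<sigma>. \<phi> (ascale z x) = ascale z (\<phi> x)) \<and>
     (\<forall>x\<in>LGhat \<sigma>. \<forall>y\<in>LGhat \<sigma>. \<phi> (abr br x y) = abr br (\<phi> x) (\<phi> y))"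

definition real_form_hat :: "('n::finite gv \<Rightarrow> 'n gv \<Rightarrow> 'n gv) \<Rightarrow> ('n gv \<Rightarrow> 'n gv) \<Rightarrow> 'n aff set \<Rightarrow> bool" where
  "real_form_hat br \<sigma> R \<longleftrightarrow> R \<subseteq> LGhat \<sigma> \<and> azero \<in> R \<and>
     (\<forall>x\<in>R. \<forall>y\<in>R. aadd x y \<in> R) \<and>
     (\<forall>r::real. \<forall>x\<in>R. ascale (complex_of_real r) x \<in> R) \<and>
     (\<forall>x\<in>R. \<forall>y\<in>R. abr br x y \<in> R) \<and>
     (\<forall>x\<in>LGhat \<sigma>. \<exists>!pq. fst pq \<in> R \<and> snd pq \<in> R \<and> x = aadd (fst pq) (ascale \<i> (snd pq)))"

definition conj_rf :: "('n::finite gv \<Rightarrow> 'n gv \<Rightarrow> 'n gv) \<Rightarrow> ('n gv \<Rightarrow> 'n gv) \<Rightarrow> 'n aff set \<Rightarrow> 'n aff set \<Rightarrow> bool" where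
  "conj_rf br \<sigma> R1 R2 \<longleftrightarrow> (\<exists>\<phi>. aut_hat br \<sigma> \<phi> \<and> \<phi> ` R1 = R2)"

definition conj_rf_rel :: "('n::finite gv \<Rightarrow> 'n gv \<Rightarrow> 'n gv) \<Rightarrow> ('n gv \<Rightarrow> 'n gv) \<Rightarrow> ('n aff set \<times> 'n aff set) set" where
  "conj_rf_rel br \<sigma> = {(R1, R2). conj_rf br \<sigma> R1 R2}"

definition compact_hat :: "('n::finite gv \<Rightarrow> 'n gv \<Rightarrow> 'n gv) \<Rightarrow> ('n gv \<Rightarrow> 'n gv) \<Rightarrow> 'n gv set \<Rightarrow> 'n aff set \<Rightarrow> bool" where
  "compact_hat br \<sigma> U R \<longleftrightarrow> real_form_hat br \<sigma> R \<and> conj_rf br \<sigma> R (Uhat \<sigma> U)"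

definition noncompact_hat :: "('n::finite gv \<Rightarrow> 'n gv \<Rightarrow> 'n gv) \<Rightarrow> ('n gv \<Rightarrow> 'n gv) \<Rightarrow> 'n gv set \<Rightarrow> 'n aff set \<Rightarrow> bool" where
  "noncompact_hat br \<sigma> U R \<longleftrightarrow> real_form_hat br \<sigma> R \<and> \<not> conj_rf br \<sigma> R (Uhat \<sigma> U)"

definition real_aut_on :: "('n::finite gv \<Rightarrow> 'n gv \<Rightarrow> 'n gv) \<Rightarrow> 'n aff set \<Rightarrow> ('n aff \<Rightarrow> 'n aff) \<Rightarrow> bool" where
  "real_aut_on br S \<psi> \<longleftrightarrow> bij_betw \<psi> S S \<and>
     (\<forall>x\<in>S. \<forall>y\<in>S. \<psi> (aadd x y) = aadd (\<psi> x) (\<psi> y)) \<and>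
     (\<forall>r::real. \<forall>x\<in>S. \<psi> (ascale (complex_of_real r) x) = ascale (complex_of_real r) (\<psi> x)) \<and>
     (\<forall>x\<in>S. \<forall>y\<in>S. \<psi> (abr br x y) = abr br (\<psi> x) (\<psi> y))"

definition inv_U :: "('n::finite gv \<Rightarrow> 'n gv \<Rightarrow> 'n gv) \<Rightarrow> ('n gv \<Rightarrow> 'n gv) \<Rightarrow> 'n gv set \<Rightarrow> ('n aff \<Rightarrow> 'n aff) set" where
  "inv_U br \<sigma> U = {\<theta>. real_aut_on br (Uhat \<sigma> U) \<theta> \<and> (\<forall>x\<in>Uhat \<sigma> U. \<theta> (\<theta> x) = x) \<and>
                        (\<exists>x\<in>Uhat \<sigma> U. \<theta> x \<noteq> x)}"

definition conj_U_rel :: "('n::finite gv \<Rightarrow> 'n gv \<Rightarrow> 'n gv) \<Rightarrow> ('n gv \<Rightarrow> 'n gv) \<Rightarrow> 'n gv set \<Rightarrow> (('n aff \<Rightarrow> 'n aff) \<times> ('n aff \<Rightarrow> 'n aff)) set" where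
  "conj_U_rel br \<sigma> U = {(\<theta>1, \<theta>2). \<exists>\<psi>. real_aut_on br (Uhat \<sigma> U) \<psi> \<and>
                           (\<forall>x\<in>Uhat \<sigma> U. \<psi> (\<theta>1 x) = \<theta>2 (\<psi> x))}"

definition inv_G :: "('n::finite gv \<Rightarrow> 'n gv \<Rightarrow> 'n gv) \<Rightarrow> ('n gv \<Rightarrow> 'n gv) \<Rightarrow> ('n aff \<Rightarrow> 'n aff) set" where
  "inv_G br \<sigma> = {\<theta>. aut_hat br \<sigma> \<theta> \<and> (\<forall>x\<in>LGhat \<sigma>. \<theta> (\<theta> x) = x) \<and> (\<exists>x\<in>LGhat \<sigma>. \<theta> x \<noteq> x)}"

definition conj_G_rel :: "('n::finite gv \<Rightarrow> 'n gv \<Rightarrow> 'n gv) \<Rightarrow> ('n gv \<Rightarrow> 'n gv) \<Rightarrow> (('n aff \<Rightarrow> 'n aff) \<times> ('n aff \<Rightarrow> 'n aff)) set" where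
  "conj_G_rel br \<sigma> = {(\<theta>1, \<theta>2). \<exists>\<psi>. aut_hat br \<sigma> \<psi> \<and> (\<forall>x\<in>LGhat \<sigma>. \<psi> (\<theta>1 x) = \<theta>2 (\<psi> x))}"

definition cartan_dec :: "('n::finite gv \<Rightarrow> 'n gv \<Rightarrow> 'n gv) \<Rightarrow> ('n gv \<Rightarrow> 'n gv) \<Rightarrow> 'n gv set \<Rightarrow>
    'n aff set \<Rightarrow> 'n aff set \<Rightarrow> 'n aff set \<Rightarrow> bool" where
  "cartan_dec br \<sigma> U R K M \<longleftrightarrow> (\<exists>\<theta>. real_aut_on br R \<theta> \<and> (\<forall>x\<in>R. \<theta> (\<theta> x) = x) \<and>
      (\<exists>x\<in>R. \<theta> x \<noteq> x) \<and>
      K = {x\<in>R. \<theta> x = x} \<and> M = {x\<in>R. \<theta> x = ascale (-1) x} \<and>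
      compact_hat br \<sigma> U {aadd k (ascale \<i> m) | k m. k \<in> K \<and> m \<in> M})"

end

theory Submission
  imports Defs "HOL-Computational_Algebra.Fundamental_Theorem_Algebra"
begin

text \<open>
  Every linear automorphism of the affine algebra preserves the derived algebra and its centre, so it induces an
  automorphism of the loop algebra and of its centroid, the periodic functions. Compatibility with the derivation
  \<open>d\<close> forces the latter to be a change of parameter \<open>t \<mapsto> \<plusminus>t + s\<close>; hence the automorphism acts
  pointwise, by a smooth curve in the automorphism group of the simple Lie algebra.

  Let \<open>\<omega>\<close> be the conjugation with respect to the compact form. For a conjugate \<open>\<xi>\<close> of \<open>\<omega>\<close> the product
  \<open>\<xi> \<omega>\<close> acts pointwise by positive self-adjoint automorphisms, so it has a unique positive square root; the
  root is again smooth in \<open>t\<close>, and lifts to the affine algebra. By uniqueness it commutes with everything that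
  fixes \<open>\<omega>\<close> and \<open>\<xi>\<close>, it conjugates \<open>\<omega>\<close> to \<open>\<xi>\<close>, and the square root of the square root yields a midpoint of
  \<open>\<omega>\<close> and \<open>\<xi>\<close>. This is the polar decomposition (Hadamard geometry) from which Cartan's classical arguments
  follow: a linear or antilinear involution fixes the midpoint of \<open>\<omega>\<close> and its image, so up to conjugacy it commutes
  with \<open>\<omega>\<close>, and involutions commuting with \<open>\<omega>\<close> that are conjugate are conjugate by something commuting with \<open>\<omega>\<close>.
\<close>

text \<open>Automorphisms are purely algebraic here: no continuity is assumed, so all analytic
  information about them has to come out of algebra. The lever is the Casimir identity along a
  moving frame that untwists \<sigma>: it writes every loop as a finite sum of brackets of loops.
  This places the loops in the derived algebra up to the centre, makes module maps pointwise, and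
  lets a lift be recovered from its pointwise part. Points of the circle are recovered from units: a
  periodic function without zeros is invertible, and the image of a unit has no zeros.

  A pointwise family determines its lift only up to \<open>shift\<close>, the automorphisms d |-> d
  + r c. This kernel has no torsion, so positive roots remain unique after lifting, and the defect
  of a lifted root is removed by halving r.

  Smoothness of the root is a bootstrap. Its difference quotients solve a Sylvester equation
  exactly, which yields the first derivative; an algebra of functions closed under differentiation
  yields the others. A lift exists because T' T^-1 is a derivation of the simple algebra, hence
  inner, and this supplies the image of d.\<close>

section \<open>Smooth curves and algebras of functions closed under differentiation\<close>

lemma hder_Suc': "hder (Suc k) f = hder k (\<lambda>t. vector_derivative f (at t))"
  by (induction k) auto

lemma smooth_has_vector_derivative:
  assumes "smooth f"
  shows "(f has_vector_derivative vector_derivative f (at t)) (at t)"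
  using assms unfolding smooth_def
  by (metis hder.simps(1) vector_derivative_works)

lemma smooth_vector_derivative:
  assumes "smooth f"
  shows "smooth (\<lambda>t. vector_derivative f (at t))"
  using assms unfolding smooth_def by (metis hder_Suc')

text \<open>A family in which every member has its derivative again contains all iterated
  derivatives, so smoothness can be shown without a formula for the k-th derivative.\<close>

lemma smooth_coinduct:
  assumes "f \<in> F" and step: "\<And>f. f \<in> F \<Longrightarrow> \<exists>g\<in>F. \<forall>t. (f has_vector_derivative g t) (at t)"
  shows "smooth f"
proof -
  have "hder k f \<in> F" for k
  proof (induction k)
    case (Suc k)
    then obtain g where "g \<in> F" "\<forall>t. (hder k f has_vector_derivative g t) (at t)"
      using step by blast
    moreover from this have "hder (Suc k) f = g"
      by (auto simp: vector_derivative_at)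
    ultimately show ?case by simp
  qed (use assms in simp)
  then have "\<exists>g. (hder k f has_vector_derivative g) (at t)" for k t
    by (meson step)
  then show ?thesis
    unfolding smooth_def by (meson differentiableI_vector)
qed

lemma smooth_continuous: "smooth f \<Longrightarrow> continuous_on S f"
  unfolding smooth_def
  by (metis continuous_at_imp_continuous_on differentiable_imp_continuous_within hder.simps(1))

lemma smooth_const [simp]: "smooth (\<lambda>t. c)"
proof (rule smooth_coinduct[where F = "{(\<lambda>t. c), (\<lambda>t. 0)}"])
  show "\<exists>g\<in>{(\<lambda>t. c), (\<lambda>t. 0)}. \<forall>t. (f has_vector_derivative g t) (at t)"
    if "f \<in> {(\<lambda>t. c), (\<lambda>t. 0)}" for f :: "real \<Rightarrow> 'a"
    using that by (auto intro!: derivative_eq_intros)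
qed simp

lemma smooth_bounded_linear:
  assumes B: "bounded_linear B" and "smooth f"
  shows "smooth (\<lambda>t. B (f t))"
proof (rule smooth_coinduct[where F = "{\<lambda>t. B (f t) | f. smooth f}"])
  fix h assume "h \<in> {\<lambda>t. B (f t) | f. smooth f}"
  then obtain f where f: "h = (\<lambda>t. B (f t))" "smooth f" by blast
  then have "\<forall>t. (h has_vector_derivative B (vector_derivative f (at t))) (at t)"
    using bounded_linear.has_vector_derivative[OF B] smooth_has_vector_derivative by blast
  then show "\<exists>g\<in>{\<lambda>t. B (f t) | f. smooth f}. \<forall>t. (h has_vector_derivative g t) (at t)"
    using smooth_vector_derivative[OF f(2)]
    by (intro bexI[of _ "\<lambda>t. B (vector_derivative f (at t))"]) auto
qed (use assms in blast)

lemma smooth_affine: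
  assumes "smooth f"
  shows "smooth (\<lambda>t. f (e * t + s))"
\<comment> \<open>The family carries a scalar \<open>c\<close> because each differentiation produces
  another factor \<open>e\<close>.\<close>
proof (rule smooth_coinduct[where F = "{\<lambda>t. c *\<^sub>R f (e * t + s) | f c. smooth f}"])
  fix h assume "h \<in> {\<lambda>t. c *\<^sub>R f (e * t + s) | f c. smooth f}"
  then obtain f c where f: "h = (\<lambda>t. c *\<^sub>R f (e * t + s))" "smooth f" by blast
  have "((\<lambda>t. e * t + s) has_vector_derivative e) (at t)" for t
    by (auto intro!: derivative_eq_intros)
  then have "((\<lambda>t. f (e * t + s)) has_vector_derivative e *\<^sub>R vector_derivative f (at (e * t + s))) (at t)" for t
    using vector_diff_chain_at[of "\<lambda>t. e * t + s" e t f, OF _ smooth_has_vector_derivative[OF f(2)]]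
    by (simp add: o_def)
  then have "(h has_vector_derivative (c * e) *\<^sub>R vector_derivative f (at (e * t + s))) (at t)" for t
    unfolding f using has_vector_derivative_scaleR[OF DERIV_const[of c]] by fastforce
  then show "\<exists>g\<in>{\<lambda>t. c *\<^sub>R f (e * t + s) | f c. smooth f}. \<forall>t. (h has_vector_derivative g t) (at t)"
    using smooth_vector_derivative[OF f(2)]
    by (intro bexI[of _ "\<lambda>t. (c * e) *\<^sub>R vector_derivative f (at (e * t + s))"]) auto
next
  show "(\<lambda>t. f (e * t + s)) \<in> {\<lambda>t. c *\<^sub>R f (e * t + s) | f c. smooth f}"
    using assms by (intro CollectI exI[of _ f] exI[of _ 1]) auto
qed

text \<open>Polynomials in the functions of \<open>G\<close> with smooth coefficients. The members
  of \<open>G\<close> are not assumed smooth: their smoothness is what closure under differentiation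
  is meant to prove.\<close>

inductive_set smooth_alg :: "(real \<Rightarrow> complex) set \<Rightarrow> (real \<Rightarrow> complex) set" for G where
  base: "smooth f \<Longrightarrow> f \<in> smooth_alg G"
| gen: "f \<in> G \<Longrightarrow> f \<in> smooth_alg G"
| add: "f \<in> smooth_alg G \<Longrightarrow> g \<in> smooth_alg G \<Longrightarrow> (\<lambda>t. f t + g t) \<in> smooth_alg G"
| mult: "f \<in> smooth_alg G \<Longrightarrow> g \<in> smooth_alg G \<Longrightarrow> (\<lambda>t. f t * g t) \<in> smooth_alg G"

lemma smooth_alg_mono: "f \<in> smooth_alg G0 \<Longrightarrow> G0 \<subseteq> G \<Longrightarrow> f \<in> smooth_alg G"
  by (induction rule: smooth_alg.induct) (auto intro: smooth_alg.intros)

text \<open>Two generating sets because of the inverse of a determinant: its derivative contains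
  that of the determinant, a polynomial in the entries \<open>G0\<close> alone, while the
  derivatives of the entries involve that inverse and lie in the algebra of the larger
  \<open>G\<close>.\<close>

lemma smooth_alg_derivative:
  assumes "f \<in> smooth_alg G0" "G0 \<subseteq> G"
    and G: "\<And>g. g \<in> G0 \<Longrightarrow> \<exists>g'\<in>smooth_alg G. \<forall>t. (g has_vector_derivative g' t) (at t)"
  shows "\<exists>g\<in>smooth_alg G. \<forall>t. (f has_vector_derivative g t) (at t)"
  using assms(1)
proof induction
  case (base f)
  then show ?case
    by (intro bexI[of _ "\<lambda>t. vector_derivative f (at t)"] smooth_alg.base smooth_vector_derivative)
      (simp_all add: smooth_has_vector_derivative)
next
  case (add f g)
  then obtain f' g' where "f' \<in> smooth_alg G" "g' \<in> smooth_alg G"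
    "\<forall>t. (f has_vector_derivative f' t) (at t)" "\<forall>t. (g has_vector_derivative g' t) (at t)"
    by blast
  then show ?case
    by (intro bexI[of _ "\<lambda>t. f' t + g' t"]) (auto intro: smooth_alg.add derivative_eq_intros)
next
  case (mult f g)
  then obtain f' g' where "f' \<in> smooth_alg G" "g' \<in> smooth_alg G"
    "\<forall>t. (f has_vector_derivative f' t) (at t)" "\<forall>t. (g has_vector_derivative g' t) (at t)"
    by blast
  moreover have "f \<in> smooth_alg G" "g \<in> smooth_alg G"
    using mult.hyps assms(2) by (auto intro: smooth_alg_mono)
  ultimately show ?case
    by (intro bexI[of _ "\<lambda>t. f t * g' t + f' t * g t"])
      (auto intro: smooth_alg.add smooth_alg.mult has_vector_derivative_mult)
qed (fact G)

text \<open>An algebra is smooth as soon as the derivatives of its generators lie in it again;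
  the generators may be a solution of a differential equation or an inverse.\<close>

lemma smooth_alg_smooth:
  assumes "f \<in> smooth_alg G"
    and "\<And>g. g \<in> G \<Longrightarrow> \<exists>g'\<in>smooth_alg G. \<forall>t. (g has_vector_derivative g' t) (at t)"
  shows "smooth f"
  using assms(1) by (rule smooth_coinduct) (rule smooth_alg_derivative[OF _ order_refl assms(2)])

lemma smooth_alg_sum:
  assumes "\<And>i. i \<in> I \<Longrightarrow> f i \<in> smooth_alg G"
  shows "(\<lambda>t. \<Sum>i\<in>I. f i t) \<in> smooth_alg G"
  using assms
  by (induction I rule: infinite_finite_induct) (auto intro: smooth_alg.intros)

lemma smooth_alg_prod:
  assumes "\<And>i. i \<in> I \<Longrightarrow> f i \<in> smooth_alg G"
  shows "(\<lambda>t. \<Prod>i\<in>I. f i t) \<in> smooth_alg G"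
  using assms
  by (induction I rule: infinite_finite_induct) (auto intro: smooth_alg.intros)

lemma smooth_add:
  fixes f g :: "real \<Rightarrow> complex"
  shows "smooth f \<Longrightarrow> smooth g \<Longrightarrow> smooth (\<lambda>t. f t + g t)"
  by (rule smooth_alg_smooth[where G = "{}"]) (auto intro: smooth_alg.intros)

lemma smooth_mult:
  fixes f g :: "real \<Rightarrow> complex"
  shows "smooth f \<Longrightarrow> smooth g \<Longrightarrow> smooth (\<lambda>t. f t * g t)"
  by (rule smooth_alg_smooth[where G = "{}"]) (auto intro: smooth_alg.intros)

lemma smooth_sum:
  fixes f :: "'i \<Rightarrow> real \<Rightarrow> complex"
  shows "(\<And>i. i \<in> I \<Longrightarrow> smooth (f i)) \<Longrightarrow> smooth (\<lambda>t. \<Sum>i\<in>I. f i t)"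
  by (rule smooth_alg_smooth[where G = "{}"]) (auto intro: smooth_alg.base smooth_alg_sum)

lemma smooth_exp: "smooth (\<lambda>t. exp (c * complex_of_real t))"
proof (rule smooth_alg_smooth[where G = "{\<lambda>t. exp (c * of_real t)}"])
  fix g assume g: "g \<in> {\<lambda>t. exp (c * complex_of_real t)}"
  have "((\<lambda>z. exp (c * z)) has_field_derivative c * exp (c * of_real t)) (at (of_real t))" for t
    by (auto intro!: derivative_eq_intros)
  then have "((\<lambda>t. exp (c * of_real t)) has_vector_derivative c * exp (c * of_real t)) (at t)" for t
    by (rule has_vector_derivative_real_field)
  then show "\<exists>g'\<in>smooth_alg {\<lambda>t. exp (c * of_real t)}. \<forall>t. (g has_vector_derivative g' t) (at t)"
    using g by (intro bexI[of _ "\<lambda>t. c * exp (c * of_real t)"])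
      (auto intro: smooth_alg.mult[OF smooth_alg.base[OF smooth_const] smooth_alg.gen])
qed (auto intro: smooth_alg.intros)

lemma has_vector_derivative_inverse_complex:
  fixes f :: "real \<Rightarrow> complex"
  assumes "(f has_vector_derivative f') (at t)" "f t \<noteq> 0"
  shows "((\<lambda>t. inverse (f t)) has_vector_derivative - f' * (inverse (f t) * inverse (f t))) (at t)"
  using field_vector_diff_chain_at[OF assms(1) DERIV_inverse[OF assms(2)]]
  by (simp add: o_def power2_eq_square)

text \<open>The derivative -f' (1/f)^2 is again a polynomial in 1/f with smooth
  coefficients.\<close>

lemma smooth_inverse:
  fixes f :: "real \<Rightarrow> complex"
  assumes f: "smooth f" "\<And>t. f t \<noteq> 0"
  shows "smooth (\<lambda>t. inverse (f t))"
proof (rule smooth_alg_smooth[where G = "{\<lambda>t. inverse (f t)}"])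
  fix g assume g: "g \<in> {\<lambda>t. inverse (f t)}"
  let ?d = "\<lambda>t. - vector_derivative f (at t) * (inverse (f t) * inverse (f t))"
  have "smooth (\<lambda>t. - vector_derivative f (at t))"
    using smooth_bounded_linear[OF bounded_linear_minus[OF bounded_linear_ident] smooth_vector_derivative[OF f(1)]] .
  then have "?d \<in> smooth_alg {\<lambda>t. inverse (f t)}"
    by (intro smooth_alg.mult[OF smooth_alg.base smooth_alg.mult[OF smooth_alg.gen smooth_alg.gen]]) auto
  moreover have "\<forall>t. (g has_vector_derivative ?d t) (at t)"
    using g f has_vector_derivative_inverse_complex smooth_has_vector_derivative by fastforce
  ultimately show "\<exists>g'\<in>smooth_alg {\<lambda>t. inverse (f t)}. \<forall>t. (g has_vector_derivative g' t) (at t)"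
    by (intro bexI[of _ ?d])
qed (auto intro: smooth_alg.intros)

section \<open>Curves in coordinate spaces\<close>

lemma vec_sum_axis: "(x :: 'a::real_normed_field ^ 'n::finite) = (\<Sum>i\<in>UNIV. axis i (x $ i))"
  by (simp add: vec_eq_iff axis_def)

lemma bounded_linear_axis: "bounded_linear (axis i :: 'a::real_normed_vector \<Rightarrow> 'a ^ 'n::finite)"
proof (rule bounded_linear_intro[where K = 1])
  show "norm (axis i x :: 'a ^ 'n) \<le> norm x * 1" for x :: 'a
  proof -
    have "norm (axis i x :: 'a ^ 'n) \<le> (\<Sum>j\<in>UNIV. norm ((axis i x :: 'a ^ 'n) $ j))"
      unfolding norm_vec_def by (rule L2_set_le_sum) simp
    also have "\<dots> = (\<Sum>j\<in>UNIV. if j = i then norm x else 0)"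
      by (rule sum.cong) (auto simp: axis_def)
    finally show ?thesis by simp
  qed
qed (auto simp: vec_eq_iff axis_def)

lemma has_vector_derivative_vec:
  fixes u :: "real \<Rightarrow> 'a::real_normed_field ^ 'n::finite"
  assumes "\<And>i. ((\<lambda>t. u t $ i) has_vector_derivative u' $ i) F"
  shows "(u has_vector_derivative u') F"
proof -
  have "((\<lambda>t. \<Sum>i\<in>UNIV. axis i (u t $ i)) has_vector_derivative (\<Sum>i\<in>UNIV. axis i (u' $ i))) F"
    by (intro has_vector_derivative_sum bounded_linear.has_vector_derivative[OF bounded_linear_axis] assms)
  then show ?thesis by (simp only: vec_sum_axis[symmetric])
qed

lemma smooth_vec_iff:
  fixes u :: "real \<Rightarrow> 'a::real_normed_field ^ 'n::finite"
  shows "smooth u \<longleftrightarrow> (\<forall>i. smooth (\<lambda>t. u t $ i))"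
proof
  assume "\<forall>i. smooth (\<lambda>t. u t $ i)"
  then show "smooth u"
  proof (intro smooth_coinduct[where F = "{u. \<forall>i. smooth (\<lambda>t. u t $ i)}"])
    fix v :: "real \<Rightarrow> 'a ^ 'n"
    assume v: "v \<in> {u. \<forall>i. smooth (\<lambda>t. u t $ i)}"
    let ?v' = "\<lambda>t. \<chi> i. vector_derivative (\<lambda>t. v t $ i) (at t)"
    have c: "smooth (\<lambda>t. v t $ i)" for i using v by simp
    have "(v has_vector_derivative ?v' t) (at t)" for t
      by (rule has_vector_derivative_vec) (use smooth_has_vector_derivative[OF c] in simp)
    moreover have "?v' \<in> {u. \<forall>i. smooth (\<lambda>t. u t $ i)}"
      using smooth_vector_derivative[OF c] by simp
    ultimately show "\<exists>g\<in>{u. \<forall>i. smooth (\<lambda>t. u t $ i)}. \<forall>t. (v has_vector_derivative g t) (at t)"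
      by (intro bexI[of _ ?v'] allI)
  qed simp
qed (intro allI smooth_bounded_linear[OF bounded_linear_vec_nth])

lemma smooth_vec_add:
  fixes u v :: "real \<Rightarrow> complex ^ 'n::finite"
  shows "smooth u \<Longrightarrow> smooth v \<Longrightarrow> smooth (\<lambda>t. u t + v t)"
  unfolding smooth_vec_iff by (simp add: smooth_add)

lemma smooth_vec_scale:
  fixes u :: "real \<Rightarrow> complex ^ 'n::finite"
  shows "smooth f \<Longrightarrow> smooth u \<Longrightarrow> smooth (\<lambda>t. f t *s u t)"
  unfolding smooth_vec_iff by (simp add: smooth_mult)

lemma smooth_vec_sum:
  fixes u :: "'i \<Rightarrow> real \<Rightarrow> complex ^ 'n::finite"
  shows "(\<And>i. i \<in> I \<Longrightarrow> smooth (u i)) \<Longrightarrow> smooth (\<lambda>t. \<Sum>i\<in>I. u i t)"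
  unfolding smooth_vec_iff by (simp add: smooth_sum)

section \<open>Complex linear maps\<close>

definition clin :: "(complex^'n::finite \<Rightarrow> complex^'m::finite) \<Rightarrow> bool" where
  "clin f \<longleftrightarrow> (\<forall>x y. f (x + y) = f x + f y) \<and> (\<forall>c x. f (c *s x) = c *s f x)"

lemma clin_linear: "clin f \<longleftrightarrow> Vector_Spaces.linear (*s) (*s) f"
  unfolding Vector_Spaces.linear_iff clin_def by (simp add: vec.vector_space_axioms)

lemma clin_add: "clin f \<Longrightarrow> f (x + y) = f x + f y"
  and clin_scale: "clin f \<Longrightarrow> f (c *s x) = c *s f x"
  by (auto simp: clin_def)

lemma clin_0: "clin f \<Longrightarrow> f 0 = 0"
  using clin_scale[of f 0 0] by simp

lemma clin_minus: "clin f \<Longrightarrow> f (- x) = - f x"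
  using clin_scale[of f "- 1" x] by simp

lemma clin_diff: "clin f \<Longrightarrow> f (x - y) = f x - f y"
  using clin_add[of f x "- y"] by (simp add: clin_minus)

lemma clin_sum: "clin f \<Longrightarrow> f (\<Sum>i\<in>I. g i) = (\<Sum>i\<in>I. f (g i))"
  by (induction I rule: infinite_finite_induct) (auto simp: clin_0 clin_add)

lemma scaleR_vec_complex: "r *\<^sub>R x = complex_of_real r *s (x :: complex^'n::finite)"
  by (simp add: vec_eq_iff scaleR_conv_of_real[where 'a = complex])

lemma clin_bounded_linear: "clin f \<Longrightarrow> bounded_linear f"
  by (rule linear_conv_bounded_linear[THEN iffD1], rule linearI)
    (auto simp: scaleR_vec_complex clin_add clin_scale)

lemma clin_expand: "clin f \<Longrightarrow> f x = (\<Sum>i\<in>UNIV. x $ i *s f (axis i 1))"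
  using clin_sum[of f "\<lambda>i. x $ i *s axis i 1" UNIV] by (simp add: clin_scale basis_expansion)

lemma clin_surj_imp_inj:
  fixes f :: "complex^'n::finite \<Rightarrow> complex^'n"
  shows "clin f \<Longrightarrow> surj f \<Longrightarrow> inj f"
  unfolding clin_linear by (rule vec.linear_surjective_imp_injective) auto

lemma clin_inj_imp_surj:
  fixes f :: "complex^'n::finite \<Rightarrow> complex^'n"
  shows "clin f \<Longrightarrow> inj f \<Longrightarrow> surj f"
  unfolding clin_linear by (rule vec.linear_injective_imp_surjective) auto

lemma clin_inj: "clin f \<Longrightarrow> (\<And>x. f x = 0 \<Longrightarrow> x = 0) \<Longrightarrow> inj f"
  using clin_diff[of f] by (intro injI) (metis right_minus_eq)

lemma clin_inv: "clin f \<Longrightarrow> bij f \<Longrightarrow> clin (inv f)"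
proof -
  assume f: "clin f" "bij f"
  then have "f (inv f y) = y" "inv f (f x) = x" for x y
    by (simp_all add: bij_is_surj surj_f_inv_f bij_is_inj)
  then show ?thesis
    using f(1) unfolding clin_def by (metis)
qed

lemma clin_eq_on_span:
  assumes "clin f" "clin g" "vec.span S = UNIV" "\<And>x. x \<in> S \<Longrightarrow> f x = g x"
  shows "f x = g x"
proof -
  have "x \<in> vec.span S" using assms(3) by simp
  then show ?thesis
    by (induction rule: vec.span_induct_alt) (auto simp: assms clin_0 clin_add clin_scale)
qed

lemma span_UNIV_mono:
  assumes "vec.span S = UNIV" "S \<subseteq> vec.span S'"
  shows "vec.span S' = UNIV"
  using vec.span_minimal[OF assms(2) vec.subspace_span] assms(1) by auto

text \<open>Scalars may change under \<open>f\<close> as long as multiples of x in \<open>S\<close>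
  go to multiples of \<open>f x\<close>, so the lemma covers antilinear maps as well.\<close>

lemma span_UNIV_image:
  assumes "vec.span S = UNIV" "surj f" "f 0 = 0" "\<And>x y. f (x + y) = f x + f y"
    "\<And>c x. x \<in> S \<Longrightarrow> \<exists>c'. f (c *s x) = c' *s f x" "\<And>x. x \<in> S \<Longrightarrow> f x \<in> S'"
  shows "vec.span (S' :: (complex^'n::finite) set) = UNIV"
proof -
  have "f x \<in> vec.span S'" for x
  proof -
    have "x \<in> vec.span S" using assms(1) by simp
    then show ?thesis
    proof (induction rule: vec.span_induct_alt)
      case (step c x y)
      obtain c' where "f (c *s x) = c' *s f x"
        using assms(5) step by blast
      then show ?case
        using step assms(4,6) by (simp add: vec.span_add vec.span_scale vec.span_base)
    qed (use assms(3) vec.span_zero in auto)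
  qed
  then show ?thesis using \<open>surj f\<close> by (metis UNIV_eq_I surjD)
qed

subsection \<open>Diagonalisability\<close>

text \<open>\<open>papp T p x\<close> is p(T) x, evaluated by Horner's scheme.\<close>

definition papp :: "(complex^'n::finite \<Rightarrow> complex^'n) \<Rightarrow> complex poly \<Rightarrow> complex^'n \<Rightarrow> complex^'n" where
  "papp T p = fold_coeffs (\<lambda>a f x. a *s x + f (T x)) p (\<lambda>x. 0)"

lemma papp_0 [simp]: "papp T 0 x = 0"
  by (simp add: papp_def)

lemma papp_pCons [simp]: "papp T (pCons a p) x = a *s x + papp T p (T x)"
  by (cases "p = 0 \<and> a = 0") (auto simp: papp_def)

context
  fixes T :: "complex^'n::finite \<Rightarrow> complex^'n"
  assumes T: "clin T"
begin

lemma clin_papp: "clin (papp T p)"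
proof (induction p)
  case (pCons a p)
  then show ?case
    using T unfolding clin_def by (simp add: vec.scale_right_distrib algebra_simps)
qed (simp add: clin_def)

lemma papp_add: "papp T (p + q) x = papp T p x + papp T q x"
proof (induction p q arbitrary: x rule: poly_induct2)
  case (pCons a p b q)
  then show ?case by (simp add: vec.scale_left_distrib algebra_simps)
qed simp

lemma papp_smult: "papp T (smult c p) x = c *s papp T p x"
  by (induction p arbitrary: x) (auto simp: vec.scale_right_distrib)

lemma papp_linear_factor: "papp T ([:- a, 1:] * q) x = papp T q (T x - a *s x)"
proof -
  have "[:- a, 1:] * q = pCons 0 q + smult (- a) q" by simp
  then show ?thesis
    by (simp only: papp_add papp_smult papp_pCons)
      (simp add: clin_diff[OF clin_papp] clin_scale[OF clin_papp] vec.scale_minus_left)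
qed

lemma papp_monom: "papp T (monom c k) x = c *s (T ^^ k) x"
  by (induction k arbitrary: x) (auto simp: monom_0 monom_Suc funpow_swap1)

text \<open>Otherwise x, T x, T^2 x, ... would be linearly independent. An annihilator of a single
  vector is all that the inductions below consume, so the minimal polynomial of \<open>T\<close>
  never appears.\<close>

lemma ex_annihilating_poly: "\<exists>p. p \<noteq> 0 \<and> papp T p x = 0"
proof (rule ccontr)
  assume none: "\<not> ?thesis"
  \<comment> \<open>The cardinality is carried along because the image of \<open>{..<k}\<close>
    could otherwise collapse.\<close>
  have "vec.independent ((\<lambda>j. (T ^^ j) x) ` {..<k}) \<and> card ((\<lambda>j. (T ^^ j) x) ` {..<k}) = k" for k
  proof (induction k)
    case (Suc k)
    \<comment> \<open>The disjunct \<open>p = 0\<close> serves k = 0, where no degree lies below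
      \<open>k\<close>.\<close>
    let ?V = "{papp T p x | p. degree p < k \<or> p = 0}"
    have "vec.subspace ?V"
    proof (rule vec.subspaceI)
      show "0 \<in> ?V" by (auto intro!: exI[of _ 0])
    next
      fix u v assume "u \<in> ?V" "v \<in> ?V"
      then obtain p q where "u = papp T p x" "degree p < k \<or> p = 0" "v = papp T q x" "degree q < k \<or> q = 0"
        by blast
      then show "u + v \<in> ?V"
        by (auto simp flip: papp_add intro!: exI[of _ "p + q"] degree_add_less)
    next
      fix c u assume "u \<in> ?V"
      then obtain p where "u = papp T p x" "degree p < k \<or> p = 0" by blast
      then show "c *s u \<in> ?V"
        using degree_smult_le[of c p] by (auto simp flip: papp_smult intro!: exI[of _ "smult c p"])
    qed
    moreover have "(\<lambda>j. (T ^^ j) x) ` {..<k} \<subseteq> ?V"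
    proof clarify
      fix j assume "j < k"
      then show "\<exists>p. (T ^^ j) x = papp T p x \<and> (degree p < k \<or> p = 0)"
        by (intro exI[of _ "monom 1 j"]) (auto simp: papp_monom degree_monom_eq)
    qed
    ultimately have sub: "vec.span ((\<lambda>j. (T ^^ j) x) ` {..<k}) \<subseteq> ?V"
      by (rule vec.span_minimal[rotated])
    have "(T ^^ k) x \<notin> ?V"
    proof clarify
      fix p assume p: "(T ^^ k) x = papp T p x" "degree p < k \<or> p = 0"
      have "papp T (monom 1 k + smult (- 1) p) x = 0"
        unfolding papp_add papp_smult papp_monom using p by simp
      moreover have "coeff (monom 1 k + smult (- 1) p) k = 1"
        using p(2) by (auto simp: coeff_eq_0)
      ultimately show False using none by (metis coeff_0 zero_neq_one)
    qed
    with sub have n: "(T ^^ k) x \<notin> vec.span ((\<lambda>j. (T ^^ j) x) ` {..<k})" by blast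
    moreover have "(T ^^ k) x \<notin> (\<lambda>j. (T ^^ j) x) ` {..<k}"
      using n by (rule contrapos_nn) (rule vec.span_base)
    ultimately show ?case
      using Suc by (simp add: lessThan_Suc vec.independent_insert)
  qed (simp add: vec.independent_empty)
  then obtain S :: "(complex^'n) set" where "vec.independent S" "card S = Suc (vec.dim (UNIV :: (complex^'n) set))"
    by blast
  moreover from this have "card S \<le> vec.dim (UNIV :: (complex^'n) set)"
    using vec.dim_subset_UNIV[of S] vec.dim_eq_card_independent[of S] by (simp add: vec.dimension_def)
  ultimately show False by simp
qed

text \<open>Split a root a off the annihilating polynomial of x: either (T - a) x = 0 and x is an
  eigenvector, or (T - a) x is a nonzero vector annihilated by a polynomial of smaller
  degree.\<close>

lemma ex_eigenvector: "\<exists>v l. v \<noteq> 0 \<and> T v = l *s v"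
proof -
  have "\<exists>v l. v \<noteq> 0 \<and> T v = l *s v" if "p \<noteq> 0" "papp T p x = 0" "x \<noteq> 0" for p x
    using that
  proof (induction "degree p" arbitrary: p x)
    case 0
    then obtain c where "p = [:c:]" "c \<noteq> 0" using degree_eq_zeroE[of p] by (metis pCons_0_0)
    then show ?case using 0 by simp
  next
    case (Suc n)
    then obtain a where "poly p a = 0"
      using alg_closed_imp_poly_has_root[of p] by auto
    then obtain q where q: "p = [:- a, 1:] * q" by (metis dvdE poly_eq_0_iff_dvd)
    then have "q \<noteq> 0" using Suc by auto
    then have "degree q = n" using q Suc(2) degree_mult_eq[of "[:- a, 1:]" q] by simp
    have "papp T q (T x - a *s x) = 0"
      using Suc q by (simp only: papp_linear_factor)
    then show ?case
      using Suc(1)[of q "T x - a *s x"] \<open>q \<noteq> 0\<close> \<open>degree q = n\<close> Suc(5)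
      by (cases "T x - a *s x = 0") auto
  qed
  moreover have "axis undefined 1 \<noteq> (0 :: complex^'n)" by (simp add: axis_eq_0_iff)
  ultimately show ?thesis using ex_annihilating_poly by blast
qed

text \<open>The hypothesis says that (T - l)^2 x = 0 implies (T - l) x = 0, so there are no Jordan
  blocks of size above one. Induction on the degree of a polynomial annihilating x puts x into the
  span of the eigenvectors.\<close>

lemma semisimple_diagonalizable:
  assumes ss: "\<And>l x. T (T x - l *s x) = l *s (T x - l *s x) \<Longrightarrow> T x = l *s x"
  shows "vec.span {v. \<exists>l. T v = l *s v} = UNIV"
proof -
  let ?E = "{v. \<exists>l. T v = l *s v}"
  \<comment> \<open>Work modulo the image of T - a on that span. An eigenvector v for l is (T - a)(v
    / (l - a)) if l differs from a, and is itself killed by T - a if l = a; so the remainder of y is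
    killed by T - a.\<close>
  have red: "\<exists>z\<in>vec.span ?E. T (y - (T z - a *s z)) = a *s (y - (T z - a *s z))"
    if "y \<in> vec.span ?E" for y a
    using that
  proof (induction rule: vec.span_induct_alt)
    case base
    show ?case by (rule bexI[of _ 0]) (simp_all add: clin_0[OF T] vec.span_zero)
  next
    case (step c v y)
    then obtain z l where z: "z \<in> vec.span ?E" "T (y - (T z - a *s z)) = a *s (y - (T z - a *s z))"
      and l: "T v = l *s v" by blast
    show ?case
    proof (cases "l = a")
      case True
      have "T (c *s v + y - (T z - a *s z)) = T (c *s v) + T (y - (T z - a *s z))"
        by (metis clin_add[OF T] add_diff_eq)
      then show ?thesis using z l True
        by (intro bexI[of _ z])
          (auto simp: clin_scale[OF T] vec.scale_right_distrib vec.scale_right_diff_distrib)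
    next
      case False
      define q where "q = c / (l - a)"
      then have "c = q * (l - a)" using False by simp
      let ?z = "z + q *s v"
      have "c *s v = (q * l - a * q) *s v"
        unfolding \<open>c = q * (l - a)\<close> by (simp add: algebra_simps)
      then have "c *s v = q *s (l *s v) - a *s (q *s v)"
        by (simp only: vec.scale_left_diff_distrib vec.scale_scale)
      then have "c *s v + y - (T ?z - a *s ?z) = y - (T z - a *s z)"
        by (simp only: clin_add[OF T] clin_scale[OF T] l vec.scale_right_distrib) simp
      moreover have "?z \<in> vec.span ?E"
        by (intro vec.span_add[OF z(1)] vec.span_scale vec.span_base) (use l in blast)
      ultimately show ?thesis using z(2) by (intro bexI[of _ ?z]) (simp_all only:)
    qed
  qed
  have "x \<in> vec.span ?E" if "p \<noteq> 0" "papp T p x = 0" for p x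
    using that
  proof (induction "degree p" arbitrary: p x)
    case 0
    then obtain c where "p = [:c:]" "c \<noteq> 0" using degree_eq_zeroE[of p] by (metis pCons_0_0)
    then show ?case using 0 vec.span_zero by simp
  next
    case (Suc n)
    then obtain a where "poly p a = 0"
      using alg_closed_imp_poly_has_root[of p] by auto
    then obtain q where q: "p = [:- a, 1:] * q" by (metis dvdE poly_eq_0_iff_dvd)
    then have "q \<noteq> 0" using Suc by auto
    then have "degree q = n" using q Suc(2) degree_mult_eq[of "[:- a, 1:]" q] by simp
    have "papp T q (T x - a *s x) = 0"
      using Suc q by (simp only: papp_linear_factor)
    then have "T x - a *s x \<in> vec.span ?E"
      using Suc(1) \<open>q \<noteq> 0\<close> \<open>degree q = n\<close> by blast
    then obtain z where z: "z \<in> vec.span ?E"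
      "T (T x - a *s x - (T z - a *s z)) = a *s (T x - a *s x - (T z - a *s z))"
      using red by blast
    \<comment> \<open>The remainder equals (T - a)(x - z) and is killed by T - a, so
      \<open>ss\<close> makes x - z an eigenvector.\<close>
    have "T x - a *s x - (T z - a *s z) = T (x - z) - a *s (x - z)"
      by (simp add: clin_diff[OF T] vec.scale_right_diff_distrib)
    then have "T (x - z) = a *s (x - z)"
      using ss z by metis
    then have "x - z \<in> vec.span ?E" by (intro vec.span_base) blast
    then show ?case using z vec.span_add[of "x - z" ?E z] by simp
  qed
  then show ?thesis using ex_annihilating_poly by blast
qed

end

text \<open>Diagonalisable with positive eigenvalues. Phrased without an inner product, so that the
  notion is invariant under conjugation by all linear and antilinear bijections
  (\<open>posdiag_conj\<close>).\<close>

definition posdiag :: "(complex^'n::finite \<Rightarrow> complex^'n) \<Rightarrow> bool" where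
  "posdiag T \<longleftrightarrow> clin T \<and> vec.span {v. \<exists>l>0. T v = complex_of_real l *s v} = UNIV"

lemma posdiag_clin: "posdiag T \<Longrightarrow> clin T"
  by (simp add: posdiag_def)

text \<open>T + l multiplies each spanning eigenvector by a positive number, so it is surjective
  and, in finite dimension, injective.\<close>

lemma posdiag_no_nonpos_eigenvalue:
  assumes "posdiag T" "0 \<le> l" "T y = - (complex_of_real l *s y)"
  shows "y = 0"
proof -
  let ?f = "\<lambda>x. T x + complex_of_real l *s x"
  have T: "clin T" using assms posdiag_def by blast
  have f: "clin ?f"
    using T by (simp add: clin_def vec.scale_right_distrib algebra_simps)
  have "x \<in> range ?f" for x
  proof -
    have "x \<in> vec.span {v. \<exists>l>0. T v = complex_of_real l *s v}"
      using assms unfolding posdiag_def by simp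
    then show ?thesis
    proof (induction rule: vec.span_induct_alt)
      case base
      show ?case by (rule range_eqI[of _ _ 0]) (simp add: clin_0[OF T])
    next
      case (step c v y)
      then obtain m w where m: "m > 0" "T v = complex_of_real m *s v" and w: "y = ?f w" by blast
      define q where "q = c / complex_of_real (m + l)"
      have "complex_of_real (m + l) \<noteq> 0"
        using m assms(2) by (simp del: of_real_add)
      then have "c = complex_of_real m * q + complex_of_real l * q"
        unfolding distrib_right[symmetric] of_real_add[symmetric] by (simp add: q_def)
      then have "c *s v = ?f (q *s v)"
        by (simp add: clin_scale[OF T] m vec.scale_left_distrib mult.commute)
      then show ?case
        by (intro range_eqI[of _ _ "q *s v + w"])
          (simp only: w clin_add[OF f])
    qed
  qed
  then have "inj ?f" using clin_surj_imp_inj[OF f] by blast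
  moreover have "?f y = ?f 0" using assms(3) by (simp add: clin_0[OF T])
  ultimately show ?thesis by (meson injD)
qed

lemma posdiag_bij: "posdiag T \<Longrightarrow> bij T"
proof -
  assume T: "posdiag T"
  then have "inj T"
    using posdiag_no_nonpos_eigenvalue[OF T, of 0] by (intro clin_inj posdiag_clin) auto
  then show ?thesis
    using clin_inj_imp_surj posdiag_clin[OF T] by (auto simp: bij_def)
qed

text \<open>\<open>X\<close> sends an eigenvector of \<open>T\<close> for l > 0 to a vector on which
  \<open>S\<close> acts as -l, and this vector must be 0. Both the uniqueness of square roots and
  the solvability of the Sylvester equation rest on this.\<close>

lemma posdiag_sylvester_inj:
  assumes S: "posdiag S" and T: "posdiag T" and X: "clin X" and 0: "\<And>v. S (X v) + X (T v) = 0"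
  shows "X v = 0"
proof (rule clin_eq_on_span[OF X, of "\<lambda>v. 0"])
  show "X v = 0" if v: "v \<in> {v. \<exists>l>0. T v = complex_of_real l *s v}" for v
  proof -
    from v obtain l where l: "l > 0" "T v = complex_of_real l *s v" by blast
    have "S (X v) + complex_of_real l *s X v = 0"
      using 0[of v] l by (simp add: clin_scale[OF X])
    then have "S (X v) = - (complex_of_real l *s X v)"
      by (simp add: eq_neg_iff_add_eq_0)
    then show ?thesis using posdiag_no_nonpos_eigenvalue[OF S, of l "X v"] l by simp
  qed
qed (use T in \<open>auto simp: posdiag_def clin_def\<close>)

text \<open>X = S - T satisfies S X + X T = S^2 - T^2 = 0.\<close>

lemma posdiag_sqrt_unique:
  assumes S: "posdiag S" and T: "posdiag T" and eq: "\<And>v. S (S v) = T (T v)"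
  shows "S = T"
proof
  fix v
  have S': "clin S" and T': "clin T" using S T by (auto simp: posdiag_def)
  have "S v - T v = 0"
  proof (rule posdiag_sylvester_inj[OF S T, of "\<lambda>v. S v - T v"])
    show "clin (\<lambda>v. S v - T v)"
      using S' T' by (simp add: clin_def vec.scale_right_diff_distrib algebra_simps)
  qed (simp add: clin_diff[OF S'] eq)
  then show "S v = T v" by simp
qed

lemma posdiag_sqrt_exists:
  assumes T: "posdiag T"
  shows "\<exists>S. posdiag S \<and> (\<forall>v. S (S v) = T v)"
proof -
  let ?E = "{v. \<exists>l>0. T v = complex_of_real l *s v}"
  obtain B where B: "B \<subseteq> ?E" "vec.independent B" "?E \<subseteq> vec.span B"
    using vec.maximal_independent_subset by blast
  have sp: "vec.span B = UNIV"
    using T span_UNIV_mono[OF _ B(3)] by (simp add: posdiag_def)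
  obtain l where l: "\<And>b. b \<in> B \<Longrightarrow> l b > 0 \<and> T b = complex_of_real (l b) *s b"
  proof -
    have "\<forall>b\<in>B. \<exists>l>0. T b = complex_of_real l *s b" using B(1) by blast
    from bchoice[OF this] show ?thesis using that by blast
  qed
  obtain S where S: "clin S" "\<And>b. b \<in> B \<Longrightarrow> S b = complex_of_real (sqrt (l b)) *s b"
    using vec.linear_independent_extend[OF B(2), of "\<lambda>b. complex_of_real (sqrt (l b)) *s b"]
    unfolding clin_linear by blast
  have "S (S v) = T v" for v
  proof (rule clin_eq_on_span[OF _ _ sp, of "\<lambda>v. S (S v)"])
    show "clin (\<lambda>v. S (S v))" using S(1) by (simp add: clin_def)
    show "S (S b) = T b" if "b \<in> B" for b
      using l[OF that] by (simp add: S(2)[OF that] clin_scale[OF S(1)] flip: of_real_mult)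
  qed (use T in \<open>simp add: posdiag_def\<close>)
  moreover have "B \<subseteq> {v. \<exists>l>0. S v = complex_of_real l *s v}"
    using S(2) l by (auto intro!: exI[of _ "sqrt (l _)"])
  then have "posdiag S"
    unfolding posdiag_def using S(1) span_UNIV_mono[OF sp order_trans[OF _ vec.span_superset]] by blast
  ultimately show ?thesis by blast
qed

text \<open>The vector w = S v - sqrt l v satisfies S w = - sqrt l w and therefore vanishes.\<close>

lemma posdiag_sqrt_eigenvector:
  assumes S: "posdiag S" and l: "l > 0" and v: "S (S v) = complex_of_real l *s v"
  shows "S v = complex_of_real (sqrt l) *s v"
proof -
  let ?w = "S v - complex_of_real (sqrt l) *s v"
  have "S ?w = - (complex_of_real (sqrt l) *s ?w)"
    using v l posdiag_clin[OF S]
    by (simp add: clin_diff clin_scale vec.scale_right_diff_distrib del: of_real_mult) (simp flip: of_real_mult)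
  then have "?w = 0" using posdiag_no_nonpos_eigenvalue[OF S, of "sqrt l" ?w] l by simp
  then show ?thesis by simp
qed

text \<open>Positive eigenvalues are real, so complex conjugation leaves them alone.
  \<open>T'\<close> is described by the intertwining relation, which keeps inverses of antilinear
  maps out of the proof.\<close>

lemma posdiag_conj:
  assumes T: "posdiag T" and f: "bij f" "\<And>x y. f (x + y) = f x + f y"
    and sc: "(\<forall>c x. f (c *s x) = c *s f x) \<or> (\<forall>c x. f (c *s x) = cnj c *s f x)"
    and T': "\<And>x. T' (f x) = f (T x)"
  shows "posdiag T'"
proof -
  have f0: "f 0 = 0" using f(2)[of 0 0] by simp
  have "clin T'" unfolding clin_def
  proof (intro conjI allI)
    fix x y
    obtain u v where "x = f u" "y = f v" using f(1) by (meson bij_pointE)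
    then show "T' (x + y) = T' x + T' y"
      by (simp add: T' clin_add[OF posdiag_clin[OF T]] flip: f(2))
  next
    fix c x
    obtain u where "x = f u" using f(1) by (meson bij_pointE)
    then have "\<exists>c'. c *s x = f (c' *s u) \<and> f (c' *s T u) = c *s f (T u)"
      using sc by (metis complex_cnj_cnj)
    then show "T' (c *s x) = c *s T' x"
      using \<open>x = f u\<close> T' by (auto simp: clin_scale[OF posdiag_clin[OF T]])
  qed
  moreover have "vec.span {v. \<exists>l>0. T' v = complex_of_real l *s v} = UNIV"
  proof (rule span_UNIV_image[where f = f and S = "{v. \<exists>l>0. T v = complex_of_real l *s v}"])
    show "f x \<in> {v. \<exists>l>0. T' v = complex_of_real l *s v}" if "x \<in> {v. \<exists>l>0. T v = complex_of_real l *s v}" for x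
    proof -
      from that obtain l where "l > 0" "T x = complex_of_real l *s x" by blast
      then have "T' (f x) = complex_of_real l *s f x"
        using sc T'[of x] by auto
      then show ?thesis using \<open>l > 0\<close> by blast
    qed
  qed (use T f f0 sc in \<open>auto simp: posdiag_def bij_is_surj\<close>)
  ultimately show ?thesis by (simp add: posdiag_def)
qed

lemma posdiag_inv:
  assumes T: "posdiag T"
  shows "posdiag (inv T)"
proof -
  have b: "bij T" using posdiag_bij[OF T] .
  have "inv T v = complex_of_real (inverse l) *s v" if "l > 0" "T v = complex_of_real l *s v" for l v
  proof -
    have "T (complex_of_real (inverse l) *s v) = v"
      using that by (simp add: clin_scale[OF posdiag_clin[OF T]] flip: of_real_inverse of_real_mult)
    then show ?thesis using b by (metis bij_inv_eq_iff)
  qed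
  then have "{v. \<exists>l>0. T v = complex_of_real l *s v} \<subseteq> {v. \<exists>l>0. inv T v = complex_of_real l *s v}"
    using positive_imp_inverse_positive by blast
  then show ?thesis
    using T clin_inv[OF posdiag_clin[OF T] b] span_UNIV_mono[OF _ order_trans[OF _ vec.span_superset]]
    unfolding posdiag_def by blast
qed

subsection \<open>Hermitian forms\<close>

definition herm :: "(complex^'n::finite \<Rightarrow> complex^'n \<Rightarrow> complex) \<Rightarrow> bool" where
  "herm h \<longleftrightarrow> (\<forall>x y z. h (x + y) z = h x z + h y z) \<and> (\<forall>c x y. h (c *s x) y = c * h x y) \<and>
     (\<forall>x y. h y x = cnj (h x y)) \<and> (\<forall>x. x \<noteq> 0 \<longrightarrow> Re (h x x) > 0)"

context
  fixes h :: "complex^'n::finite \<Rightarrow> complex^'n \<Rightarrow> complex"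
  assumes h: "herm h"
begin

lemma herm_add: "h (x + y) z = h x z + h y z"
  and herm_scale: "h (c *s x) y = c * h x y"
  and herm_cnj: "h y x = cnj (h x y)"
  and herm_pos: "x \<noteq> 0 \<Longrightarrow> Re (h x x) > 0"
  using h unfolding herm_def by blast+

lemma herm_add_right: "h x (y + z) = h x y + h x z"
  using herm_cnj[of x "y + z"] herm_cnj[of x y] herm_cnj[of x z] by (simp add: herm_add)

lemma herm_scale_right: "h x (c *s y) = cnj c * h x y"
  using herm_cnj[of x "c *s y"] herm_cnj[of x y] by (simp add: herm_scale)

lemma herm_diff: "h (x - y) z = h x z - h y z"
  using herm_add[of "x - y" y z] by simp

lemma herm_self_nonzero: "x \<noteq> 0 \<Longrightarrow> h x x \<noteq> 0"
  using herm_pos[of x] by auto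

lemma herm_0: "h 0 y = 0"
  using herm_scale[of 0 0 y] by simp

lemma herm_0_right: "h x 0 = 0"
  using herm_scale_right[of x 0 0] by simp

lemma herm_sum: "h (\<Sum>i\<in>I. f i) y = (\<Sum>i\<in>I. h (f i) y)"
  by (induction I rule: infinite_finite_induct) (auto simp: herm_0 herm_add)

lemma herm_sum_right: "h x (\<Sum>i\<in>I. f i) = (\<Sum>i\<in>I. h x (f i))"
  by (induction I rule: infinite_finite_induct) (auto simp: herm_0_right herm_add_right)

lemma herm_expand: "h x y = (\<Sum>i\<in>UNIV. \<Sum>j\<in>UNIV. x $ i * (cnj (y $ j) * h (axis i 1) (axis j 1)))"
proof -
  have "h x y = h (\<Sum>i\<in>UNIV. x $ i *s axis i 1) (\<Sum>j\<in>UNIV. y $ j *s axis j 1)"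
    by (simp only: basis_expansion)
  also have "\<dots> = (\<Sum>i\<in>UNIV. x $ i * h (axis i 1) (\<Sum>j\<in>UNIV. y $ j *s axis j 1))"
    by (simp only: herm_sum herm_scale)
  also have "\<dots> = (\<Sum>i\<in>UNIV. x $ i * (\<Sum>j\<in>UNIV. cnj (y $ j) * h (axis i 1) (axis j 1)))"
    by (simp only: herm_sum_right herm_scale_right)
  finally show ?thesis by (simp add: sum_distrib_left)
qed

lemma herm_tendsto:
  assumes "(f \<longlongrightarrow> a) F" "(g \<longlongrightarrow> b) F"
  shows "((\<lambda>n. h (f n) (g n)) \<longlongrightarrow> h a b) F"
  unfolding herm_expand[of "f _"] herm_expand[of a] by (intro tendsto_intros assms)

lemma herm_continuous_on:
  assumes "continuous_on S f" "continuous_on S g"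
  shows "continuous_on S (\<lambda>t. h (f t) (g t))"
  unfolding herm_expand[of "f _"] by (intro continuous_intros assms)

text \<open>Compactness of the unit sphere. This turns bounds on the form into bounds on the norm of
  a family of roots.\<close>

lemma herm_lower_bound: "\<exists>m>0. \<forall>x. m * (norm x)\<^sup>2 \<le> Re (h x x)"
proof -
  have "continuous_on (sphere 0 1) (\<lambda>x. Re (h x x))"
    by (intro continuous_intros herm_continuous_on)
  moreover have "axis undefined 1 \<in> sphere (0 :: complex^'n) 1"
    by (simp add: norm_axis_1)
  ultimately obtain u where u: "u \<in> sphere 0 1" "\<And>x. x \<in> sphere 0 1 \<Longrightarrow> Re (h u u) \<le> Re (h x x)"
    using continuous_attains_inf[of "sphere (0 :: complex^'n) 1" "\<lambda>x. Re (h x x)"] by auto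
  have "Re (h u u) * (norm x)\<^sup>2 \<le> Re (h x x)" for x
  proof (cases "x = 0")
    case False
    let ?y = "complex_of_real (inverse (norm x)) *s x"
    have "norm (inverse (norm x) *\<^sub>R x) = 1" using False by simp
    then have "norm ?y = 1" by (simp only: scaleR_vec_complex)
    then have "Re (h u u) \<le> Re (h ?y ?y)" using u(2) by simp
    also have "h ?y ?y = complex_of_real ((inverse (norm x))\<^sup>2) * h x x"
      by (simp add: herm_scale herm_scale_right power2_eq_square)
    also have "Re \<dots> = (inverse (norm x))\<^sup>2 * Re (h x x)" by (simp del: of_real_power)
    finally show ?thesis using False by (simp add: field_simps)
  qed (simp add: herm_0)
  moreover have "Re (h u u) > 0" using u(1) herm_pos[of u] by force
  ultimately show ?thesis by blast
qed

lemma self_adjoint_posdiag: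
  assumes T: "clin T" and sa: "\<And>x y. h (T x) y = h x (T y)"
    and nonneg: "\<And>x. Re (h (T x) x) \<ge> 0" and inj: "\<And>x. T x = 0 \<Longrightarrow> x = 0"
  shows "posdiag T"
proof -
  have real: "cnj l = l" if "T w = l *s w" "w \<noteq> 0" for l w
    using sa[of w w] herm_self_nonzero[OF that(2)] that(1) by (simp add: herm_scale herm_scale_right)
  have "vec.span {v. \<exists>l. T v = l *s v} = UNIV"
  proof (rule semisimple_diagonalizable[OF T])
    fix l x assume *: "T (T x - l *s x) = l *s (T x - l *s x)"
    \<comment> \<open>Put w = (T - l) x. Since T w = l w with l real, self-adjointness gives h(w, w)
      = h(x, (T - l) w) = 0.\<close>
    have "T x - l *s x = 0"
    proof (rule ccontr)
      assume w: "T x - l *s x \<noteq> 0"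
      have "h (T x - l *s x) (T x - l *s x) = h x (T (T x - l *s x)) - l * h x (T x - l *s x)"
        by (simp only: herm_diff[of "T x" "l *s x" "T x - l *s x"] sa herm_scale)
      also have "\<dots> = 0"
        unfolding * herm_scale_right real[OF * w] by simp
      finally show False using herm_self_nonzero[OF w] by simp
    qed
    then show "T x = l *s x" by simp
  qed
  moreover have "{v. \<exists>l. T v = l *s v} \<subseteq> {v. \<exists>l>0. T v = complex_of_real l *s v}"
  proof clarify
    fix v l assume v: "T v = l *s v"
    show "\<exists>l>0. T v = complex_of_real l *s v"
    proof (cases "v = 0")
      case True
      then show ?thesis by (intro exI[of _ 1]) (simp add: clin_0[OF T])
    next
      case False
      have l: "l = complex_of_real (Re l)"
        using real[OF v False] by (simp add: complex_eq_iff)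
      have "Re (h (T v) v) = Re l * Re (h v v)"
        by (subst v, subst l) (simp add: herm_scale)
      then have "Re l \<ge> 0"
        using nonneg[of v] herm_pos[OF False] by (simp add: zero_le_mult_iff)
      moreover have "Re l \<noteq> 0"
        using inj[of v] False v l by auto
      ultimately show ?thesis using v l by (intro exI[of _ "Re l"]) auto
    qed
  qed
  ultimately show ?thesis
    using T span_UNIV_mono[OF _ order_trans[OF _ vec.span_superset]] unfolding posdiag_def by blast
qed

lemma unitary_diagonalizable:
  assumes T: "clin T" and un: "\<And>x y. h (T x) (T y) = h x y"
  shows "vec.span {v. \<exists>l. T v = l *s v} = UNIV"
proof (rule semisimple_diagonalizable[OF T])
  fix l x assume *: "T (T x - l *s x) = l *s (T x - l *s x)"
  have "T x - l *s x = 0"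
  proof (rule ccontr)
    let ?w = "T x - l *s x"
    assume w: "?w \<noteq> 0"
    have l: "l * cnj l = 1"
      using un[of ?w ?w] herm_self_nonzero[OF w] unfolding * herm_scale herm_scale_right by (simp add: mult.commute)
    \<comment> \<open>With |l| = 1 and T w = l w, unitarity gives h(T x, w) = l h(T x, T w) = l h(x,
      w), hence h(w, w) = 0.\<close>
    have "h (T x) ?w = (l * cnj l) * h (T x) ?w" using l by simp
    also have "\<dots> = l * h (T x) (T ?w)" unfolding * herm_scale_right by simp
    also have "\<dots> = h (l *s x) ?w" unfolding un herm_scale by simp
    finally have "h ?w ?w = 0" using herm_diff[of "T x" "l *s x" ?w] by simp
    then show False using herm_self_nonzero[OF w] by simp
  qed
  then show "T x = l *s x" by simp
qed

end

subsection \<open>Smooth families of square roots\<close>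

lemma matrix_clin: "clin f \<Longrightarrow> matrix f *v x = f x"
  by (simp add: clin_linear matrix_works)

lemma matrix_component: "matrix f $ i $ j = f (axis j 1) $ i"
  by (simp add: matrix_def)

lemma clin_matrix: "clin ((*v) A)"
  by (simp add: clin_linear)

text \<open>The roots are locally bounded, and any limit of them along t_n -> t is a nonnegative
  self-adjoint root of \<open>N t\<close>, so it equals \<open>S t\<close> by uniqueness. A map into
  a compact set with closed graph is continuous.\<close>

lemma isCont_sqrt_family:
  fixes S :: "real \<Rightarrow> complex^'n::finite \<Rightarrow> complex^'n"
  assumes h: "herm h" and S: "\<And>t. posdiag (S t)" and sq: "\<And>t x. S t (S t x) = N t x"
    and sa: "\<And>t x y. h (S t x) y = h x (S t y)" and nonneg: "\<And>t x. Re (h (S t x) x) \<ge> 0"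
    and N: "\<And>x. continuous_on UNIV (\<lambda>t. N t x)"
  shows "isCont (\<lambda>t. matrix (S t)) t0"
proof -
  let ?I = "cball t0 1"
  have lin: "clin (S t)" for t using S posdiag_clin by blast
  obtain m where m: "m > 0" "\<And>x. m * (norm x)\<^sup>2 \<le> Re (h x x)"
    using herm_lower_bound[OF h] by blast
  \<comment> \<open>From m |S x|^2 <= h(S x, S x) = h(N x, x), whose right side is bounded on the
    compact interval.\<close>
  have "\<exists>R. \<forall>t\<in>?I. norm (S t x) \<le> R" for x
  proof -
    have "compact ((\<lambda>t. Re (h (N t x) x)) ` ?I)"
      by (intro compact_continuous_image continuous_intros herm_continuous_on[OF h])
        (auto intro: continuous_on_subset[OF N])
    then obtain B where B: "\<And>t. t \<in> ?I \<Longrightarrow> \<bar>Re (h (N t x) x)\<bar> \<le> B"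
    proof -
      assume *: "\<And>B. (\<And>t. t \<in> ?I \<Longrightarrow> \<bar>Re (h (N t x) x)\<bar> \<le> B) \<Longrightarrow> thesis"
      from compact_imp_bounded[OF \<open>compact _\<close>] obtain a where "\<forall>y\<in>(\<lambda>t. Re (h (N t x) x)) ` ?I. norm y \<le> a"
        unfolding bounded_iff by blast
      then show thesis by (intro *[of a]) auto
    qed
    have "norm (S t x) \<le> sqrt (B / m)" if "t \<in> ?I" for t
    proof (rule real_le_rsqrt)
      have "m * (norm (S t x))\<^sup>2 \<le> Re (h (N t x) x)"
        using m(2)[of "S t x"] sa[of t "S t x" x] by (simp add: sq)
      also have "\<dots> \<le> B" using B[OF that] by simp
      finally show "(norm (S t x))\<^sup>2 \<le> B / m" using m(1) by (simp add: field_simps)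
    qed
    then show ?thesis by blast
  qed
  then obtain R where R: "\<And>x t. t \<in> ?I \<Longrightarrow> norm (S t x) \<le> R x" by metis
  let ?K = "\<Sum>i\<in>(UNIV::'n set). \<Sum>j\<in>(UNIV::'n set). R (axis j 1)"
  have bd: "matrix (S t) \<in> cball 0 ?K" if "t \<in> ?I" for t
  proof -
    have "norm (matrix (S t)) \<le> (\<Sum>i\<in>UNIV. norm (matrix (S t) $ i))"
      unfolding norm_vec_def[of "matrix (S t)"] by (rule L2_set_le_sum) simp
    also have "\<dots> \<le> (\<Sum>i\<in>(UNIV::'n set). \<Sum>j\<in>(UNIV::'n set). norm (matrix (S t) $ i $ j))"
      by (intro sum_mono) (simp add: norm_vec_def[of "matrix (S t) $ _"] L2_set_le_sum)
    also have "\<dots> \<le> ?K"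
    proof (intro sum_mono)
      fix i j :: 'n
      show "norm (matrix (S t) $ i $ j) \<le> R (axis j 1)"
        unfolding matrix_component
        by (rule order_trans[OF Finite_Cartesian_Product.norm_nth_le R[OF that]])
    qed
    finally show ?thesis by simp
  qed
  have "continuous_on ?I (\<lambda>t. matrix (S t))"
  proof (rule continuous_from_closed_graph[of "cball 0 ?K"])
    show "(\<lambda>t. matrix (S t)) \<in> ?I \<rightarrow> cball 0 ?K" using bd by blast
    show "closed ((\<lambda>x. (x, matrix (S x))) ` ?I)"
      unfolding closed_sequential_limits
    proof (intro allI impI, elim conjE)
      fix X and p assume X: "\<forall>n. X n \<in> (\<lambda>x. (x, matrix (S x))) ` ?I" and lim: "X \<longlonglongrightarrow> p"
      obtain t A where p: "p = (t, A)" by (cases p)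
      let ?t = "\<lambda>n. fst (X n)"
      have "\<exists>s\<in>?I. X n = (s, matrix (S s))" for n using X by blast
      then have Xn: "X n = (?t n, matrix (S (?t n)))" "?t n \<in> ?I" for n by (metis fst_conv)+
      have t: "?t \<longlonglongrightarrow> t" using tendsto_fst[OF lim] p by simp
      have "matrix (S (?t n)) = snd (X n)" for n by (metis Xn(1) snd_conv)
      then have A: "(\<lambda>n. matrix (S (?t n))) \<longlonglongrightarrow> A"
        using tendsto_snd[OF lim] p by simp
      have tI: "t \<in> ?I"
        using closed_sequentially[OF closed_cball _ t] Xn(2) by blast
      have Ax: "(\<lambda>n. S (?t n) x) \<longlonglongrightarrow> A *v x" for x
      proof -
        have "(\<lambda>n. matrix (S (?t n)) *v x) \<longlonglongrightarrow> A *v x"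
          unfolding matrix_vector_mult_def by (intro tendsto_intros A)
        then show ?thesis by (simp add: matrix_clin[OF lin])
      qed
      have ANt: "A *v (A *v x) = N t x" for x
      proof (rule LIMSEQ_unique)
        have "isCont (\<lambda>t. N t x) t" using N continuous_on_eq_continuous_at open_UNIV by blast
        then show "(\<lambda>n. N (?t n) x) \<longlonglongrightarrow> N t x" using t by (rule isCont_tendsto_compose)
        have "(\<lambda>n. matrix (S (?t n)) *v (S (?t n) x)) \<longlonglongrightarrow> A *v (A *v x)"
          unfolding matrix_vector_mult_def[of _ "S _ x"] matrix_vector_mult_def[of _ "A *v x"]
          by (intro tendsto_intros A Ax)
        then show "(\<lambda>n. N (?t n) x) \<longlonglongrightarrow> A *v (A *v x)" by (simp add: matrix_clin[OF lin] sq)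
      qed
      have "posdiag ((*v) A)"
      proof (rule self_adjoint_posdiag[OF h clin_matrix])
        show "h (A *v x) y = h x (A *v y)" for x y
          using LIMSEQ_unique[OF herm_tendsto[OF h Ax tendsto_const] ] herm_tendsto[OF h tendsto_const Ax]
          by (simp add: sa)
        show "Re (h (A *v x) x) \<ge> 0" for x
          by (rule LIMSEQ_le_const[OF tendsto_Re[OF herm_tendsto[OF h Ax tendsto_const]]])
            (use nonneg in auto)
        \<comment> \<open>A limit of positive operators might be singular; here its square is
          \<open>N t\<close>, the square of the bijection \<open>S t\<close>.\<close>
        show "x = 0" if "A *v x = 0" for x
        proof -
          have "S t (S t x) = S t (S t 0)"
            using ANt[of x] that by (simp add: sq[symmetric] clin_0[OF lin])
          then show ?thesis using posdiag_bij[OF S] by (metis bij_pointE)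
        qed
      qed
      then have "(*v) A = S t"
        using posdiag_sqrt_unique[OF _ S] ANt sq by metis
      then have "A = matrix (S t)" by (metis matrix_of_matrix_vector_mul)
      then show "p \<in> (\<lambda>x. (x, matrix (S x))) ` ?I" using p tI by blast
    qed
  qed auto
  then show ?thesis
    by (rule continuous_on_interior) simp
qed

text \<open>The matrix of X |-> P X + X Q on matrices flattened to vectors indexed by pairs. A
  concrete matrix makes determinants and Cramer's rule available.\<close>

definition sylvester :: "complex^'n::finite^'n \<Rightarrow> complex^'n^'n \<Rightarrow> complex^('n \<times> 'n)^('n \<times> 'n)" where
  "sylvester P Q = (\<chi> p q. (if snd q = snd p then P $ fst p $ fst q else 0) +
     (if fst q = fst p then Q $ snd q $ snd p else 0))"

definition flat :: "complex^'n::finite^'n \<Rightarrow> complex^('n \<times> 'n)" where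
  "flat X = (\<chi> p. X $ fst p $ snd p)"

lemma sum_UNIV_prod: "(\<Sum>p\<in>UNIV. f p) = (\<Sum>k\<in>UNIV. \<Sum>l\<in>UNIV. f (k, l))"
  by (simp add: sum.cartesian_product flip: UNIV_Times_UNIV)

lemma sylvester_flat: "sylvester P Q *v flat X = flat (P ** X + X ** Q)"
proof -
  have "(sylvester P Q *v flat X) $ (i, j) = flat (P ** X + X ** Q) $ (i, j)" for i j
  proof -
    have "(sylvester P Q *v flat X) $ (i, j) = (\<Sum>k\<in>UNIV. \<Sum>l\<in>UNIV. (if l = j then P $ i $ k * X $ k $ l else 0)
        + (if k = i then X $ k $ l * Q $ l $ j else 0))"
      by (auto intro!: sum.cong simp: matrix_vector_mult_def sylvester_def flat_def sum_UNIV_prod distrib_right)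
    also have "\<dots> = (\<Sum>k\<in>UNIV. P $ i $ k * X $ k $ j) + (\<Sum>k\<in>UNIV. if k = i then (\<Sum>l\<in>UNIV. X $ k $ l * Q $ l $ j) else 0)"
      unfolding sum.distrib by (intro arg_cong2[where f = "(+)"] sum.cong) auto
    finally show ?thesis by (simp add: flat_def matrix_matrix_mult_def)
  qed
  then show ?thesis by (simp add: vec_eq_iff split_paired_all)
qed

lemma det_sylvester:
  assumes S: "posdiag S" and T: "posdiag T"
  shows "det (sylvester (matrix S) (matrix T)) \<noteq> 0"
proof -
  have "inj ((*v) (sylvester (matrix S) (matrix T)))"
  proof (rule clin_inj[OF clin_matrix])
    fix v assume 0: "sylvester (matrix S) (matrix T) *v v = 0"
    obtain X where v: "v = flat X"
    proof
      show "v = flat (\<chi> i j. v $ (i, j))" by (simp add: flat_def vec_eq_iff)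
    qed
    have "flat (matrix S ** X + X ** matrix T) = 0"
      using 0 by (simp add: sylvester_flat v)
    then have "matrix S ** X + X ** matrix T = 0"
      by (simp add: flat_def vec_eq_iff)
    then have "(matrix S ** X + X ** matrix T) *v x = 0" for x by simp
    then have "S (X *v x) + X *v (T x) = 0" for x
      by (simp only: matrix_vector_mult_add_rdistrib matrix_vector_mul_assoc[symmetric]
        matrix_clin[OF posdiag_clin[OF S]] matrix_clin[OF posdiag_clin[OF T]])
    then have "X *v x = 0" for x
      using posdiag_sylvester_inj[OF S T clin_matrix] by blast
    then have "X = 0" using matrix_eq[of X 0] by simp
    then show "v = 0" using v by (simp add: flat_def vec_eq_iff)
  qed
  then show ?thesis by (simp add: invertible_det_nz[symmetric] invertible_left_inverse matrix_left_invertible_injective)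
qed

text \<open>Cramer's rule, with the quotient written as a product with \<open>inverse\<close>: the
  solution is visibly a polynomial in the entries and the inverse determinant.\<close>

definition sylvester_sol :: "complex^'n::finite^'n \<Rightarrow> complex^'n^'n \<Rightarrow> complex^'n^'n \<Rightarrow> 'n \<times> 'n \<Rightarrow> complex" where
  "sylvester_sol P Q B k = det (\<chi> i j. if j = k then flat B $ i else sylvester P Q $ i $ j) * inverse (det (sylvester P Q))"

lemma sylvester_solution:
  assumes "det (sylvester P Q) \<noteq> 0" "P ** X + X ** Q = B"
  shows "X $ i $ j = sylvester_sol P Q B (i, j)"
proof -
  have "sylvester P Q *v flat X = flat B" using assms(2) by (simp add: sylvester_flat)
  then have "flat X $ (i, j) = sylvester_sol P Q B (i, j)"
    unfolding cramer[OF assms(1)] sylvester_sol_def by (simp add: divide_inverse)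
  then show ?thesis by (simp add: flat_def)
qed

lemma smooth_alg_det:
  fixes A :: "real \<Rightarrow> complex^'m::finite^'m"
  assumes "\<And>i j. (\<lambda>t. A t $ i $ j) \<in> smooth_alg G"
  shows "(\<lambda>t. det (A t)) \<in> smooth_alg G"
  unfolding det_def
  by (intro smooth_alg_sum smooth_alg.mult[OF smooth_alg.base[OF smooth_const]] smooth_alg_prod assms)

lemma tendsto_det:
  fixes A :: "'b \<Rightarrow> complex^'m::finite^'m"
  assumes "\<And>i j. ((\<lambda>s. A s $ i $ j) \<longlongrightarrow> B $ i $ j) F"
  shows "((\<lambda>s. det (A s)) \<longlongrightarrow> det B) F"
  unfolding det_def by (intro tendsto_intros assms)

lemma has_vector_derivative_quotient:
  fixes f :: "real \<Rightarrow> complex"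
  shows "(f has_vector_derivative d) (at t) \<longleftrightarrow> ((\<lambda>s. (f s - f t) / of_real (s - t)) \<longlongrightarrow> d) (at t)"
proof -
  let ?D = "\<lambda>y. (1 / norm (y - t)) *\<^sub>R (f y - (f t + (y - t) *\<^sub>R d))"
  have "norm (?D y) = norm ((f y - f t) / of_real (y - t) - d)" if "y \<noteq> t" for y
  proof -
    define c where "c = complex_of_real (y - t)"
    have c: "c \<noteq> 0" using that by (simp add: c_def)
    have "(y - t) *\<^sub>R d = c * d" by (simp add: c_def scaleR_conv_of_real)
    then have "f y - (f t + (y - t) *\<^sub>R d) = c * ((f y - f t) / c - d)"
      using c by (simp add: right_diff_distrib[of c _ d])
    moreover have "norm (y - t) = norm c" by (simp only: c_def norm_of_real real_norm_def)
    ultimately show ?thesis unfolding c_def[symmetric] using c by (simp add: norm_mult)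
  qed
  then have "eventually (\<lambda>y. norm (?D y) = norm ((f y - f t) / of_real (y - t) - d)) (at t)"
    by (auto simp: eventually_at_filter)
  then have "(?D \<longlongrightarrow> 0) (at t) \<longleftrightarrow> ((\<lambda>y. (f y - f t) / of_real (y - t) - d) \<longlongrightarrow> 0) (at t)"
    using tendsto_cong[of "\<lambda>y. norm (?D y)" "\<lambda>y. norm ((f y - f t) / of_real (y - t) - d)" "at t" 0]
    by (simp only: tendsto_norm_zero_iff)
  then show ?thesis
    unfolding has_vector_derivative_def has_derivative_at2
    using bounded_linear_scaleR_left by (simp only: LIM_zero_iff) blast
qed

text \<open>Differentiating \<open>S\<^sup>2 = N\<close> gives the Sylvester equation \<open>S S' + S' S = N'\<close>, which Cramer's rule solves by a
  rational function of the entries of \<open>S\<close> and \<open>N'\<close>.\<close>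

lemma smooth_sqrt_family:
  fixes S :: "real \<Rightarrow> complex^'n::finite \<Rightarrow> complex^'n"
  assumes S: "\<And>t. posdiag (S t)" and sq: "\<And>t x. S t (S t x) = N t x"
    and N: "\<And>x. smooth (\<lambda>t. N t x)" and cont: "\<And>t. isCont (\<lambda>t. matrix (S t)) t"
  shows "smooth (\<lambda>t. S t x)"
proof -
  have lin: "clin (S t)" for t using S posdiag_clin by blast
  define M where "M t = matrix (S t)" for t
  define Q where "Q t = matrix (N t)" for t
  define Q' where "Q' t = (\<chi> i j. vector_derivative (\<lambda>t. Q t $ i $ j) (at t))" for t
  have M2: "M t ** M t = Q t" for t
  proof -
    have "(M t ** M t) *v x = N t x" for x
      by (simp add: M_def matrix_clin[OF lin] sq flip: matrix_vector_mul_assoc)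
    then show ?thesis unfolding Q_def by (metis ext matrix_of_matrix_vector_mul)
  qed
  have Q_smooth: "smooth (\<lambda>t. Q t $ i $ j)" for i j
    unfolding Q_def matrix_component using N smooth_vec_iff[of "\<lambda>t. N t (axis j 1)"] by simp
  have det0: "det (sylvester (M s) (M t)) \<noteq> 0" for s t
    unfolding M_def by (rule det_sylvester[OF S S])
  have M': "((\<lambda>s. M s $ i $ j) has_vector_derivative sylvester_sol (M t) (M t) (Q' t) (i, j)) (at t)" for i j t
    unfolding has_vector_derivative_quotient
  proof -
    let ?D = "\<lambda>s. \<chi> i j. (Q s $ i $ j - Q t $ i $ j) / of_real (s - t)"
    \<comment> \<open>The difference quotient X solves M s X + X M t = (Q s - Q t) / (s - t)
      exactly, because M s (M s - M t) + (M s - M t) M t = Q s - Q t. Continuity of M therefore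
      suffices to pass to the limit, and the determinant must be nonzero for two different
      times.\<close>
    have "(M s $ i $ j - M t $ i $ j) / of_real (s - t) = sylvester_sol (M s) (M t) (?D s) (i, j)" if "s \<noteq> t" for s
    proof -
      let ?X = "\<chi> i j. (M s $ i $ j - M t $ i $ j) / of_real (s - t)"
      have "M s ** ?X + ?X ** M t = ?D s"
      proof -
        have telescope: "a * (b - b') / c + (a - a') * b' / c = (a * b - a' * b') / c" for a a' b b' c :: complex
          by (simp add: algebra_simps flip: add_divide_distrib diff_divide_distrib)
        have "(M s ** ?X + ?X ** M t) $ k $ l = ?D s $ k $ l" for k l
          unfolding M2[symmetric] matrix_matrix_mult_def
          by (simp add: telescope sum_divide_distrib sum.distrib[symmetric] sum_subtractf[symmetric] del: of_real_diff)
        then show ?thesis by (simp add: vec_eq_iff)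
      qed
      from sylvester_solution[OF det0 this, of i j] show ?thesis by simp
    qed
    then have ev: "eventually (\<lambda>s. sylvester_sol (M s) (M t) (?D s) (i, j) = (M s $ i $ j - M t $ i $ j) / of_real (s - t)) (at t)"
      by (auto simp: eventually_at_filter)
    have Mlim: "(M \<longlongrightarrow> M t) (at t)" using cont[of t] unfolding isCont_def M_def[abs_def] .
    have Dlim: "((\<lambda>s. (Q s $ k $ l - Q t $ k $ l) / of_real (s - t)) \<longlongrightarrow> Q' t $ k $ l) (at t)" for k l
      using smooth_has_vector_derivative[OF Q_smooth, of k l t]
      unfolding has_vector_derivative_quotient Q'_def by simp
    have "((\<lambda>s. sylvester_sol (M s) (M t) (?D s) (i, j)) \<longlongrightarrow> sylvester_sol (M t) (M t) (Q' t) (i, j)) (at t)"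
    proof -
      have syl: "((\<lambda>s. sylvester (M s) (M t) $ p $ q) \<longlongrightarrow> sylvester (M t) (M t) $ p $ q) (at t)" for p q
        unfolding sylvester_def by (auto intro!: tendsto_intros Mlim)
      have "((\<lambda>s. flat (?D s) $ p) \<longlongrightarrow> flat (Q' t) $ p) (at t)" for p
        unfolding flat_def using Dlim by simp
      then show ?thesis
        unfolding sylvester_sol_def
        by (intro tendsto_mult tendsto_inverse tendsto_det det0 syl) (simp add: syl)
    qed
    then show "((\<lambda>s. (M s $ i $ j - M t $ i $ j) / of_real (s - t)) \<longlongrightarrow> sylvester_sol (M t) (M t) (Q' t) (i, j)) (at t)"
      using ev by (rule Lim_transform_eventually)
  qed
  \<comment> \<open>The bootstrap: the derivative of an entry is a polynomial in the entries, the
    inverse determinant and the smooth entries of \<open>Q'\<close>, and the derivative of the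
    inverse determinant is again of this kind.\<close>
  let ?H = "{\<lambda>t. M t $ i $ j | i j. True}"
  let ?inv = "\<lambda>t. inverse (det (sylvester (M t) (M t)))"
  let ?G = "insert ?inv ?H"
  have entry: "(\<lambda>t. M t $ i $ j) \<in> smooth_alg ?H" for i j by (intro smooth_alg.gen) blast
  have syl: "(\<lambda>t. sylvester (M t) (M t) $ p $ q) \<in> smooth_alg ?H" for p q
  proof -
    have "(\<lambda>t. if b then M t $ i $ j else 0) \<in> smooth_alg ?H" for b i j
      using entry by (cases b) (simp_all add: smooth_alg.base)
    then have "(\<lambda>t. (if snd q = snd p then M t $ fst p $ fst q else 0) +
        (if fst q = fst p then M t $ snd q $ snd p else 0)) \<in> smooth_alg ?H"
      by (intro smooth_alg.add)
    then show ?thesis unfolding sylvester_def by simp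
  qed
  have Mder: "\<exists>g'\<in>smooth_alg ?G. \<forall>t. (g has_vector_derivative g' t) (at t)" if g: "g \<in> ?H" for g
  proof -
    obtain i j where ij: "g = (\<lambda>t. M t $ i $ j)" using g by blast
    have "(\<lambda>t. det (\<chi> p q. if q = (i, j) then flat (Q' t) $ p else sylvester (M t) (M t) $ p $ q)) \<in> smooth_alg ?H"
    proof (rule smooth_alg_det)
      fix p q :: "'n \<times> 'n"
      have "(\<lambda>t. flat (Q' t) $ p) \<in> smooth_alg ?H"
        unfolding flat_def Q'_def by (simp add: smooth_alg.base smooth_vector_derivative[OF Q_smooth])
      then show "(\<lambda>t. (\<chi> p q. if q = (i, j) then flat (Q' t) $ p else sylvester (M t) (M t) $ p $ q) $ p $ q) \<in> smooth_alg ?H"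
        using syl by (cases "q = (i, j)") simp_all
    qed
    then have "(\<lambda>t. sylvester_sol (M t) (M t) (Q' t) (i, j)) \<in> smooth_alg ?G"
      unfolding sylvester_sol_def
      by (intro smooth_alg.mult smooth_alg_mono[of _ ?H ?G] smooth_alg.gen[of ?inv]) auto
    then show ?thesis unfolding ij by (rule rev_bexI) (intro allI M')
  qed
  have "smooth (\<lambda>t. M t $ i $ j)" for i j
  proof (rule smooth_alg_smooth[where G = ?G])
    show "(\<lambda>t. M t $ i $ j) \<in> smooth_alg ?G" by (intro smooth_alg.gen) blast
    fix g assume "g \<in> ?G"
    then consider "g = ?inv" | "g \<in> ?H" by blast
    then show "\<exists>g'\<in>smooth_alg ?G. \<forall>t. (g has_vector_derivative g' t) (at t)"
    proof cases
      case 1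
      have "\<exists>d\<in>smooth_alg ?G. \<forall>t. ((\<lambda>t. det (sylvester (M t) (M t))) has_vector_derivative d t) (at t)"
        by (rule smooth_alg_derivative[OF smooth_alg_det[OF syl] _ Mder]) blast+
      then obtain d where d: "d \<in> smooth_alg ?G"
        "\<And>t. ((\<lambda>t. det (sylvester (M t) (M t))) has_vector_derivative d t) (at t)" by blast
      have "(\<lambda>t. (- 1) * d t * (?inv t * ?inv t)) \<in> smooth_alg ?G"
        by (intro smooth_alg.mult[OF smooth_alg.mult[OF smooth_alg.base[OF smooth_const] d(1)] smooth_alg.mult] smooth_alg.gen) blast+
      moreover have "(?inv has_vector_derivative (- 1) * d t * (?inv t * ?inv t)) (at t)" for t
        using has_vector_derivative_inverse_complex[OF d(2) det0] by simp
      ultimately show ?thesis unfolding 1 by (intro bexI allI)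
    qed (rule Mder)
  qed
  then have "smooth (\<lambda>t. S t x $ i)" for i
    unfolding matrix_clin[OF lin, symmetric] M_def[symmetric] matrix_vector_mult_def
    by (auto intro!: smooth_sum smooth_mult)
  then show ?thesis using smooth_vec_iff by blast
qed

subsection \<open>Lie algebras with a compact real form\<close>

definition tr :: "(complex^'n::finite \<Rightarrow> complex^'n) \<Rightarrow> complex" where
  "tr f = (\<Sum>i\<in>UNIV. f (axis i 1) $ i)"

lemma killing_tr: "killing br x y = tr (\<lambda>v. br x (br y v))"
  by (simp add: killing_def tr_def)

lemma tr_trace: "tr f = trace (matrix f)"
  by (simp add: tr_def trace_def matrix_component)

lemma clin_compose: "clin f \<Longrightarrow> clin g \<Longrightarrow> clin (\<lambda>x. f (g x))"
  by (simp add: clin_def)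

lemma tr_commute:
  assumes "clin f" "clin g"
  shows "tr (\<lambda>x. f (g x)) = tr (\<lambda>x. g (f x))"
  using trace_mul_sym[of "matrix f" "matrix g"] assms
  unfolding tr_trace clin_linear by (simp add: o_def flip: matrix_compose_gen)

lemma tr_add: "tr (\<lambda>x. f x + g x) = tr f + tr g"
  by (simp add: tr_def sum.distrib)

lemma tr_diff: "tr (\<lambda>x. f x - g x) = tr f - tr g"
  by (simp add: tr_def sum_subtractf)

lemma tr_scale: "tr (\<lambda>x. c *s f x) = c * tr f"
  by (simp add: tr_def sum_distrib_left)

lemma tr_sum: "tr (\<lambda>x. \<Sum>i\<in>I. f i x) = (\<Sum>i\<in>I. tr (f i))"
  by (simp add: tr_def) (rule sum.swap)

locale clie =
  fixes br :: "complex^'n::finite \<Rightarrow> complex^'n \<Rightarrow> complex^'n"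
  assumes lie_alg: "lie_alg br"
begin

lemma br_add_left: "br (x + y) z = br x z + br y z"
  and br_add_right: "br x (y + z) = br x y + br x z"
  and br_scale_left: "br (c *s x) y = c *s br x y"
  and br_scale_right: "br x (c *s y) = c *s br x y"
  and br_self: "br x x = 0"
  using lie_alg unfolding lie_alg_def by blast+

lemma clin_br: "clin (br x)" "clin (\<lambda>x. br x y)"
  by (simp_all add: clin_def br_add_left br_add_right br_scale_left br_scale_right)

lemmas br_0_right = clin_0[OF clin_br(1)] and br_0_left = clin_0[OF clin_br(2)]
lemmas br_minus_right = clin_minus[OF clin_br(1)] and br_minus_left = clin_minus[OF clin_br(2)]
lemmas br_diff_right = clin_diff[OF clin_br(1)] and br_diff_left = clin_diff[OF clin_br(2)]

lemma br_antisym: "br x y = - br y x"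
proof -
  have "br (x + y) (x + y) = 0" by (rule br_self)
  then show ?thesis
    unfolding br_add_left br_add_right by (simp add: br_self eq_neg_iff_add_eq_0 add.commute)
qed

lemma jacobi: "br (br x y) z = br x (br y z) - br y (br x z)"
proof -
  have "br x (br y z) + br y (br z x) + br z (br x y) = 0"
    using lie_alg unfolding lie_alg_def by blast
  moreover have "br y (br z x) = - br y (br x z)"
    by (metis br_antisym br_minus_right)
  moreover have "br z (br x y) = - br (br x y) z"
    by (rule br_antisym)
  ultimately show ?thesis by simp
qed

lemma killing_add_left: "killing br (x + y) z = killing br x z + killing br y z"
  and killing_add_right: "killing br x (y + z) = killing br x y + killing br x z"
  and killing_scale_left: "killing br (c *s x) z = c * killing br x z"
  and killing_scale_right: "killing br x (c *s z) = c * killing br x z"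
  by (simp_all add: killing_tr br_add_left br_add_right br_scale_left br_scale_right tr_add tr_scale)

lemma killing_sym: "killing br x y = killing br y x"
  unfolding killing_tr by (rule tr_commute[OF clin_br(1) clin_br(1)])

lemma killing_0: "killing br 0 y = 0" "killing br x 0 = 0"
  using killing_scale_left[of 0 0 y] killing_scale_right[of x 0 0] by auto

lemma killing_minus: "killing br (- x) y = - killing br x y" "killing br x (- y) = - killing br x y"
  using killing_scale_left[of "-1" x y] killing_scale_right[of x "-1" y] by auto

lemma killing_diff: "killing br (x - y) z = killing br x z - killing br y z"
  "killing br x (y - z) = killing br x y - killing br x z"
  using killing_add_left[of x "- y" z] killing_add_right[of x y "- z"] by (auto simp: killing_minus)

lemma killing_sum: "killing br (\<Sum>i\<in>I. f i) y = (\<Sum>i\<in>I. killing br (f i) y)"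
  by (induction I rule: infinite_finite_induct) (auto simp: killing_0 killing_add_left)

lemma killing_invariant: "killing br (br x y) z = killing br x (br y z)"
proof -
  have "tr (\<lambda>v. br y (br x (br z v))) = tr (\<lambda>v. br x (br z (br y v)))"
    by (rule tr_commute[OF clin_br(1) clin_compose[OF clin_br(1) clin_br(1)], of y x z])
  then show ?thesis
    by (simp add: killing_tr jacobi br_diff_right tr_diff)
qed

lemma lie_aut_clin: "lie_aut br A \<Longrightarrow> clin A"
  by (simp add: lie_aut_def clin_def)

lemma lie_aut_br: "lie_aut br A \<Longrightarrow> A (br x y) = br (A x) (A y)"
  by (simp add: lie_aut_def)

lemma lie_aut_bij: "lie_aut br A \<Longrightarrow> bij A"
  by (simp add: lie_aut_def)

lemma killing_aut:
  assumes A: "lie_aut br A"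
  shows "killing br (A x) (A y) = killing br x y"
proof -
  have b: "bij A" using lie_aut_bij[OF A] .
  have inv: "A (inv A v) = v" "inv A (A v) = v" for v
    using b by (simp_all add: bij_is_surj surj_f_inv_f bij_is_inj)
  have "br (A x) (br (A y) v) = A (br x (br y (inv A v)))" for v
    by (simp add: lie_aut_br[OF A] inv)
  then have "killing br (A x) (A y) = tr (\<lambda>v. A (br x (br y (inv A v))))"
    by (simp add: killing_tr)
  also have "\<dots> = tr (\<lambda>v. br x (br y (inv A (A v))))"
    by (rule tr_commute[OF lie_aut_clin[OF A]
          clin_compose[OF clin_br(1) clin_compose[OF clin_br(1) clin_inv[OF lie_aut_clin[OF A] b]]]])
  finally show ?thesis by (simp add: inv killing_tr)
qed

end

section \<open>Compact real forms and their conjugations\<close>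

definition rconj :: "(complex^'n::finite) set \<Rightarrow> complex^'n \<Rightarrow> complex^'n" where
  "rconj V x = (let pq = THE pq. fst pq \<in> V \<and> snd pq \<in> V \<and> x = fst pq + \<i> *s snd pq in fst pq - \<i> *s snd pq)"

locale compact_form = clie br for br :: "complex^'n::finite \<Rightarrow> complex^'n \<Rightarrow> complex^'n" +
  fixes V :: "(complex^'n) set"
  assumes compact_rf: "compact_rf_g br V"
begin

lemma real_form: "real_form_g br V"
  using compact_rf by (simp add: compact_rf_g_def)

lemma V_add: "x \<in> V \<Longrightarrow> y \<in> V \<Longrightarrow> x + y \<in> V"
  and V_scale: "x \<in> V \<Longrightarrow> complex_of_real r *s x \<in> V"
  and V_br: "x \<in> V \<Longrightarrow> y \<in> V \<Longrightarrow> br x y \<in> V"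
  and V_0: "0 \<in> V"
  using real_form unfolding real_form_g_def by blast+

lemma V_minus: "x \<in> V \<Longrightarrow> - x \<in> V"
  using V_scale[of x "- 1"] by simp

lemma V_diff: "x \<in> V \<Longrightarrow> y \<in> V \<Longrightarrow> x - y \<in> V"
  using V_add[OF _ V_minus] by fastforce

lemma V_decomp: obtains p q where "p \<in> V" "q \<in> V" "x = p + \<i> *s q"
  using real_form unfolding real_form_g_def by metis

lemma rconj_eq: "p \<in> V \<Longrightarrow> q \<in> V \<Longrightarrow> rconj V (p + \<i> *s q) = p - \<i> *s q"
proof -
  assume pq: "p \<in> V" "q \<in> V"
  have "\<exists>!pq'. fst pq' \<in> V \<and> snd pq' \<in> V \<and> p + \<i> *s q = fst pq' + \<i> *s snd pq'"
    using real_form unfolding real_form_g_def by blast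
  then have "(THE pq'. fst pq' \<in> V \<and> snd pq' \<in> V \<and> p + \<i> *s q = fst pq' + \<i> *s snd pq') = (p, q)"
    by (rule the1_equality) (use pq in simp)
  then show ?thesis by (simp add: rconj_def)
qed

lemma rconj_fix: "x \<in> V \<Longrightarrow> rconj V x = x"
  using rconj_eq[OF _ V_0, of x] by simp

lemma rconj_add: "rconj V (x + y) = rconj V x + rconj V y"
proof -
  obtain p q p' q' where *: "p \<in> V" "q \<in> V" "x = p + \<i> *s q" "p' \<in> V" "q' \<in> V" "y = p' + \<i> *s q'"
    by (metis V_decomp)
  have "x + y = (p + p') + \<i> *s (q + q')" using * by (simp add: vec.scale_right_distrib)
  then have "rconj V (x + y) = (p + p') - \<i> *s (q + q')"
    using * by (simp only: rconj_eq V_add)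
  also have "\<dots> = (p - \<i> *s q) + (p' - \<i> *s q')" by (simp add: vec.scale_right_distrib)
  finally show ?thesis using * by (simp only: rconj_eq)
qed

lemma rconj_scale: "rconj V (c *s x) = cnj c *s rconj V x"
proof -
  obtain p q where *: "p \<in> V" "q \<in> V" "x = p + \<i> *s q" by (metis V_decomp)
  define a b where "a = complex_of_real (Re c)" and "b = complex_of_real (Im c)"
  have c: "c = a + \<i> * b" "cnj c = a - \<i> * b"
    by (simp_all add: a_def b_def complex_eq_iff)
  have "c *s x = (a *s p - b *s q) + \<i> *s (a *s q + b *s p)"
    unfolding c * by (simp add: vec_eq_iff algebra_simps)
  moreover have "a *s p - b *s q \<in> V" "a *s q + b *s p \<in> V"
    unfolding a_def b_def using * by (auto intro: V_add V_diff V_scale)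
  ultimately have "rconj V (c *s x) = (a *s p - b *s q) - \<i> *s (a *s q + b *s p)"
    by (simp only: rconj_eq)
  also have "\<dots> = cnj c *s (p - \<i> *s q)"
    unfolding c(2) by (simp add: vec_eq_iff algebra_simps)
  finally show ?thesis using * rconj_eq by simp
qed

lemma rconj_rconj: "rconj V (rconj V x) = x"
proof -
  obtain p q where *: "p \<in> V" "q \<in> V" "x = p + \<i> *s q" by (metis V_decomp)
  then show ?thesis using rconj_eq[OF *(1,2)] rconj_eq[OF *(1) V_minus[OF *(2)]] by simp
qed

lemma rconj_mem: "x \<in> V \<longleftrightarrow> rconj V x = x"
proof
  assume fixed: "rconj V x = x"
  obtain p q where *: "p \<in> V" "q \<in> V" "x = p + \<i> *s q" by (metis V_decomp)
  then have "p - \<i> *s q = p + \<i> *s q" using fixed rconj_eq[OF *(1,2)] by simp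
  then have "q $ k = 0" for k by (auto simp: vec_eq_iff)
  then have "q = 0" by (simp add: vec_eq_iff)
  then show "x \<in> V" using * by simp
qed (rule rconj_fix)

lemma rconj_br: "rconj V (br x y) = br (rconj V x) (rconj V y)"
proof -
  obtain p q p' q' where *: "p \<in> V" "q \<in> V" "x = p + \<i> *s q" "p' \<in> V" "q' \<in> V" "y = p' + \<i> *s q'"
    by (metis V_decomp)
  have "br x y = (br p p' - br q q') + \<i> *s (br p q' + br q p')"
    unfolding * by (simp add: br_add_left br_add_right br_scale_left br_scale_right vec_eq_iff algebra_simps)
  then have "rconj V (br x y) = (br p p' - br q q') - \<i> *s (br p q' + br q p')"
    using rconj_eq[of "br p p' - br q q'" "br p q' + br q p'"] * V_add V_diff V_br by simp
  also have "\<dots> = br (p - \<i> *s q) (p' - \<i> *s q')"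
    by (simp add: br_diff_left br_diff_right br_scale_left br_scale_right vec_eq_iff algebra_simps)
  finally show ?thesis using * rconj_eq by simp
qed

lemma rconj_0: "rconj V 0 = 0"
  by (rule rconj_fix[OF V_0])

lemma rconj_minus: "rconj V (- x) = - rconj V x"
  using rconj_scale[of "- 1" x] by simp

lemma rconj_diff: "rconj V (x - y) = rconj V x - rconj V y"
  using rconj_add[of x "- y"] by (simp add: rconj_minus)

lemma bij_rconj: "bij (rconj V)"
  by (metis bijI' rconj_rconj)

lemma bounded_linear_rconj: "bounded_linear (rconj V)"
  by (rule linear_conv_bounded_linear[THEN iffD1], rule linearI)
    (auto simp: scaleR_vec_complex rconj_add rconj_scale)

lemma killing_neg: "x \<in> V \<Longrightarrow> x \<noteq> 0 \<Longrightarrow> Re (killing br x x) < 0"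
  and killing_self_real: "x \<in> V \<Longrightarrow> killing br x x \<in> \<real>"
  using compact_rf unfolding compact_rf_g_def by (metis, metis Reals_0 killing_0(1))

lemma killing_real:
  assumes "x \<in> V" "y \<in> V"
  shows "killing br x y \<in> \<real>"
proof -
  have "killing br x y = (killing br (x + y) (x + y) - killing br x x - killing br y y) / 2"
    using killing_sym[of x y] by (simp add: killing_add_left killing_add_right)
  also have "\<dots> \<in> \<real>" using assms by (intro Reals_divide Reals_diff killing_self_real V_add) simp_all
  finally show ?thesis .
qed

lemma killing_rconj: "killing br (rconj V x) (rconj V y) = cnj (killing br x y)"
proof -
  obtain p q p' q' where *: "p \<in> V" "q \<in> V" "x = p + \<i> *s q" "p' \<in> V" "q' \<in> V" "y = p' + \<i> *s q'"
    by (metis V_decomp)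
  define k where "k a b = Re (killing br a b)" for a b
  have k: "killing br a b = complex_of_real (k a b)" if "a \<in> V" "b \<in> V" for a b
    using killing_real[OF that] by (simp add: k_def)
  have "rconj V x = p - \<i> *s q" "rconj V y = p' - \<i> *s q'" using * rconj_eq by auto
  then show ?thesis
    unfolding * using *(1,2,4,5)
    by (simp add: killing_add_left killing_add_right killing_diff killing_scale_left killing_scale_right k)
qed

text \<open>The Killing form is negative definite on \<open>V\<close>; the sign makes this Hermitian
  form positive definite on the complex algebra.\<close>

definition hform :: "complex^'n \<Rightarrow> complex^'n \<Rightarrow> complex" where
  "hform x y = - killing br x (rconj V y)"

lemma herm_hform: "herm hform"
  unfolding herm_def
proof (intro conjI allI impI)
  fix x y z :: "complex^'n" and c
  show "hform (x + y) z = hform x z + hform y z" "hform (c *s x) y = c * hform x y"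
    by (simp_all add: hform_def killing_add_left killing_scale_left)
  show "hform y x = cnj (hform x y)"
    unfolding hform_def using killing_rconj[of "rconj V y" x] by (simp add: rconj_rconj killing_sym)
  assume "x \<noteq> 0"
  obtain p q where *: "p \<in> V" "q \<in> V" "x = p + \<i> *s q" by (metis V_decomp)
  have "hform x x = - killing br (p + \<i> *s q) (p - \<i> *s q)"
    unfolding hform_def using * rconj_eq[of p q] by simp
  also have "\<dots> = - killing br p p - killing br q q"
    using killing_sym[of p q]
    by (simp add: killing_add_left killing_diff killing_scale_left killing_scale_right algebra_simps)
  finally have "hform x x = - killing br p p - killing br q q" .
  moreover have "Re (killing br a a) \<le> 0" if "a \<in> V" for a
    using killing_neg[OF that] by (cases "a = 0") (auto simp: killing_0)
  moreover have "p \<noteq> 0 \<or> q \<noteq> 0" using \<open>x \<noteq> 0\<close> * by auto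
  ultimately show "Re (hform x x) > 0"
    using killing_neg[of p] killing_neg[of q] * by (smt (verit) minus_complex.simps(1) uminus_complex.simps(1))
qed

lemma killing_nondegenerate: "(\<And>y. killing br x y = 0) \<Longrightarrow> x = 0"
  using herm_pos[OF herm_hform, of x] by (auto simp: hform_def)

lemma killing_eqI: "(\<And>y. killing br x y = killing br x' y) \<Longrightarrow> x = x'"
  using killing_nondegenerate[of "x - x'"] by (simp add: killing_diff)

lemma centerless: "(\<And>y. br x y = 0) \<Longrightarrow> x = 0"
  using killing_nondegenerate[of x] by (simp add: killing_tr br_0_right tr_def)

lemma ex_dual_basis: "\<exists>d. \<forall>i y. killing br (d i) y = y $ i"
proof -
  let ?f = "\<lambda>x. \<chi> j. killing br x (axis j 1)"
  have f: "clin ?f"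
    by (simp add: clin_def vec_eq_iff killing_add_left killing_scale_left)
  have expand: "killing br x y = (\<Sum>j\<in>UNIV. y $ j * killing br x (axis j 1))" for x y
  proof -
    have "killing br x y = killing br (\<Sum>j\<in>UNIV. y $ j *s axis j 1) x"
      unfolding basis_expansion by (rule killing_sym)
    then show ?thesis by (simp add: killing_sum killing_scale_left killing_sym[of x])
  qed
  have "inj ?f"
    by (rule clin_inj[OF f], rule killing_nondegenerate) (subst expand, simp add: vec_eq_iff)
  then have "surj ?f" using clin_inj_imp_surj[OF f] by blast
  then have "\<forall>i. \<exists>d. axis i 1 = ?f d" by (intro allI surjD)
  from choice[OF this] obtain d where d: "\<And>i. axis i 1 = ?f (d i)" by blast
  have "killing br (d i) y = y $ i" for i y
  proof -
    have "killing br (d i) (axis j 1) = (if j = i then 1 else 0)" for j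
      using arg_cong[OF d[of i], of "\<lambda>v. v $ j"] by (simp add: axis_def eq_commute)
    then show ?thesis by (subst expand) (simp add: if_distrib[of "(*) _"] cong: if_cong)
  qed
  then show ?thesis by blast
qed

definition dual :: "'n \<Rightarrow> complex^'n" where
  "dual = (SOME d. \<forall>i y. killing br (d i) y = y $ i)"

lemma killing_dual: "killing br (dual i) y = y $ i"
  using someI_ex[OF ex_dual_basis] unfolding dual_def by blast

lemma dual_expand: "(\<Sum>i\<in>UNIV. killing br x (axis i 1) *s dual i) = x"
proof (rule killing_eqI)
  fix y
  have "killing br x y = killing br (\<Sum>i\<in>UNIV. y $ i *s axis i 1) x"
    unfolding basis_expansion by (rule killing_sym)
  then show "killing br (\<Sum>i\<in>UNIV. killing br x (axis i 1) *s dual i) y = killing br x y"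
    by (simp add: killing_sum killing_scale_left killing_dual killing_sym[of x] mult.commute)
qed

text \<open>The Casimir element of the Killing form acts as the identity in the adjoint
  representation: paired with y, the sum becomes the trace of ad y ad x. The dual bases are moved by
  \<open>E\<close> and its contragredient \<open>F\<close> to allow frames that depend on t.\<close>

lemma casimir:
  assumes E: "clin E" "bij E" and F: "\<And>x y. killing br (F x) (E y) = killing br x y"
  shows "(\<Sum>i\<in>UNIV. br (F (dual i)) (br (E (axis i 1)) x)) = x"
proof (rule killing_eqI)
  fix y
  have inv: "E (inv E v) = v" "inv E (E v) = v" for v
    using E(2) by (simp_all add: bij_is_surj surj_f_inv_f bij_is_inj)
  have "killing br (br (F (dual i)) (br (E (axis i 1)) x)) y = inv E (br y (br x (E (axis i 1)))) $ i" for i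
  proof -
    have "killing br (br (F (dual i)) (br (E (axis i 1)) x)) y = killing br (F (dual i)) (br y (br x (E (axis i 1))))"
      unfolding killing_invariant
      by (subst br_antisym[of _ y], subst br_antisym[of _ x]) (simp add: br_minus_right)
    also have "\<dots> = killing br (dual i) (inv E (br y (br x (E (axis i 1)))))"
      by (subst F[symmetric]) (simp add: inv)
    finally show ?thesis by (simp add: killing_dual)
  qed
  then have "killing br (\<Sum>i\<in>UNIV. br (F (dual i)) (br (E (axis i 1)) x)) y = tr (\<lambda>v. inv E (br y (br x (E v))))"
    by (simp add: killing_sum tr_def)
  also have "\<dots> = tr (\<lambda>v. br y (br x (E (inv E v))))"
    using tr_commute[of "inv E" "\<lambda>v. br y (br x (E v))"]
      clin_inv[OF E] clin_compose[OF clin_br(1) clin_compose[OF clin_br(1) E(1)]] by simp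
  also have "\<dots> = killing br y x" by (simp add: inv killing_tr)
  also have "\<dots> = killing br x y" by (rule killing_sym)
  finally show "killing br (\<Sum>i\<in>UNIV. br (F (dual i)) (br (E (axis i 1)) x)) y = killing br x y" .
qed

text \<open>The classical argument with the inner element made explicit: it depends linearly on
  \<open>D\<close>, so a smooth family of derivations comes from a smooth curve of elements.\<close>

lemma derivation_inner:
  assumes D: "clin D" and der: "\<And>x y. D (br x y) = br (D x) y + br x (D y)"
  shows "D x = br (\<Sum>i\<in>UNIV. tr (\<lambda>v. D (br (axis i 1) v)) *s dual i) x"
proof -
  define z where "z = (\<Sum>i\<in>UNIV. tr (\<lambda>v. D (br (axis i 1) v)) *s dual i)"
  \<comment> \<open>Subtracting ad z makes tr (D ad x) vanish for all x. Then (D x, y) = tr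
    ([D, ad x] ad y) = tr (D ad [x, y]) = 0 for the corrected D.\<close>
  let ?D = "\<lambda>x. D x - br z x"
  have D': "clin ?D"
    using D by (simp add: clin_def br_add_right br_scale_right vec.scale_right_diff_distrib)
  have der': "?D (br x y) = br (?D x) y + br x (?D y)" for x y
    by (simp add: der br_diff_left br_diff_right jacobi)
  have z: "killing br z x = tr (\<lambda>v. D (br x v))" for x
  proof -
    have "br x v = (\<Sum>i\<in>UNIV. x $ i *s br (axis i 1) v)" for v
      using clin_expand[OF clin_br(2)] .
    then have "tr (\<lambda>v. D (br x v)) = (\<Sum>i\<in>UNIV. x $ i * tr (\<lambda>v. D (br (axis i 1) v)))"
      by (simp add: clin_sum[OF D] clin_scale[OF D] tr_sum tr_scale)
    then show ?thesis
      by (simp add: z_def killing_sum killing_scale_left killing_dual mult.commute)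
  qed
  have 0: "tr (\<lambda>v. ?D (br x v)) = 0" for x
    using z[of x] by (simp add: tr_diff killing_tr)
  have "?D x = 0"
  proof (rule killing_nondegenerate)
    fix y
    have "br (?D x) (br y v) = ?D (br x (br y v)) - br x (?D (br y v))" for v
      by (simp add: der')
    then have "killing br (?D x) y = tr (\<lambda>v. ?D (br x (br y v))) - tr (\<lambda>v. br x (?D (br y v)))"
      unfolding killing_tr by (simp only: tr_diff)
    also have "tr (\<lambda>v. br x (?D (br y v))) = tr (\<lambda>v. ?D (br y (br x v)))"
      by (rule tr_commute[OF clin_br(1) clin_compose[OF D' clin_br(1)]])
    also have "tr (\<lambda>v. ?D (br x (br y v))) - tr (\<lambda>v. ?D (br y (br x v))) = tr (\<lambda>v. ?D (br (br x y) v))"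
      unfolding tr_diff[symmetric] by (simp add: jacobi clin_diff[OF D] br_diff_right algebra_simps)
    finally show "killing br (?D x) y = 0" using 0 by simp
  qed
  then show ?thesis by (simp add: z_def)
qed

lemma compact_rf_aut:
  assumes A: "lie_aut br A"
  shows "compact_rf_g br (A ` V)" "rconj (A ` V) (A x) = A (rconj V x)"
proof -
  have inj: "A x = A y \<longleftrightarrow> x = y" for x y
    using lie_aut_bij[OF A] by (simp add: bij_is_inj inj_eq)
  have lin: "clin A" by (rule lie_aut_clin[OF A])
  have decomp: "\<exists>!pq. fst pq \<in> A ` V \<and> snd pq \<in> A ` V \<and> x = fst pq + \<i> *s snd pq" for x
  proof -
    obtain y where y: "x = A y" using lie_aut_bij[OF A] by (meson bij_pointE)
    obtain p q where *: "p \<in> V" "q \<in> V" "y = p + \<i> *s q" by (metis V_decomp)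
    show ?thesis
    proof (rule ex1I[of _ "(A p, A q)"])
      show "fst (A p, A q) \<in> A ` V \<and> snd (A p, A q) \<in> A ` V \<and> x = fst (A p, A q) + \<i> *s snd (A p, A q)"
        using * y by (simp add: clin_add[OF lin] clin_scale[OF lin])
    next
      fix pq assume "fst pq \<in> A ` V \<and> snd pq \<in> A ` V \<and> x = fst pq + \<i> *s snd pq"
      then obtain p' q' where **: "p' \<in> V" "q' \<in> V" "pq = (A p', A q')" "x = A p' + \<i> *s A q'"
        by (cases pq) auto
      then have "y = p' + \<i> *s q'" using y inj by (simp add: clin_add[OF lin, symmetric] clin_scale[OF lin, symmetric])
      then have "(p, q) = (p', q')"
        using real_form * ** unfolding real_form_g_def by (metis fst_conv snd_conv)
      then show "pq = (A p, A q)" using ** by simp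
    qed
  qed
  show "compact_rf_g br (A ` V)"
    unfolding compact_rf_g_def real_form_g_def
  proof (intro conjI ballI allI impI decomp)
    show "0 \<in> A ` V" using V_0 clin_0[OF lin] by (metis image_eqI)
    show "x + y \<in> A ` V" if "x \<in> A ` V" "y \<in> A ` V" for x y
      using that V_add by (auto simp: clin_add[OF lin, symmetric])
    show "complex_of_real r *s x \<in> A ` V" if "x \<in> A ` V" for x r
      using that V_scale by (auto simp: clin_scale[OF lin, symmetric])
    show "br x y \<in> A ` V" if "x \<in> A ` V" "y \<in> A ` V" for x y
      using that V_br by (auto simp: lie_aut_br[OF A, symmetric])
    show "killing br x x \<in> \<real>" "Re (killing br x x) < 0" if "x \<in> A ` V" "x \<noteq> 0" for x
    proof -
      obtain v where "v \<in> V" "x = A v" "v \<noteq> 0" using \<open>x \<in> A ` V\<close> \<open>x \<noteq> 0\<close> clin_0[OF lin] by auto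
      then show "killing br x x \<in> \<real>" "Re (killing br x x) < 0"
        using killing_self_real killing_neg by (auto simp: killing_aut[OF A])
    qed
  qed
  then interpret im: compact_form br "A ` V" by unfold_locales
  obtain p q where *: "p \<in> V" "q \<in> V" "x = p + \<i> *s q" by (metis V_decomp)
  then show "rconj (A ` V) (A x) = A (rconj V x)"
    using im.rconj_eq[of "A p" "A q"] rconj_eq[of p q]
    by (simp add: clin_add[OF lin] clin_diff[OF lin] clin_scale[OF lin])
qed

end

text \<open>The product is self-adjoint for the Hermitian form of \<open>V\<close>, and its
  quadratic form at x is the Hermitian form of \<open>W\<close> at the conjugate of x with respect
  to \<open>V\<close>, which is positive.\<close>

lemma two_compact_forms_posdiag:
  assumes "compact_form br V" "compact_form br W"
  shows "posdiag (\<lambda>x. rconj W (rconj V x))"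
proof -
  interpret v: compact_form br V by fact
  interpret w: compact_form br W by fact
  show ?thesis
  proof (rule self_adjoint_posdiag[OF v.herm_hform])
    show "clin (\<lambda>x. rconj W (rconj V x))"
      by (simp add: clin_def v.rconj_add w.rconj_add v.rconj_scale w.rconj_scale)
    show "v.hform (rconj W (rconj V x)) y = v.hform x (rconj W (rconj V y))" for x y
    proof -
      have "killing br (rconj W (rconj V x)) (rconj V y) = cnj (killing br (rconj V x) (rconj W (rconj V y)))"
        using w.killing_rconj[of "rconj V x" "rconj W (rconj V y)"] by (simp add: w.rconj_rconj)
      also have "\<dots> = killing br x (rconj V (rconj W (rconj V y)))"
        using v.killing_rconj[of "rconj V x" "rconj W (rconj V y)"] by (simp add: v.rconj_rconj)
      finally show ?thesis by (simp add: v.hform_def)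
    qed
    show "Re (v.hform (rconj W (rconj V x)) x) \<ge> 0" for x
    proof -
      have "v.hform (rconj W (rconj V x)) x = w.hform (rconj V x) (rconj V x)"
        by (simp add: v.hform_def w.hform_def v.killing_sym)
      then show ?thesis
        using herm_pos[OF w.herm_hform, of "rconj V x"] herm_0[OF w.herm_hform]
        by (cases "rconj V x = 0") auto
    qed
    show "x = 0" if "rconj W (rconj V x) = 0" for x
      using that by (metis v.rconj_rconj w.rconj_rconj v.rconj_0 w.rconj_0)
  qed
qed

section \<open>A simple algebra with its twisting automorphism\<close>

locale simple_compact = compact_form br U
  for br :: "complex^'n::finite \<Rightarrow> complex^'n \<Rightarrow> complex^'n" and U +
  fixes \<sigma> :: "complex^'n \<Rightarrow> complex^'n"
  assumes simple: "simple_lie br" and \<sigma>_aut: "lie_aut br \<sigma>" and \<sigma>_U: "\<sigma> ` U = U"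
begin

abbreviation "\<tau> \<equiv> rconj U"

text \<open>Any eigenspace of \<open>T\<close> is a nonzero ideal.\<close>

lemma schur:
  assumes T: "clin T" and comm: "\<And>y x. T (br y x) = br y (T x)"
  shows "\<exists>l. \<forall>x. T x = l *s x"
proof -
  obtain v l where v: "v \<noteq> 0" "T v = l *s v" using ex_eigenvector[OF T] by blast
  let ?I = "{x. T x = l *s x}"
  have "lie_ideal br ?I"
    unfolding lie_ideal_def csubspace_def
    by (auto simp: clin_0[OF T] clin_add[OF T] clin_scale[OF T] comm br_scale_right vec.scale_right_distrib
      mult.commute)
  then have "?I = {0} \<or> ?I = UNIV" using simple unfolding simple_lie_def by blast
  then show ?thesis using v by blast
qed

lemma \<sigma>_clin: "clin \<sigma>" and \<sigma>_bij: "bij \<sigma>"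
  using \<sigma>_aut by (auto simp: lie_aut_clin lie_aut_bij)

lemma \<tau>_\<sigma>: "\<tau> (\<sigma> x) = \<sigma> (\<tau> x)"
  using compact_rf_aut(2)[OF \<sigma>_aut] by (simp add: \<sigma>_U)

text \<open>\<sigma> preserves the Killing form and commutes with \<tau>, so it is unitary for
  \<open>hform\<close>.\<close>

lemma \<sigma>_diagonalizable: "vec.span {v. \<exists>l. \<sigma> v = l *s v} = UNIV"
  by (rule unitary_diagonalizable[OF herm_hform \<sigma>_clin]) (simp add: hform_def \<tau>_\<sigma> killing_aut[OF \<sigma>_aut])

text \<open>A one-parameter group of linear maps that reaches \<sigma> at time 2 pi, built from
  logarithms of the eigenvalues of \<sigma>. Its orbits are twisted loops, which trivialises the
  twisted loop space over the periodic functions.\<close>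

lemma ex_frame:
  "\<exists>E. (\<forall>t. clin (E t)) \<and> (\<forall>x. E 0 x = x) \<and> (\<forall>s t x. E (s + t) x = E s (E t x)) \<and>
     (\<forall>x. E (2 * pi) x = \<sigma> x) \<and> (\<forall>x. smooth (\<lambda>t. E t x))"
proof -
  let ?E = "{v. \<exists>l. \<sigma> v = l *s v}"
  obtain B where B: "B \<subseteq> ?E" "vec.independent B" "?E \<subseteq> vec.span B"
    using vec.maximal_independent_subset by blast
  have sp: "vec.span B = UNIV"
    using span_UNIV_mono[OF \<sigma>_diagonalizable B(3)] .
  have "\<forall>b\<in>B. \<exists>l. \<sigma> b = l *s b" using B(1) by blast
  from bchoice[OF this] obtain l where l: "\<And>b. b \<in> B \<Longrightarrow> \<sigma> b = l b *s b" by blast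
  have l0: "l b \<noteq> 0" if "b \<in> B" for b
  proof
    assume "l b = 0"
    then have "\<sigma> b = \<sigma> 0" using l[OF that] by (simp add: clin_0[OF \<sigma>_clin])
    then have "b = 0" using \<sigma>_bij by (simp add: bij_is_inj inj_eq)
    then show False using that B(2) vec.dependent_zero by blast
  qed
  define c where "c b = Ln (l b) / complex_of_real (2 * pi)" for b
  have "\<exists>E. clin E \<and> (\<forall>b\<in>B. E b = exp (c b * complex_of_real t) *s b)" for t
    using vec.linear_independent_extend[OF B(2), of "\<lambda>b. exp (c b * complex_of_real t) *s b"]
    unfolding clin_linear by blast
  then obtain E where E: "\<And>t. clin (E t)" "\<And>t b. b \<in> B \<Longrightarrow> E t b = exp (c b * complex_of_real t) *s b"
    by metis
  have "E 0 x = x" for x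
    by (rule clin_eq_on_span[OF E(1) _ sp, of "\<lambda>x. x"]) (auto simp: E clin_def)
  moreover have "E (s + t) x = E s (E t x)" for s t x
    by (rule clin_eq_on_span[OF E(1) clin_compose[OF E(1) E(1)] sp])
      (simp add: E(2) clin_scale[OF E(1)] distrib_left exp_add mult.commute)
  moreover have "E (2 * pi) x = \<sigma> x" for x
  proof (rule clin_eq_on_span[OF E(1) \<sigma>_clin sp])
    fix b assume b: "b \<in> B"
    have "c b * complex_of_real (2 * pi) = Ln (l b)" by (simp add: c_def)
    then show "E (2 * pi) b = \<sigma> b" using b l[OF b] l0[OF b] E(2)[OF b, of "2 * pi"] by simp
  qed
  moreover have "smooth (\<lambda>t. E t x)" for x
  proof -
    have "x \<in> vec.span B" using sp by simp
    then show ?thesis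
    proof (induction rule: vec.span_induct_alt)
      case base
      show ?case by (simp add: clin_0[OF E(1)])
    next
      case (step a b y)
      have "smooth (\<lambda>t. a *s (exp (c b * complex_of_real t) *s b) + E t y)"
        by (intro smooth_vec_add smooth_vec_scale smooth_exp smooth_const step)
      then show ?case using step by (simp add: clin_add[OF E(1)] clin_scale[OF E(1)] E(2))
    qed
  qed
  ultimately show ?thesis using E(1) by blast
qed

end

subsection \<open>Loops\<close>

abbreviation dt :: "(real \<Rightarrow> 'a::real_normed_vector) \<Rightarrow> real \<Rightarrow> 'a" where
  "dt u \<equiv> \<lambda>t. vector_derivative u (at t)"

lemma smooth_nth:
  fixes u :: "real \<Rightarrow> complex^'n::finite"
  shows "smooth u \<Longrightarrow> smooth (\<lambda>t. u t $ i)"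
  by (rule smooth_bounded_linear[OF bounded_linear_vec_nth])

lemma bounded_bilinear_scale: "bounded_bilinear ((*s) :: complex \<Rightarrow> complex^'n::finite \<Rightarrow> complex^'n)"
  by (rule bilinear_conv_bounded_bilinear[THEN iffD1])
    (auto simp: bilinear_def linear_iff scaleR_vec_complex scaleR_conv_of_real vec.scale_right_distrib
      vec.scale_left_distrib mult.commute)

lemma dt_scale:
  fixes u :: "real \<Rightarrow> complex^'n::finite"
  assumes "smooth f" "smooth u"
  shows "dt (\<lambda>t. f t *s u t) t = f t *s dt u t + dt f t *s u t"
  by (intro vector_derivative_at bounded_bilinear.has_vector_derivative[OF bounded_bilinear_scale]
      smooth_has_vector_derivative assms)

lemma dt_const_scale:
  fixes u :: "real \<Rightarrow> complex^'n::finite"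
  assumes "smooth u"
  shows "dt (\<lambda>t. c *s u t) t = c *s dt u t"
  using dt_scale[OF smooth_const assms, of c] by simp

lemma dt_add: "smooth u \<Longrightarrow> smooth v \<Longrightarrow> dt (\<lambda>t. u t + v t) t = dt u t + dt v t"
  by (intro vector_derivative_at has_vector_derivative_add smooth_has_vector_derivative)

lemma dt_bounded_linear: "bounded_linear B \<Longrightarrow> smooth u \<Longrightarrow> dt (\<lambda>t. B (u t)) t = B (dt u t)"
  by (rule vector_derivative_at, erule bounded_linear.has_vector_derivative, erule smooth_has_vector_derivative)

lemma dt_affine:
  assumes "smooth u"
  shows "dt (\<lambda>t. u (e * t + s)) t = e *\<^sub>R dt u (e * t + s)"
proof -
  have "((\<lambda>t. e * t + s) has_vector_derivative e) (at t)"
    by (auto intro!: derivative_eq_intros)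
  from vector_diff_chain_at[OF this smooth_has_vector_derivative[OF assms]] show ?thesis
    by (intro vector_derivative_at) (simp add: o_def)
qed

text \<open>The scalars that act on twisted loops: \<sigma> is linear, so multiplication by such a
  function preserves the twist.\<close>

definition periodic_fun :: "(real \<Rightarrow> complex) \<Rightarrow> bool" where
  "periodic_fun f \<longleftrightarrow> smooth f \<and> (\<forall>t. f (t + 2 * pi) = f t)"

lemma periodic_fun_const: "periodic_fun (\<lambda>t. c)"
  by (simp add: periodic_fun_def)

lemma periodic_fun_add: "periodic_fun f \<Longrightarrow> periodic_fun g \<Longrightarrow> periodic_fun (\<lambda>t. f t + g t)"
  by (simp add: periodic_fun_def smooth_add)

lemma periodic_fun_mult: "periodic_fun f \<Longrightarrow> periodic_fun g \<Longrightarrow> periodic_fun (\<lambda>t. f t * g t)"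
  by (simp add: periodic_fun_def smooth_mult)

lemma periodic_fun_cnj: "periodic_fun f \<Longrightarrow> periodic_fun (\<lambda>t. cnj (f t))"
  by (simp add: periodic_fun_def smooth_bounded_linear[OF bounded_linear_cnj])

lemma periodic_fun_inverse: "periodic_fun f \<Longrightarrow> (\<And>t. f t \<noteq> 0) \<Longrightarrow> periodic_fun (\<lambda>t. inverse (f t))"
  by (simp add: periodic_fun_def smooth_inverse)

lemma dt_shift: "smooth u \<Longrightarrow> dt u (t + c) = dt (\<lambda>t. u (t + c)) t"
  using dt_affine[of u 1 c t] by simp

lemma periodic_fun_dt: "periodic_fun f \<Longrightarrow> periodic_fun (dt f)"
  by (simp add: periodic_fun_def smooth_vector_derivative dt_shift)

lemma periodic_fun_exp: "periodic_fun (\<lambda>t. exp (\<i> * complex_of_real t))"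
  unfolding periodic_fun_def
proof (intro conjI allI smooth_exp)
  fix t
  have "\<i> * complex_of_real (t + 2 * pi) = \<i> * complex_of_real t + 2 * complex_of_real pi * \<i>"
    by (simp add: algebra_simps)
  then show "exp (\<i> * complex_of_real (t + 2 * pi)) = exp (\<i> * complex_of_real t)"
    by (simp only: exp_add exp_two_pi_i mult_1_right)
qed

lemma dt_exp: "dt (\<lambda>t. exp (c * complex_of_real t)) t = c * exp (c * complex_of_real t)"
proof -
  have "((\<lambda>z. exp (c * z)) has_field_derivative c * exp (c * of_real t)) (at (of_real t))"
    by (auto intro!: derivative_eq_intros)
  then have "((\<lambda>t. exp (c * of_real t)) has_vector_derivative c * exp (c * of_real t)) (at t)"
    by (rule has_vector_derivative_real_field)
  then show ?thesis by (rule vector_derivative_at)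
qed

context clie begin

lemma bounded_bilinear_br: "bounded_bilinear br"
  by (rule bilinear_conv_bounded_bilinear[THEN iffD1])
    (auto simp: bilinear_def linear_iff scaleR_vec_complex br_add_left br_add_right br_scale_left br_scale_right)

lemma bounded_bilinear_killing: "bounded_bilinear (killing br)"
  by (rule bilinear_conv_bounded_bilinear[THEN iffD1])
    (auto simp: bilinear_def linear_iff scaleR_vec_complex scaleR_conv_of_real killing_add_left
      killing_add_right killing_scale_left killing_scale_right)

lemma br_expand: "br x y = (\<Sum>i\<in>UNIV. x $ i *s (\<Sum>j\<in>UNIV. y $ j *s br (axis i 1) (axis j 1)))"
  by (subst clin_expand[OF clin_br(2)], subst clin_expand[OF clin_br(1)]) simp

lemma smooth_br: "smooth u \<Longrightarrow> smooth v \<Longrightarrow> smooth (\<lambda>t. br (u t) (v t))"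
  unfolding br_expand[of "u _"]
  by (intro smooth_vec_sum smooth_vec_scale smooth_const) (simp_all add: smooth_nth)

lemma smooth_killing: "smooth u \<Longrightarrow> smooth v \<Longrightarrow> smooth (\<lambda>t. killing br (u t) (v t))"
  unfolding killing_def
proof (rule smooth_sum)
  fix i :: 'n
  assume "smooth u" "smooth v"
  then have "smooth (\<lambda>t. br (u t) (br (v t) (axis i 1)))" by (intro smooth_br smooth_const)
  then show "smooth (\<lambda>t. br (u t) (br (v t) (axis i 1)) $ i)" by (rule smooth_nth)
qed

lemma dt_br: "smooth u \<Longrightarrow> smooth v \<Longrightarrow> dt (\<lambda>t. br (u t) (v t)) t = br (u t) (dt v t) + br (dt u t) (v t)"
  by (intro vector_derivative_at bounded_bilinear.has_vector_derivative[OF bounded_bilinear_br] smooth_has_vector_derivative)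

lemma dt_killing: "smooth u \<Longrightarrow> smooth v \<Longrightarrow>
    ((\<lambda>t. killing br (u t) (v t)) has_vector_derivative killing br (u t) (dt v t) + killing br (dt u t) (v t)) (at t)"
  by (intro bounded_bilinear.has_vector_derivative[OF bounded_bilinear_killing] smooth_has_vector_derivative)

lemma killing_integrable: "smooth u \<Longrightarrow> smooth v \<Longrightarrow> (\<lambda>t. killing br (u t) (v t)) integrable_on {0..2 * pi}"
  by (intro integrable_continuous_real smooth_continuous smooth_killing)

lemma ldot_add_left: "smooth u \<Longrightarrow> smooth v \<Longrightarrow> smooth w \<Longrightarrow>
    ldot br (\<lambda>t. u t + v t) w = ldot br u w + ldot br v w"
  unfolding ldot_def killing_add_left by (intro integral_add killing_integrable)

lemma ldot_add_right: "smooth u \<Longrightarrow> smooth v \<Longrightarrow> smooth w \<Longrightarrow>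
    ldot br w (\<lambda>t. u t + v t) = ldot br w u + ldot br w v"
  unfolding ldot_def killing_add_right by (intro integral_add killing_integrable)

lemma ldot_scale_left: "ldot br (\<lambda>t. c *s u t) v = c * ldot br u v"
  unfolding ldot_def killing_scale_left by (rule integral_mult_right)

lemma ldot_scale_right: "ldot br v (\<lambda>t. c *s u t) = c * ldot br v u"
  unfolding ldot_def killing_scale_right by (rule integral_mult_right)

lemma ldot_sym: "ldot br u v = ldot br v u"
  unfolding ldot_def by (simp add: killing_sym)

end

subsection \<open>The affine algebra\<close>

lemma aadd_eq: "aadd (u, a, b) (v, a', b') = ((\<lambda>t. u t + v t), a + a', b + b')"
  and ascale_eq: "ascale z (u, a, b) = ((\<lambda>t. z *s u t), z * a, z * b)"
  and abr_eq: "abr br (u, a, b) (v, a', b') =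
    ((\<lambda>t. br (u t) (v t) + b *s dt v t - b' *s dt u t), ldot br (dt u) v, 0)"
  by (simp_all add: aadd_def ascale_def abr_def)

lemma aadd_commute: "aadd x y = aadd y x"
  by (cases x; cases y) (simp add: aadd_eq add.commute)

lemma aadd_assoc: "aadd (aadd x y) z = aadd x (aadd y z)"
  by (cases x; cases y; cases z) (simp add: aadd_eq add.assoc)

lemma ascale_ascale: "ascale z (ascale w x) = ascale (z * w) x"
  by (cases x) (simp add: ascale_eq mult.assoc)

lemma ascale_1: "ascale 1 x = x"
  by (cases x) (simp add: ascale_eq)

lemma ascale_0: "ascale 0 x = azero"
  by (cases x) (simp add: ascale_eq azero_def)

lemma aadd_azero: "aadd x azero = x" "aadd azero x = x"
  by (cases x; simp add: aadd_eq azero_def)+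

context simple_compact begin

abbreviation "L \<equiv> loop_alg \<sigma>"
abbreviation "G \<equiv> LGhat \<sigma>"

lemma loop_smooth: "u \<in> L \<Longrightarrow> smooth u"
  and loop_shift: "u \<in> L \<Longrightarrow> u (t + 2 * pi) = \<sigma> (u t)"
  by (auto simp: loop_alg_def)

lemma loop_add: "u \<in> L \<Longrightarrow> v \<in> L \<Longrightarrow> (\<lambda>t. u t + v t) \<in> L"
  by (simp add: loop_alg_def smooth_vec_add clin_add[OF \<sigma>_clin])

lemma loop_scale_fun: "periodic_fun f \<Longrightarrow> u \<in> L \<Longrightarrow> (\<lambda>t. f t *s u t) \<in> L"
  by (simp add: loop_alg_def periodic_fun_def smooth_vec_scale clin_scale[OF \<sigma>_clin])

lemma loop_scale: "u \<in> L \<Longrightarrow> (\<lambda>t. c *s u t) \<in> L"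
  using loop_scale_fun[OF periodic_fun_const] .

lemma loop_0: "(\<lambda>t. 0) \<in> L"
  by (simp add: loop_alg_def clin_0[OF \<sigma>_clin])

lemma loop_minus: "u \<in> L \<Longrightarrow> (\<lambda>t. - u t) \<in> L"
  using loop_scale[of u "- 1"] by simp

lemma loop_diff: "u \<in> L \<Longrightarrow> v \<in> L \<Longrightarrow> (\<lambda>t. u t - v t) \<in> L"
  using loop_add[OF _ loop_minus, of u v] by simp

lemma loop_sum: "(\<And>i. i \<in> I \<Longrightarrow> u i \<in> L) \<Longrightarrow> (\<lambda>t. \<Sum>i\<in>I. u i t) \<in> L"
  by (induction I rule: infinite_finite_induct) (simp_all add: loop_0 loop_add)

lemma loop_br: "u \<in> L \<Longrightarrow> v \<in> L \<Longrightarrow> (\<lambda>t. br (u t) (v t)) \<in> L"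
  by (simp add: loop_alg_def smooth_br lie_aut_br[OF \<sigma>_aut])

lemma loop_dt: "u \<in> L \<Longrightarrow> dt u \<in> L"
  by (simp add: loop_alg_def smooth_vector_derivative dt_shift dt_bounded_linear[OF clin_bounded_linear[OF \<sigma>_clin]])

lemma loop_\<tau>: "u \<in> L \<Longrightarrow> (\<lambda>t. \<tau> (u t)) \<in> L"
  by (simp add: loop_alg_def smooth_bounded_linear[OF bounded_linear_rconj] \<tau>_\<sigma>)

text \<open>Integration by parts; the boundary terms cancel because \<sigma> preserves the Killing
  form.\<close>

lemma ldot_parts:
  assumes u: "u \<in> L" and v: "v \<in> L"
  shows "ldot br (dt u) v = - ldot br u (dt v)"
proof -
  have s: "smooth u" "smooth v" "smooth (dt u)" "smooth (dt v)"
    using u v loop_smooth smooth_vector_derivative by blast+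
  have "((\<lambda>t. killing br (u t) (dt v t) + killing br (dt u t) (v t)) has_integral
      killing br (u (2 * pi)) (v (2 * pi)) - killing br (u 0) (v 0)) {0..2 * pi}"
    by (rule fundamental_theorem_of_calculus)
      (auto intro: has_vector_derivative_at_within[OF dt_killing[OF s(1,2)]])
  moreover have "killing br (u (2 * pi)) (v (2 * pi)) = killing br (u 0) (v 0)"
    using loop_shift[OF u, of 0] loop_shift[OF v, of 0] by (simp add: killing_aut[OF \<sigma>_aut])
  ultimately have "integral {0..2 * pi} (\<lambda>t. killing br (u t) (dt v t) + killing br (dt u t) (v t)) = 0"
    by (simp add: integral_unique)
  then have "ldot br u (dt v) + ldot br (dt u) v = 0"
    unfolding ldot_def using integral_add[OF killing_integrable[OF s(1,4)] killing_integrable[OF s(3,2)]] by simp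
  then show ?thesis by (simp add: eq_neg_iff_add_eq_0 add.commute)
qed

lemma ldot_dt_self: "u \<in> L \<Longrightarrow> ldot br (dt u) u = 0"
  using ldot_parts[of u u] ldot_sym[of u "dt u"] by simp

section \<open>Moving frames and the Casimir identity for loops\<close>

definition is_frame :: "(real \<Rightarrow> complex^'n \<Rightarrow> complex^'n) \<Rightarrow> bool" where
  "is_frame E \<longleftrightarrow> (\<forall>t. clin (E t)) \<and> (\<forall>x. E 0 x = x) \<and> (\<forall>s t x. E (s + t) x = E s (E t x)) \<and>
     (\<forall>x. E (2 * pi) x = \<sigma> x) \<and> (\<forall>x. smooth (\<lambda>t. E t x))"

definition frame :: "real \<Rightarrow> complex^'n \<Rightarrow> complex^'n" where
  "frame = (SOME E. is_frame E)"

lemma is_frame_frame: "is_frame frame"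
proof -
  have "\<exists>E. is_frame E" unfolding is_frame_def by (rule ex_frame)
  then show ?thesis unfolding frame_def by (rule someI_ex)
qed

lemmas frame_props = is_frame_frame[unfolded is_frame_def]

lemmas clin_frame = frame_props[THEN conjunct1, rule_format]
  and frame_0 = frame_props[THEN conjunct2, THEN conjunct1, rule_format]
  and frame_add = frame_props[THEN conjunct2, THEN conjunct2, THEN conjunct1, rule_format]
  and frame_2pi = frame_props[THEN conjunct2, THEN conjunct2, THEN conjunct2, THEN conjunct1, rule_format]
  and smooth_frame = frame_props[THEN conjunct2, THEN conjunct2, THEN conjunct2, THEN conjunct2, rule_format]

lemma frame_inverse: "frame t (frame (- t) x) = x" "frame (- t) (frame t x) = x"
  using frame_add[of t "- t" x] frame_add[of "- t" t x] by (simp_all add: frame_0)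

lemma bij_frame: "bij (frame t)"
  by (rule bij_betw_byWitness[where f' = "frame (- t)"]) (auto simp: frame_inverse)

lemma frame_loop: "(\<lambda>t. frame t x) \<in> L"
  by (simp add: loop_alg_def smooth_frame add.commute[of _ "2 * pi"] frame_add frame_2pi)

lemma loop_through: "\<exists>u\<in>L. u t = x"
  by (rule bexI[OF _ frame_loop[of "frame (- t) x"]]) (simp add: frame_inverse)

definition coeff :: "(real \<Rightarrow> complex^'n) \<Rightarrow> 'n \<Rightarrow> real \<Rightarrow> complex" where
  "coeff u i t = frame (- t) (u t) $ i"

abbreviation fr :: "'n \<Rightarrow> real \<Rightarrow> complex^'n" where
  "fr i \<equiv> \<lambda>t. frame t (axis i 1)"

lemma smooth_apply:
  fixes A :: "real \<Rightarrow> complex^'m::finite \<Rightarrow> complex^'k::finite"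
  assumes "\<And>t. clin (A t)" "\<And>x. smooth (\<lambda>t. A t x)" "smooth u"
  shows "smooth (\<lambda>t. A t (u t))"
proof -
  have "A t (u t) = (\<Sum>i\<in>UNIV. u t $ i *s A t (axis i 1))" for t
    by (rule clin_expand[OF assms(1)])
  moreover have "smooth (\<lambda>t. \<Sum>i\<in>UNIV. u t $ i *s A t (axis i 1))"
    using assms(2,3) by (intro smooth_vec_sum smooth_vec_scale smooth_nth)
  ultimately show ?thesis by simp
qed

lemma smooth_frame_neg: "smooth (\<lambda>t. frame (- t) x)"
  using smooth_affine[of "\<lambda>t. frame t x" "- 1" 0, OF smooth_frame] by simp

text \<open>The twist of u and the advance of the frame over one period are both \<sigma> and
  cancel.\<close>

lemma periodic_coeff:
  assumes u: "u \<in> L"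
  shows "periodic_fun (coeff u i)"
  unfolding periodic_fun_def
proof (intro conjI allI)
  have "smooth (\<lambda>t. frame (- t) (u t))"
    by (rule smooth_apply[OF clin_frame smooth_frame_neg loop_smooth[OF u]])
  then show "smooth (coeff u i)" unfolding coeff_def[abs_def] by (rule smooth_nth)
  fix t
  have "frame (- (t + 2 * pi)) (u (t + 2 * pi)) = frame (- t) (frame (- (2 * pi)) (frame (2 * pi) (u t)))"
    by (simp add: loop_shift[OF u] frame_2pi flip: frame_add)
  then show "coeff u i (t + 2 * pi) = coeff u i t"
    by (simp add: coeff_def frame_inverse)
qed

lemma coeff_expand: "u t = (\<Sum>i\<in>UNIV. coeff u i t *s fr i t)"
proof -
  have "u t = frame t (frame (- t) (u t))" by (simp add: frame_inverse)
  also have "\<dots> = (\<Sum>i\<in>UNIV. coeff u i t *s fr i t)"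
    unfolding coeff_def by (rule clin_expand[OF clin_frame])
  finally show ?thesis .
qed

text \<open>The frame dual to \<open>fr\<close> for the Killing form, that is, the contragredient of
  \<open>frame t\<close> applied to \<open>dual i\<close>; \<open>killing_dframe\<close>
  characterises it.\<close>

definition dframe :: "'n \<Rightarrow> real \<Rightarrow> complex^'n" where
  "dframe i t = (\<Sum>j\<in>UNIV. killing br (dual i) (frame (- t) (axis j 1)) *s dual j)"

lemma killing_dframe: "killing br (dframe i t) (frame t y) = killing br (dual i) y"
proof -
  have "killing br (dframe i t) z = killing br (dual i) (frame (- t) z)" for z
  proof -
    have "killing br (dframe i t) z = (\<Sum>j\<in>UNIV. killing br (dual i) (z $ j *s frame (- t) (axis j 1)))"
      by (simp add: dframe_def killing_sum killing_scale_left killing_scale_right killing_dual mult.commute)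
    also have "\<dots> = killing br (\<Sum>j\<in>UNIV. z $ j *s frame (- t) (axis j 1)) (dual i)"
      by (simp add: killing_sum killing_sym[of "dual i"])
    also have "(\<Sum>j\<in>UNIV. z $ j *s frame (- t) (axis j 1)) = frame (- t) z"
      by (rule clin_expand[OF clin_frame, symmetric])
    finally show ?thesis by (simp add: killing_sym)
  qed
  then show ?thesis by (simp add: frame_inverse)
qed

lemma killing_frame_eqI:
  assumes "\<And>y. killing br x (frame t y) = killing br x' (frame t y)"
  shows "x = x'"
  using killing_eqI assms frame_inverse(1) by metis

lemma dframe_loop: "dframe i \<in> L"
  unfolding loop_alg_def
proof (intro CollectI conjI allI)
  show "smooth (dframe i)"
    unfolding dframe_def[abs_def]
    by (intro smooth_vec_sum smooth_vec_scale smooth_killing smooth_const smooth_frame_neg)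
  fix t
  show "dframe i (t + 2 * pi) = \<sigma> (dframe i t)"
  proof (rule killing_frame_eqI)
    fix y
    have "killing br (\<sigma> (dframe i t)) (frame (t + 2 * pi) y) = killing br (\<sigma> (dframe i t)) (\<sigma> (frame t y))"
      by (simp add: add.commute[of t] frame_add frame_2pi)
    then show "killing br (dframe i (t + 2 * pi)) (frame (t + 2 * pi) y) = killing br (\<sigma> (dframe i t)) (frame (t + 2 * pi) y)"
      by (simp add: killing_dframe killing_aut[OF \<sigma>_aut])
  qed
qed

text \<open>Both frames consist of loops, so every loop becomes a finite sum of brackets of loops.
  This explicit perfectness takes the place of continuity arguments in what follows.\<close>

lemma casimir_frame: "(\<Sum>i\<in>UNIV. br (dframe i t) (br (fr i t) x)) = x"
proof -
  \<comment> \<open>The linear map carrying \<open>dual j\<close> to \<open>dframe j t\<close>; it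
    is the contragredient of \<open>frame t\<close> that \<open>casimir\<close> asks for.\<close>
  let ?F = "\<lambda>x. \<Sum>i\<in>UNIV. killing br x (axis i 1) *s dframe i t"
  have F: "?F (dual j) = dframe j t" for j
  proof (rule killing_frame_eqI)
    fix y
    have "killing br (?F (dual j)) (frame t y) = killing br (\<Sum>i\<in>UNIV. killing br (dual j) (axis i 1) *s dual i) y"
      by (simp add: killing_sum killing_scale_left killing_dframe)
    then show "killing br (?F (dual j)) (frame t y) = killing br (dframe j t) (frame t y)"
      by (simp only: dual_expand killing_dframe)
  qed
  have "killing br (?F x) (frame t y) = killing br x y" for x y
  proof -
    have "killing br (?F x) (frame t y) = killing br (\<Sum>i\<in>UNIV. killing br x (axis i 1) *s dual i) y"
      by (simp add: killing_sum killing_scale_left killing_dframe)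
    then show ?thesis by (simp only: dual_expand)
  qed
  from casimir[OF clin_frame bij_frame this, of x] show ?thesis by (simp only: F)
qed

lemma G_iff: "(u, a, b) \<in> G \<longleftrightarrow> u \<in> L"
  by (simp add: LGhat_def)

lemma G_aadd: "x \<in> G \<Longrightarrow> y \<in> G \<Longrightarrow> aadd x y \<in> G"
  by (cases x; cases y) (simp add: aadd_eq G_iff loop_add)

lemma G_ascale: "x \<in> G \<Longrightarrow> ascale z x \<in> G"
  by (cases x) (simp add: ascale_eq G_iff loop_scale)

lemma G_abr: "x \<in> G \<Longrightarrow> y \<in> G \<Longrightarrow> abr br x y \<in> G"
  by (cases x; cases y) (simp add: abr_eq G_iff loop_add loop_diff loop_br loop_scale loop_dt)

lemma G_azero: "azero \<in> G"
  by (simp add: azero_def G_iff loop_0)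

end

subsection \<open>Automorphisms of the affine algebra act by a change of parameter and pointwise\<close>

context simple_compact begin

lemma aut_hat_inverse:
  assumes "aut_hat br \<sigma> \<psi>"
  shows "\<exists>\<psi>'. aut_hat br \<sigma> \<psi>' \<and> (\<forall>x\<in>G. \<psi>' (\<psi> x) = x) \<and> (\<forall>x\<in>G. \<psi> (\<psi>' x) = x)"
proof -
  have bij: "bij_betw \<psi> G G" using assms by (simp add: aut_hat_def)
  let ?i = "inv_into G \<psi>"
  have i: "?i (\<psi> x) = x" "\<psi> (?i x) = x" "?i x \<in> G" if "x \<in> G" for x
    using bij that by (auto simp: bij_betw_inv_into_left bij_betw_inv_into_right bij_betw_apply[OF bij_betw_inv_into])
  have eq: "?i x = y" if "y \<in> G" "\<psi> y = x" for x y using i that by blast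
  have "aut_hat br \<sigma> ?i"
    unfolding aut_hat_def
  proof (intro conjI ballI allI)
    show "bij_betw ?i G G" using bij by (rule bij_betw_inv_into)
    fix x y assume xy: "x \<in> G" "y \<in> G"
    show "?i (aadd x y) = aadd (?i x) (?i y)"
      using assms i[OF xy(1)] i[OF xy(2)] by (intro eq G_aadd) (auto simp: aut_hat_def)
    show "?i (abr br x y) = abr br (?i x) (?i y)"
      using assms i[OF xy(1)] i[OF xy(2)] by (intro eq G_abr) (auto simp: aut_hat_def)
  next
    fix z x assume x: "x \<in> G"
    show "?i (ascale z x) = ascale z (?i x)"
      using assms i[OF x] by (intro eq G_ascale) (auto simp: aut_hat_def)
  qed
  then show ?thesis using i by blast
qed

text \<open>The map induced on loops. Forgetting the central coordinate is consistent by
  \<open>fst_aut_hat\<close>, and the d coordinate vanishes by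
  \<open>aut_hat_d_component\<close>.\<close>

definition lam :: "('n aff \<Rightarrow> 'n aff) \<Rightarrow> (real \<Rightarrow> complex^'n) \<Rightarrow> real \<Rightarrow> complex^'n" where
  "lam \<psi> u = fst (\<psi> (u, 0, 0))"

lemma fr_nonzero: "fr k t \<noteq> 0"
proof
  assume "fr k t = 0"
  then have "frame t (axis k 1) = frame t 0" by (simp add: clin_0[OF clin_frame])
  then have "axis k 1 = (0 :: complex^'n)" using bij_frame by (metis bij_is_inj injD)
  then show False by (simp add: axis_eq_0_iff)
qed

text \<open>Test against a frame loop v and against e^{it} v: at t = 0 the results differ by i b
  v(0), which forces b = 0. After that, every w(t) is central in the simple algebra.\<close>

lemma abr_central:
  assumes w: "(w, a, b) \<in> G" and 0: "\<And>y. y \<in> G \<Longrightarrow> fst (abr br (w, a, b) y) = (\<lambda>t. 0)"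
  shows "w = (\<lambda>t. 0)" "b = 0"
proof -
  have eq: "br (w t) (u t) + b *s dt u t = 0" if "u \<in> L" for u t
    using fun_cong[OF 0[of "(u, 0, 0)"], of t] that by (simp add: G_iff abr_eq)
  let ?e = "\<lambda>t. exp (\<i> * complex_of_real t)"
  obtain k :: 'n where True by simp
  have "br (w 0) (fr k 0) + (b *s dt (fr k) 0 + b *s (\<i> *s fr k 0)) = 0"
    using eq[OF loop_scale_fun[OF periodic_fun_exp frame_loop[of "axis k 1"]], of 0]
      dt_scale[OF smooth_exp smooth_frame, of \<i> "axis k 1" 0]
    by (simp add: dt_exp vec.scale_right_distrib)
  moreover have "br (w 0) (fr k 0) + b *s dt (fr k) 0 = 0"
    by (rule eq[OF frame_loop])
  ultimately have "b *s (\<i> *s fr k 0) = 0"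
    unfolding add.assoc[symmetric] by (simp only: add_0)
  then show b: "b = 0" using fr_nonzero[of 0 k] by simp
  show "w = (\<lambda>t. 0)"
  proof
    fix t
    show "w t = 0"
    proof (rule centerless)
      fix y
      obtain u where "u \<in> L" "u t = y" using loop_through by blast
      then show "br (w t) y = 0" using eq[of u t] b by simp
    qed
  qed
qed

lemma aut_hat_image: "aut_hat br \<sigma> \<psi> \<Longrightarrow> \<psi> ` G = G"
  by (simp add: aut_hat_def bij_betw_def)

lemma aut_hat_surj: "aut_hat br \<sigma> \<psi> \<Longrightarrow> x \<in> G \<Longrightarrow> \<exists>y\<in>G. \<psi> y = x"
  using aut_hat_image by (metis imageE)

lemma aut_hat_props:
  assumes "aut_hat br \<sigma> \<psi>"
  shows "x \<in> G \<Longrightarrow> \<psi> x \<in> G"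
    and "x \<in> G \<Longrightarrow> y \<in> G \<Longrightarrow> \<psi> (aadd x y) = aadd (\<psi> x) (\<psi> y)"
    and "x \<in> G \<Longrightarrow> \<psi> (ascale z x) = ascale z (\<psi> x)"
    and "x \<in> G \<Longrightarrow> y \<in> G \<Longrightarrow> \<psi> (abr br x y) = abr br (\<psi> x) (\<psi> y)"
  using assms aut_hat_image[OF assms] by (auto simp: aut_hat_def)

text \<open>The image of c brackets to zero with everything, so \<open>abr_central\<close> leaves it
  only a central coordinate.\<close>

lemma aut_hat_central:
  assumes \<psi>: "aut_hat br \<sigma> \<psi>"
  obtains k where "\<And>a. \<psi> ((\<lambda>t. 0), a, 0) = ((\<lambda>t. 0), k * a, 0)"
proof -
  have c: "((\<lambda>t. 0), 1, 0) \<in> G" by (simp add: G_iff loop_0)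
  obtain w k b where wkb: "\<psi> ((\<lambda>t. 0), 1, 0) = (w, k, b)" by (metis prod_cases3)
  have 0: "fst (abr br (w, k, b) y) = (\<lambda>t. 0)" if y: "y \<in> G" for y
  proof -
    obtain x where x: "x \<in> G" "\<psi> x = y" using aut_hat_surj[OF \<psi> y] by blast
    obtain u a' b' where u: "x = (u, a', b')" by (metis prod_cases3)
    have "abr br (w, k, b) y = \<psi> (abr br ((\<lambda>t. 0), 1, 0) x)"
      using aut_hat_props(4)[OF \<psi> c x(1)] x(2) wkb by simp
    also have "abr br ((\<lambda>t. 0), 1, 0) x = azero"
      unfolding u by (simp add: abr_eq br_0_left azero_def ldot_def killing_0)
    also have "\<psi> azero = azero"
      using aut_hat_props(3)[OF \<psi> c, of 0] by (simp only: ascale_0)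
    finally show ?thesis by (simp add: azero_def)
  qed
  have "(w, k, b) \<in> G" using aut_hat_props(1)[OF \<psi> c] wkb by simp
  from abr_central[OF this 0] have *: "w = (\<lambda>t. 0)" "b = 0" by blast+
  show ?thesis
  proof
    fix a
    have "((\<lambda>t. 0), a, 0) = ascale a ((\<lambda>t. 0), 1, 0)" by (simp add: ascale_eq)
    then show "\<psi> ((\<lambda>t. 0), a, 0) = ((\<lambda>t. 0), k * a, 0)"
      using aut_hat_props(3)[OF \<psi> c, of a] wkb * by (simp add: ascale_eq mult.commute)
  qed
qed

context
  fixes \<psi> :: "'n aff \<Rightarrow> 'n aff"
  assumes \<psi>: "aut_hat br \<sigma> \<psi>"
begin

lemma lam_loop: "u \<in> L \<Longrightarrow> lam \<psi> u \<in> L"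
  using aut_hat_props(1)[OF \<psi>, of "(u, 0, 0)"] by (cases "\<psi> (u, 0, 0)") (simp add: lam_def G_iff)

lemma fst_aut_hat: "u \<in> L \<Longrightarrow> fst (\<psi> (u, a, 0)) = lam \<psi> u"
  and snd_aut_hat: "u \<in> L \<Longrightarrow> snd (snd (\<psi> (u, a, 0))) = snd (snd (\<psi> (u, 0, 0)))"
proof -
  assume u: "u \<in> L"
  obtain k where k: "\<psi> ((\<lambda>t. 0), a, 0) = ((\<lambda>t. 0), k * a, 0)" using aut_hat_central[OF \<psi>] by metis
  have "\<psi> (aadd (u, 0, 0) ((\<lambda>t. 0), a, 0)) = aadd (\<psi> (u, 0, 0)) ((\<lambda>t. 0), k * a, 0)"
    using aut_hat_props(2)[OF \<psi>, of "(u, 0, 0)" "((\<lambda>t. 0), a, 0)"] u by (simp add: G_iff loop_0 k)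
  then have "\<psi> (u, a, 0) = aadd (\<psi> (u, 0, 0)) ((\<lambda>t. 0), k * a, 0)" by (simp add: aadd_eq)
  then show "fst (\<psi> (u, a, 0)) = lam \<psi> u" "snd (snd (\<psi> (u, a, 0))) = snd (snd (\<psi> (u, 0, 0)))"
    by (simp_all add: lam_def aadd_def)
qed

lemma lam_add: "u \<in> L \<Longrightarrow> v \<in> L \<Longrightarrow> lam \<psi> (\<lambda>t. u t + v t) = (\<lambda>t. lam \<psi> u t + lam \<psi> v t)"
  using aut_hat_props(2)[OF \<psi>, of "(u, 0, 0)" "(v, 0, 0)"] by (simp add: G_iff lam_def aadd_def)

lemma lam_scale: "u \<in> L \<Longrightarrow> lam \<psi> (\<lambda>t. c *s u t) = (\<lambda>t. c *s lam \<psi> u t)"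
  using aut_hat_props(3)[OF \<psi>, of "(u, 0, 0)" c] by (simp add: G_iff lam_def ascale_def)

lemma lam_0: "lam \<psi> (\<lambda>t. 0) = (\<lambda>t. 0)"
  using lam_scale[OF loop_0, of 0] by simp

lemma lam_sum: "(\<And>i. i \<in> I \<Longrightarrow> u i \<in> L) \<Longrightarrow> lam \<psi> (\<lambda>t. \<Sum>i\<in>I. u i t) = (\<lambda>t. \<Sum>i\<in>I. lam \<psi> (u i) t)"
  by (induction I rule: infinite_finite_induct) (simp_all add: lam_0 lam_add loop_sum)

text \<open>Brackets have no d coordinate, and by \<open>casimir_frame\<close> every loop is a sum
  of brackets, up to central terms that do not affect this coordinate.\<close>

lemma aut_hat_d_component: "u \<in> L \<Longrightarrow> snd (snd (\<psi> (u, a, 0))) = 0"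
proof -
  let ?P = "\<lambda>u. u \<in> L \<and> snd (snd (\<psi> (u, 0, 0))) = 0"
  have P_add: "?P (\<lambda>t. u t + v t)" if "?P u" "?P v" for u v
    using aut_hat_props(2)[OF \<psi>, of "(u, 0, 0)" "(v, 0, 0)"] that by (simp add: G_iff aadd_def loop_add)
  have P_0: "?P (\<lambda>t. 0)"
    using aut_hat_props(3)[OF \<psi>, of "((\<lambda>t. 0), 0, 0)" 0] by (simp add: G_iff loop_0 ascale_def)
  have P_sum: "?P (\<lambda>t. \<Sum>i\<in>I. u i t)" if "\<And>i. i \<in> I \<Longrightarrow> ?P (u i)" for u :: "'n \<Rightarrow> _" and I
    using that
  proof (induction I rule: infinite_finite_induct)
    case (insert i I)
    have "?P (u i)" by (rule insert.prems) simp
    moreover have "?P (\<lambda>t. \<Sum>i\<in>I. u i t)" by (rule insert.IH, rule insert.prems) simp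
    ultimately show ?case unfolding sum.insert[OF insert.hyps] by (rule P_add)
  next
    case empty
    show ?case unfolding sum.empty by (rule P_0)
  next
    case (infinite I)
    show ?case unfolding sum.infinite[OF infinite.hyps] by (rule P_0)
  qed
  have P_br: "?P (\<lambda>t. br (v t) (w t))" if "v \<in> L" "w \<in> L" for v w
  proof -
    have "snd (snd (\<psi> (abr br (v, 0, 0) (w, 0, 0)))) = 0"
      using aut_hat_props(4)[OF \<psi>, of "(v, 0, 0)" "(w, 0, 0)"] that by (simp add: G_iff abr_def)
    then show ?thesis
      using that snd_aut_hat[OF loop_br[OF that], of "ldot br (dt v) w"] by (simp add: abr_eq loop_br)
  qed
  assume u: "u \<in> L"
  have "?P (\<lambda>t. \<Sum>i\<in>UNIV. br (dframe i t) (br (fr i t) (u t)))"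
    by (intro P_sum P_br dframe_loop loop_br frame_loop u)
  then show ?thesis using snd_aut_hat[OF u, of a] by (simp add: casimir_frame)
qed

lemma lam_br: "u \<in> L \<Longrightarrow> v \<in> L \<Longrightarrow> lam \<psi> (\<lambda>t. br (u t) (v t)) = (\<lambda>t. br (lam \<psi> u t) (lam \<psi> v t))"
proof -
  assume u: "u \<in> L" and v: "v \<in> L"
  have "lam \<psi> (\<lambda>t. br (u t) (v t)) = fst (\<psi> (abr br (u, 0, 0) (v, 0, 0)))"
    using fst_aut_hat[OF loop_br[OF u v]] by (simp add: abr_eq)
  also have "\<dots> = fst (abr br (\<psi> (u, 0, 0)) (\<psi> (v, 0, 0)))"
    using aut_hat_props(4)[OF \<psi>, of "(u, 0, 0)" "(v, 0, 0)"] u v by (simp add: G_iff)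
  also have "\<dots> = (\<lambda>t. br (lam \<psi> u t) (lam \<psi> v t))"
    using aut_hat_d_component[OF u, of 0] aut_hat_d_component[OF v, of 0] by (simp add: abr_def lam_def)
  finally show ?thesis .
qed

lemma lam_inverse:
  assumes "aut_hat br \<sigma> \<psi>'" "\<And>x. x \<in> G \<Longrightarrow> \<psi>' (\<psi> x) = x" and u: "u \<in> L"
  shows "lam \<psi>' (lam \<psi> u) = u"
proof -
  obtain v a b where v: "\<psi> (u, 0, 0) = (v, a, b)" by (metis prod_cases3)
  have "b = 0" using aut_hat_d_component[OF u, of 0] v by simp
  have L: "v \<in> L" using lam_loop[OF u] v by (simp add: lam_def)
  have "\<psi>' (v, a, 0) = (u, 0, 0)" using assms(2)[of "(u, 0, 0)"] v \<open>b = 0\<close> u by (simp add: G_iff)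
  then have "lam \<psi>' v = u"
    using simple_compact.fst_aut_hat[OF simple_compact_axioms assms(1) L, of a] by simp
  then show ?thesis using v by (simp add: lam_def)
qed

text \<open>Apply \<psi> to [d, u] = u': the image of d acts on loops as ad w + m d/dt.\<close>

lemma lam_dt:
  assumes "\<psi> ((\<lambda>t. 0), 0, 1) = (w, n, m)" and u: "u \<in> L"
  shows "lam \<psi> (dt u) t = br (w t) (lam \<psi> u t) + m *s dt (lam \<psi> u) t"
proof -
  have "abr br ((\<lambda>t. 0), 0, 1) (u, 0, 0) = (dt u, 0, 0)"
    by (simp add: abr_eq br_0_left ldot_def killing_0)
  then have "\<psi> (dt u, 0, 0) = abr br (w, n, m) (\<psi> (u, 0, 0))"
    using aut_hat_props(4)[OF \<psi>, of "((\<lambda>t. 0), 0, 1)" "(u, 0, 0)"] assms by (simp add: G_iff loop_0)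
  then show ?thesis
    using aut_hat_d_component[OF u, of 0] by (simp add: lam_def abr_def)
qed

lemma lam_surj: "u \<in> L \<Longrightarrow> \<exists>v\<in>L. lam \<psi> v = u"
proof -
  assume u: "u \<in> L"
  obtain \<psi>' where \<psi>': "aut_hat br \<sigma> \<psi>'" "\<forall>x\<in>G. \<psi> (\<psi>' x) = x"
    using aut_hat_inverse[OF \<psi>] by blast
  then obtain v a b where v: "\<psi>' (u, 0, 0) = (v, a, b)" by (metis prod_cases3)
  have L: "v \<in> L" using aut_hat_props(1)[OF \<psi>'(1), of "(u, 0, 0)"] u v by (simp add: G_iff)
  have b: "b = 0"
    using simple_compact.aut_hat_d_component[OF simple_compact_axioms \<psi>'(1) u, of 0] v by simp
  have "\<psi> (v, a, 0) = (u, 0, 0)" using \<psi>'(2) u v b by (metis G_iff)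
  then have "lam \<psi> v = u" using fst_aut_hat[OF L, of a] by simp
  then show ?thesis using L by blast
qed

text \<open>The conjugate of a multiplication operator commutes with all brackets. By the Casimir identity it acts
  pointwise, and by Schur's lemma it is then multiplication by a function.\<close>

lemma lam_centroid:
  assumes f: "periodic_fun f"
  shows "\<exists>a. periodic_fun a \<and> (\<forall>u\<in>L. \<forall>t. lam \<psi> (\<lambda>t. f t *s u t) t = a t *s lam \<psi> u t)"
proof -
  \<comment> \<open>\<open>R\<close> is a section of \<open>lam \<psi>\<close>, so \<open>T\<close>
    below is multiplication by f conjugated by \<open>lam \<psi>\<close>.\<close>
  obtain R where R: "\<And>u. u \<in> L \<Longrightarrow> R u \<in> L" "\<And>u. u \<in> L \<Longrightarrow> lam \<psi> (R u) = u"
    using lam_surj by metis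
  obtain \<psi>' where \<psi>': "aut_hat br \<sigma> \<psi>'" "\<And>x. x \<in> G \<Longrightarrow> \<psi>' (\<psi> x) = x"
    using aut_hat_inverse[OF \<psi>] by blast
  have inj: "u = v" if "u \<in> L" "v \<in> L" "lam \<psi> u = lam \<psi> v" for u v
    using lam_inverse[OF \<psi>'] that by metis
  define T where "T u = lam \<psi> (\<lambda>t. f t *s R u t)" for u
  have T_L: "T u \<in> L" if "u \<in> L" for u
    unfolding T_def by (intro lam_loop loop_scale_fun f R that)
  have T_lam: "T (lam \<psi> u) = lam \<psi> (\<lambda>t. f t *s u t)" if "u \<in> L" for u
  proof -
    have "R (lam \<psi> u) = u" by (rule inj) (simp_all add: R lam_loop that)
    then show ?thesis by (simp add: T_def)
  qed
  have T_br: "T (\<lambda>t. br (v t) (u t)) = (\<lambda>t. br (v t) (T u t))" if v: "v \<in> L" and u: "u \<in> L" for u v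
  proof -
    have "R (\<lambda>t. br (v t) (u t)) = (\<lambda>t. br (R v t) (R u t))"
      by (rule inj) (simp_all add: lam_br R u v loop_br)
    then have "T (\<lambda>t. br (v t) (u t)) = lam \<psi> (\<lambda>t. br (R v t) (f t *s R u t))"
      by (simp add: T_def br_scale_right)
    also have "\<dots> = (\<lambda>t. br (v t) (T u t))"
      unfolding T_def using lam_br[OF R(1)[OF v] loop_scale_fun[OF f R(1)[OF u]]] by (simp add: R v)
    finally show ?thesis .
  qed
  have T_add: "T (\<lambda>t. u t + v t) = (\<lambda>t. T u t + T v t)" if v: "v \<in> L" and u: "u \<in> L" for u v
  proof -
    have "R (\<lambda>t. u t + v t) = (\<lambda>t. R u t + R v t)"
      by (rule inj) (simp_all add: lam_add R u v loop_add)
    then show ?thesis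
      unfolding T_def using lam_add[OF loop_scale_fun[OF f R(1)[OF u]] loop_scale_fun[OF f R(1)[OF v]]]
      by (simp add: vec.scale_right_distrib)
  qed
  have T_0: "T (\<lambda>t. 0) = (\<lambda>t. 0)"
  proof -
    have "T (\<lambda>t. 0) t + T (\<lambda>t. 0) t = T (\<lambda>t. 0) t" for t
      using fun_cong[OF T_add[OF loop_0 loop_0], of t] by simp
    then show ?thesis by (intro ext) simp
  qed
  have T_sum: "T (\<lambda>t. \<Sum>i\<in>I. u i t) = (\<lambda>t. \<Sum>i\<in>I. T (u i) t)" if "\<And>i. i \<in> I \<Longrightarrow> u i \<in> L" for u :: "'n \<Rightarrow> _" and I
    using that by (induction I rule: infinite_finite_induct) (simp_all add: T_0 T_add loop_sum)
  \<comment> \<open>In T (sum [dframe i, [fr i, u]]) the operator \<open>T\<close> can be moved onto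
    the factor \<open>fr i\<close>; then u enters only through its value at t.\<close>
  define P where "P t x = (\<Sum>i\<in>UNIV. br (dframe i t) (br (T (fr i) t) x))" for t x
  have P: "T u t = P t (u t)" if u: "u \<in> L" for u t
  proof -
    have "T (\<lambda>t. br (fr i t) (u t)) t = br (T (fr i) t) (u t)" for i
    proof -
      have "T (\<lambda>t. br (u t) (fr i t)) t = br (u t) (T (fr i) t)"
        using fun_cong[OF T_br[OF u frame_loop[of "axis i 1"]], of t] by simp
      moreover have "T (\<lambda>t. br (fr i t) (u t)) t + T (\<lambda>t. br (u t) (fr i t)) t = 0"
      proof -
        have "br (fr i t) (u t) + br (u t) (fr i t) = 0" for t
          using br_antisym[of "fr i t" "u t"] by (simp add: eq_neg_iff_add_eq_0)
        then show ?thesis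
          using fun_cong[OF T_add[OF loop_br[OF u frame_loop] loop_br[OF frame_loop u]], of "axis i 1" "axis i 1" t]
          by (simp add: T_0)
      qed
      ultimately show ?thesis
        using br_antisym[of "u t" "T (fr i) t"] by (simp add: eq_neg_iff_add_eq_0[symmetric])
    qed
    then have "P t (u t) = (\<Sum>i\<in>UNIV. T (\<lambda>t. br (dframe i t) (br (fr i t) (u t))) t)"
      unfolding P_def using T_br[OF dframe_loop loop_br[OF frame_loop u]] by simp
    also have "\<dots> = T (\<lambda>t. \<Sum>i\<in>UNIV. br (dframe i t) (br (fr i t) (u t))) t"
      using T_sum[of UNIV "\<lambda>i t. br (dframe i t) (br (fr i t) (u t))"] loop_br[OF dframe_loop loop_br[OF frame_loop u]]
      by simp
    finally show ?thesis by (simp add: casimir_frame)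
  qed
  have "\<exists>l. \<forall>x. P t x = l *s x" for t
  proof (rule schur)
    show "clin (P t)"
      unfolding P_def clin_def
      by (simp add: br_add_right br_scale_right sum.distrib vec.scale_sum_right)
    fix y x
    obtain u v where uv: "u \<in> L" "u t = x" "v \<in> L" "v t = y" using loop_through by metis
    then show "P t (br y x) = br y (P t x)"
      using P[OF loop_br[OF uv(3,1)], of t] P[OF uv(1), of t] fun_cong[OF T_br[OF uv(3,1)], of t] by simp
  qed
  then obtain a where a: "\<And>t x. P t x = a t *s x" by metis
  have "periodic_fun a"
  proof -
    obtain k :: 'n where True by simp
    \<comment> \<open>Reading the multiplier off the loop \<open>T (fr k)\<close> shows that it is
      smooth and periodic.\<close>
    have "a = coeff (T (fr k)) k"
    proof
      fix t
      have "coeff (T (fr k)) k t = (a t *s axis k 1 :: complex^'n) $ k"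
        unfolding coeff_def P[OF frame_loop] a clin_scale[OF clin_frame] frame_inverse ..
      then show "a t = coeff (T (fr k)) k t" by simp
    qed
    then show ?thesis using periodic_coeff[OF T_L[OF frame_loop]] by simp
  qed
  moreover have "lam \<psi> (\<lambda>t. f t *s u t) t = a t *s lam \<psi> u t" if "u \<in> L" for u t
    using P[OF lam_loop[OF that], of t] T_lam[OF that] a by simp
  ultimately show ?thesis by blast
qed

section \<open>The induced automorphism of the periodic functions\<close>

definition cent :: "(real \<Rightarrow> complex) \<Rightarrow> real \<Rightarrow> complex" where
  "cent f = (SOME a. periodic_fun a \<and> (\<forall>u\<in>L. \<forall>t. lam \<psi> (\<lambda>t. f t *s u t) t = a t *s lam \<psi> u t))"

lemma cent_props:
  assumes f: "periodic_fun f"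
  shows periodic_cent: "periodic_fun (cent f)"
    and lam_cent: "u \<in> L \<Longrightarrow> lam \<psi> (\<lambda>t. f t *s u t) = (\<lambda>t. cent f t *s lam \<psi> u t)"
proof -
  have "periodic_fun (cent f) \<and> (\<forall>u\<in>L. \<forall>t. lam \<psi> (\<lambda>t. f t *s u t) t = cent f t *s lam \<psi> u t)"
    unfolding cent_def by (rule someI_ex[OF lam_centroid[OF f]])
  then show "periodic_fun (cent f)" "u \<in> L \<Longrightarrow> lam \<psi> (\<lambda>t. f t *s u t) = (\<lambda>t. cent f t *s lam \<psi> u t)"
    by auto
qed

lemma cent_eqI:
  assumes f: "periodic_fun f" and "\<And>u t. u \<in> L \<Longrightarrow> lam \<psi> (\<lambda>t. f t *s u t) t = a t *s lam \<psi> u t"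
  shows "cent f = a"
proof
  fix t
  obtain k :: 'n where True by simp
  obtain u where u: "u \<in> L" "lam \<psi> u = fr k" using lam_surj[OF frame_loop] by blast
  have "cent f t *s fr k t = a t *s fr k t"
    using assms(2)[OF u(1), of t] lam_cent[OF f u(1)] u(2) by simp
  then show "cent f t = a t" using fr_nonzero[of t k] by simp
qed

lemma cent_mult: "periodic_fun f \<Longrightarrow> periodic_fun g \<Longrightarrow> cent (\<lambda>t. f t * g t) = (\<lambda>t. cent f t * cent g t)"
proof (rule cent_eqI)
  assume fg: "periodic_fun f" "periodic_fun g"
  then show "periodic_fun (\<lambda>t. f t * g t)" by (rule periodic_fun_mult)
  fix u t assume u: "u \<in> L"
  show "lam \<psi> (\<lambda>t. (f t * g t) *s u t) t = (cent f t * cent g t) *s lam \<psi> u t"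
    using fun_cong[OF lam_cent[OF fg(1) loop_scale_fun[OF fg(2) u]], of t] lam_cent[OF fg(2) u] by simp
qed

lemma cent_add: "periodic_fun f \<Longrightarrow> periodic_fun g \<Longrightarrow> cent (\<lambda>t. f t + g t) = (\<lambda>t. cent f t + cent g t)"
proof (rule cent_eqI)
  assume fg: "periodic_fun f" "periodic_fun g"
  then show "periodic_fun (\<lambda>t. f t + g t)" by (rule periodic_fun_add)
  fix u t assume u: "u \<in> L"
  show "lam \<psi> (\<lambda>t. (f t + g t) *s u t) t = (cent f t + cent g t) *s lam \<psi> u t"
    using fun_cong[OF lam_add[OF loop_scale_fun[OF fg(1) u] loop_scale_fun[OF fg(2) u]], of t]
      lam_cent[OF fg(1) u] lam_cent[OF fg(2) u]
    by (simp add: vec.scale_left_distrib)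
qed

lemma cent_const: "cent (\<lambda>t. c) = (\<lambda>t. c)"
  by (rule cent_eqI[OF periodic_fun_const]) (simp add: lam_scale)

text \<open>Transport (f u)' = f u' + f' u and compare with ad w + m d/dt: the inner part commutes
  with multiplication by \<open>cent f\<close>, so only m times the derivative of
  \<open>cent f\<close> remains.\<close>

lemma cent_dt:
  assumes d: "\<psi> ((\<lambda>t. 0), 0, 1) = (w, n, m)" and f: "periodic_fun f"
  shows "cent (dt f) = (\<lambda>t. m * dt (cent f) t)"
proof (rule cent_eqI[OF periodic_fun_dt[OF f]])
  fix u t assume u: "u \<in> L"
  have sf: "smooth f" and sc: "smooth (cent f)"
    using f periodic_cent[OF f] by (auto simp: periodic_fun_def)
  have "dt (\<lambda>t. f t *s u t) = (\<lambda>t. f t *s dt u t + dt f t *s u t)"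
    using dt_scale[OF sf loop_smooth[OF u]] by blast
  then have "lam \<psi> (dt (\<lambda>t. f t *s u t)) t = cent f t *s lam \<psi> (dt u) t + lam \<psi> (\<lambda>t. dt f t *s u t) t"
    using fun_cong[OF lam_add[OF loop_scale_fun[OF f loop_dt[OF u]] loop_scale_fun[OF periodic_fun_dt[OF f] u]], of t]
      fun_cong[OF lam_cent[OF f loop_dt[OF u]], of t] by simp
  moreover have "lam \<psi> (dt (\<lambda>t. f t *s u t)) t = br (w t) (cent f t *s lam \<psi> u t)
      + m *s (cent f t *s dt (lam \<psi> u) t + dt (cent f) t *s lam \<psi> u t)"
    using lam_dt[OF d loop_scale_fun[OF f u], of t] dt_scale[OF sc loop_smooth[OF lam_loop[OF u]], of t]
    by (simp add: lam_cent[OF f u])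
  ultimately show "lam \<psi> (\<lambda>t. dt f t *s u t) t = (m * dt (cent f) t) *s lam \<psi> u t"
    unfolding lam_dt[OF d u] by (simp add: br_scale_right vec.scale_right_distrib mult.commute)
qed

end

abbreviation ex :: "real \<Rightarrow> complex" where
  "ex \<equiv> \<lambda>t. exp (\<i> * complex_of_real t)"

text \<open>h = \<open>cent \<psi> ex\<close> solves i h = m h' and has no zeros since
  \<open>ex\<close> is a unit. Hence m is nonzero and h = h(0) exp(i t / m), and periodicity makes
  1/m an integer.\<close>

lemma cent_exp_ode:
  assumes \<psi>: "aut_hat br \<sigma> \<psi>" and d: "\<psi> ((\<lambda>t. 0), 0, 1) = (w, n, m)"
  shows "m \<noteq> 0" "cent \<psi> ex t \<noteq> 0" "\<exists>k::int. 1 / m = of_int k \<and> (\<forall>t. cent \<psi> ex t = cent \<psi> ex 0 * exp (\<i> * of_int k * complex_of_real t))"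
proof -
  let ?h = "cent \<psi> ex"
  have per: "periodic_fun ?h" by (rule periodic_cent[OF \<psi> periodic_fun_exp])
  have "cent \<psi> (\<lambda>t. ex t * inverse (ex t)) = (\<lambda>t. ?h t * cent \<psi> (\<lambda>t. inverse (ex t)) t)"
    by (rule cent_mult[OF \<psi> periodic_fun_exp periodic_fun_inverse[OF periodic_fun_exp]]) simp
  moreover have "(\<lambda>t. ex t * inverse (ex t)) = (\<lambda>t. 1)" by simp
  ultimately have "?h t * cent \<psi> (\<lambda>t. inverse (ex t)) t = 1" for t
    using cent_const[OF \<psi>, of 1] by (metis (no_types, lifting))
  then show h0: "?h t \<noteq> 0" for t by (metis mult_zero_left zero_neq_one)
  have "dt ex = (\<lambda>t. \<i> * ex t)" using dt_exp[of \<i>] by blast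
  then have ih: "\<i> * ?h t = m * dt ?h t" for t
    using fun_cong[OF cent_dt[OF \<psi> d periodic_fun_exp], of t]
      fun_cong[OF cent_mult[OF \<psi> periodic_fun_const periodic_fun_exp], of \<i> t] cent_const[OF \<psi>, of \<i>] by simp
  show m: "m \<noteq> 0" using ih[of 0] h0[of 0] by auto
  have sh: "smooth ?h" using per by (simp add: periodic_fun_def)
  let ?g = "\<lambda>t. ?h t * exp (- (\<i> / m) * complex_of_real t)"
  have "(?g has_vector_derivative 0) (at t)" for t
  proof -
    have "(?g has_vector_derivative ?h t * dt (\<lambda>t. exp (- (\<i> / m) * complex_of_real t)) t
        + dt ?h t * exp (- (\<i> / m) * complex_of_real t)) (at t)"
      by (intro has_vector_derivative_mult smooth_has_vector_derivative sh smooth_exp)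
    moreover have "dt ?h t = \<i> / m * ?h t" using ih[of t] m by (simp add: field_simps)
    ultimately show ?thesis by (simp only: dt_exp) (simp add: algebra_simps)
  qed
  then obtain c where c: "\<And>t. ?g t = c"
    using has_vector_derivative_zero_constant[of UNIV ?g] by auto
  then have "?g t = ?h 0" for t using c[of t] c[of 0] by simp
  then have sol: "?h t = ?h 0 * exp (\<i> / m * complex_of_real t)" for t
  proof -
    have "?h t = ?g t * exp (\<i> / m * complex_of_real t)"
      by (simp add: mult.assoc flip: exp_add)
    then show ?thesis by (simp only: \<open>\<And>t. ?g t = ?h 0\<close>)
  qed
  have "?h (0 + 2 * pi) = ?h 0" using per unfolding periodic_fun_def by blast
  then have "exp (\<i> / m * complex_of_real (2 * pi)) = 1"
    using sol[of "2 * pi"] h0[of 0] by simp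
  then obtain k :: int where k: "Re (\<i> / m * complex_of_real (2 * pi)) = 0"
      "Im (\<i> / m * complex_of_real (2 * pi)) = of_int (2 * k) * pi"
    unfolding exp_eq_1 by blast
  have "\<i> / m * complex_of_real (2 * pi) = \<i> * of_int k * complex_of_real (2 * pi)"
    using k by (simp add: complex_eq_iff)
  then have "(1 / m) * (\<i> * complex_of_real (2 * pi)) = of_int k * (\<i> * complex_of_real (2 * pi))"
    by (simp add: divide_inverse mult.assoc mult.left_commute mult.commute)
  moreover have "\<i> * complex_of_real (2 * pi) \<noteq> 0" by simp
  ultimately have "1 / m = of_int k" by (simp only: mult_cancel_right) simp
  have "\<i> / m = \<i> * (1 / m)" by simp
  then have im: "\<i> / m = \<i> * of_int k" unfolding \<open>1 / m = of_int k\<close> .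
  show "\<exists>k::int. 1 / m = of_int k \<and> (\<forall>t. ?h t = ?h 0 * exp (\<i> * of_int k * complex_of_real t))"
  proof (intro exI conjI allI)
    show "1 / m = of_int k" by fact
    show "?h t = ?h 0 * exp (\<i> * of_int k * complex_of_real t)" for t
      using sol[of t] unfolding im .
  qed
qed

text \<open>The factors belonging to \<psi> and to its inverse multiply to 1, and both have integral
  reciprocals.\<close>

lemma aut_hat_d_unit:
  assumes \<psi>: "aut_hat br \<sigma> \<psi>" and d: "\<psi> ((\<lambda>t. 0), 0, 1) = (w, n, m)"
  shows "m = 1 \<or> m = - 1"
proof -
  obtain \<psi>' where \<psi>': "aut_hat br \<sigma> \<psi>'" "\<forall>x\<in>G. \<psi> (\<psi>' x) = x"
    using aut_hat_inverse[OF \<psi>] by blast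
  have dG: "((\<lambda>t. 0), 0, 1) \<in> G" by (simp add: G_iff loop_0)
  obtain w' n' m' where d': "\<psi>' ((\<lambda>t. 0), 0, 1) = (w', n', m')" by (metis prod_cases3)
  have w': "w' \<in> L" using aut_hat_props(1)[OF \<psi>'(1) dG] d' by (simp add: G_iff)
  have "(w', n', m') = aadd (w', n', 0) (ascale m' ((\<lambda>t. 0), 0, 1))"
    by (simp add: aadd_eq ascale_eq)
  then have "\<psi> (w', n', m') = aadd (\<psi> (w', n', 0)) (ascale m' (w, n, m))"
    using aut_hat_props(2)[OF \<psi>, of "(w', n', 0)" "ascale m' ((\<lambda>t. 0), 0, 1)"]
      aut_hat_props(3)[OF \<psi> dG, of m'] d w' dG by (simp add: G_iff G_ascale)
  moreover have "\<psi> (w', n', m') = ((\<lambda>t. 0), 0, 1)" using \<psi>'(2) dG d' by metis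
  ultimately have "m' * m = 1"
    using aut_hat_d_component[OF \<psi> w', of n'] by (simp add: aadd_def ascale_def)
  obtain k k' :: int where k: "1 / m = of_int k" "1 / m' = of_int k'"
    using cent_exp_ode(3)[OF \<psi> d] cent_exp_ode(3)[OF \<psi>'(1) d'] by blast
  have "of_int (k * k') = 1 / (m' * m)" by (simp flip: k)
  then have "of_int (k * k') = (1 :: complex)" using \<open>m' * m = 1\<close> by simp
  then have "k * k' = 1" by (metis of_int_eq_1_iff)
  then have "k = 1 \<or> k = - 1" by (rule zmult_eq_1_iff[THEN iffD1, THEN disj_forward]) auto
  then show ?thesis using arg_cong[OF k(1), of inverse] by auto
qed

lemma cent_exp:
  assumes \<psi>: "aut_hat br \<sigma> \<psi>"
  shows "\<exists>e s. (e = 1 \<or> e = - 1) \<and> (\<forall>t. cent \<psi> ex t = ex (e * t + s))"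
proof -
  obtain w n m where d: "\<psi> ((\<lambda>t. 0), 0, 1) = (w, n, m)" by (metis prod_cases3)
  obtain k :: int where k: "1 / m = of_int k" "\<And>t. cent \<psi> ex t = cent \<psi> ex 0 * exp (\<i> * of_int k * complex_of_real t)"
    using cent_exp_ode(3)[OF \<psi> d] by blast
  let ?c = "cent \<psi> ex 0"
  have c0: "?c \<noteq> 0" by (rule cent_exp_ode(2)[OF \<psi> d])
  \<comment> \<open>If \<open>?c\<close> lay off the unit circle, \<open>ex\<close> minus the
    constant \<open>?c\<close> would be a unit, yet its image vanishes at 0.\<close>
  have "norm ?c = 1"
  proof (rule ccontr)
    assume c: "norm ?c \<noteq> 1"
    let ?f = "\<lambda>t. ex t + - ?c"
    have f: "periodic_fun ?f" by (intro periodic_fun_add periodic_fun_exp periodic_fun_const)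
    have f0: "?f t \<noteq> 0" for t
    proof
      assume "?f t = 0"
      then have "ex t = ?c" by simp
      then show False using c norm_exp_i_times[of t] by metis
    qed
    have "cent \<psi> (\<lambda>t. ?f t * inverse (?f t)) = (\<lambda>t. cent \<psi> ?f t * cent \<psi> (\<lambda>t. inverse (?f t)) t)"
      by (rule cent_mult[OF \<psi> f periodic_fun_inverse[OF f f0]])
    moreover have "(\<lambda>t. ?f t * inverse (?f t)) = (\<lambda>t. 1)" using f0 by (intro ext) simp
    ultimately have "cent \<psi> ?f 0 * cent \<psi> (\<lambda>t. inverse (?f t)) 0 = 1"
      using cent_const[OF \<psi>, of 1] by (metis (no_types, lifting))
    moreover have "cent \<psi> ?f 0 = 0"
      using fun_cong[OF cent_add[OF \<psi> periodic_fun_exp periodic_fun_const], of "- ?c" 0] cent_const[OF \<psi>, of "- ?c"]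
      by simp
    ultimately show False by simp
  qed
  then obtain s where s: "?c = ex s" unfolding complex_norm_eq_1_exp by metis
  have "m = 1 \<or> m = - 1" by (rule aut_hat_d_unit[OF \<psi> d])
  then have "complex_of_int k = of_int 1 \<or> complex_of_int k = of_int (- 1)"
    using k(1) by auto
  then have "k = 1 \<or> k = - 1" by (simp only: of_int_eq_iff)
  then have "real_of_int k = 1 \<or> real_of_int k = - 1" by auto
  moreover have "cent \<psi> ex t = ex (real_of_int k * t + s)" for t
    using k(2)[of t] unfolding s by (simp add: distrib_left exp_add mult.commute mult.left_commute)
  ultimately show ?thesis by blast
qed

lemma ex_eq_imp: "ex t = ex s \<Longrightarrow> periodic_fun f \<Longrightarrow> f t = f s"
proof -
  assume eq: "ex t = ex s" and f: "periodic_fun f"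
  obtain k :: int where "t = s + of_int (2 * k) * pi"
    using eq unfolding exp_eq by (auto simp: complex_eq_iff)
  have shift: "f (r + 2 * pi * real n) = f r" for r n
  proof (induction n)
    case (Suc n)
    have "f (r + 2 * pi * real (Suc n)) = f ((r + 2 * pi * real n) + 2 * pi)"
      by (simp add: algebra_simps)
    then show ?case using f Suc by (simp add: periodic_fun_def)
  qed simp
  show ?thesis
  proof (cases "k \<ge> 0")
    case True
    then show ?thesis using shift[of s "nat k"] \<open>t = _\<close> by (simp add: algebra_simps)
  next
    case False
    then show ?thesis using shift[of t "nat (- k)"] \<open>t = _\<close> by (simp add: algebra_simps)
  qed
qed

text \<open>If \<open>cent f t\<close> differed from \<open>f t0\<close>, the positive function \<open>|f - cent f t|\<^sup>2 + |e - e t0|\<^sup>2\<close> would be invertible,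
  but its image vanishes at \<open>t\<close>.\<close>

lemma cent_eval:
  assumes \<psi>: "aut_hat br \<sigma> \<psi>" and t0: "cent \<psi> ex t = ex t0" and f: "periodic_fun f"
  shows "cent \<psi> f t = f t0"
proof (rule ccontr)
  assume neq: "cent \<psi> f t \<noteq> f t0"
  let ?g = "\<lambda>t'. f t' + - cent \<psi> f t" and ?e = "\<lambda>t'. ex t' + - ex t0"
  let ?F = "\<lambda>t'. ?g t' * cnj (?g t') + ?e t' * cnj (?e t')"
  have g: "periodic_fun ?g" and e: "periodic_fun ?e"
    by (intro periodic_fun_add f periodic_fun_exp periodic_fun_const)+
  have gg: "periodic_fun (\<lambda>t'. ?g t' * cnj (?g t'))" and ee: "periodic_fun (\<lambda>t'. ?e t' * cnj (?e t'))"
    by (intro periodic_fun_mult periodic_fun_cnj g e)+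
  have F: "periodic_fun ?F" by (rule periodic_fun_add[OF gg ee])
  have F0: "?F t' \<noteq> 0" for t'
  proof
    assume "?F t' = 0"
    then have "complex_of_real ((norm (?g t'))\<^sup>2 + (norm (?e t'))\<^sup>2) = 0"
      by (simp only: complex_norm_square[symmetric] of_real_add)
    then have "norm (?g t') = 0" "norm (?e t') = 0"
      by (simp_all only: of_real_eq_0_iff sum_power2_eq_zero_iff)
    then have "f t' = cent \<psi> f t" "ex t' = ex t0" by auto
    then show False using ex_eq_imp[OF _ f, of t' t0] neq by simp
  qed
  have "cent \<psi> ?g t = 0"
    using fun_cong[OF cent_add[OF \<psi> f periodic_fun_const], of "- cent \<psi> f t" t] cent_const[OF \<psi>] by simp
  moreover have "cent \<psi> ?e t = 0"
    using fun_cong[OF cent_add[OF \<psi> periodic_fun_exp periodic_fun_const], of "- ex t0" t] cent_const[OF \<psi>] t0 by simp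
  ultimately have "cent \<psi> ?F t = 0"
    using fun_cong[OF cent_add[OF \<psi> gg ee], of t] fun_cong[OF cent_mult[OF \<psi> g periodic_fun_cnj[OF g]], of t]
      fun_cong[OF cent_mult[OF \<psi> e periodic_fun_cnj[OF e]], of t] by simp
  moreover have "cent \<psi> ?F t * cent \<psi> (\<lambda>t. inverse (?F t)) t = 1"
  proof -
    have "cent \<psi> (\<lambda>t. ?F t * inverse (?F t)) = (\<lambda>t. cent \<psi> ?F t * cent \<psi> (\<lambda>t. inverse (?F t)) t)"
      by (rule cent_mult[OF \<psi> F periodic_fun_inverse[OF F F0]])
    moreover have "(\<lambda>t. ?F t * inverse (?F t)) = (\<lambda>t. 1)" using F0 by (intro ext right_inverse)
    ultimately show ?thesis using fun_cong[OF cent_const[OF \<psi>, of 1], of t] by simp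
  qed
  ultimately show False by simp
qed

text \<open>Expand u in the frame. \<open>lam \<psi>\<close> turns each coefficient f into
  \<open>cent \<psi> f\<close>, which by \<open>cent_eval\<close> is f at e t + s, so the result
  depends on u only through u(e t + s).\<close>

lemma aut_hat_pointwise:
  assumes \<psi>: "aut_hat br \<sigma> \<psi>"
  shows "\<exists>e s A. (e = 1 \<or> e = - 1) \<and> (\<forall>t. lie_aut br (A t)) \<and>
    (\<forall>u\<in>L. \<forall>a. \<exists>a'. \<psi> (u, a, 0) = ((\<lambda>t. A t (u (e * t + s))), a', 0))"
proof -
  obtain e s where es: "e = 1 \<or> e = - 1" "\<And>t. cent \<psi> ex t = ex (e * t + s)"
    using cent_exp[OF \<psi>] by blast
  define A where "A t x = (\<Sum>i\<in>UNIV. frame (- (e * t + s)) x $ i *s lam \<psi> (fr i) t)" for t x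
  have A: "lam \<psi> u t = A t (u (e * t + s))" if u: "u \<in> L" for u t
  proof -
    have "lam \<psi> u = lam \<psi> (\<lambda>t. \<Sum>i\<in>UNIV. coeff u i t *s fr i t)"
      by (subst coeff_expand[of u, symmetric]) simp
    also have "\<dots> = (\<lambda>t. \<Sum>i\<in>UNIV. lam \<psi> (\<lambda>t. coeff u i t *s fr i t) t)"
      by (rule lam_sum[OF \<psi> loop_scale_fun[OF periodic_coeff[OF u] frame_loop]])
    finally have "lam \<psi> u t = (\<Sum>i\<in>UNIV. cent \<psi> (coeff u i) t *s lam \<psi> (fr i) t)"
      by (simp add: lam_cent[OF \<psi> periodic_coeff[OF u] frame_loop])
    then show ?thesis
      by (simp add: cent_eval[OF \<psi> es(2) periodic_coeff[OF u]] A_def coeff_def)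
  qed
  have through: "\<exists>u\<in>L. u (e * t + s) = x" for t x by (rule loop_through)
  have clin: "clin (A t)" for t
    unfolding A_def clin_def
    by (simp add: clin_add[OF clin_frame] clin_scale[OF clin_frame] vec.scale_left_distrib sum.distrib
      vec.scale_sum_right)
  have hom: "A t (br x y) = br (A t x) (A t y)" for t x y
  proof -
    obtain u v where "u \<in> L" "u (e * t + s) = x" "v \<in> L" "v (e * t + s) = y" using through by metis
    then show ?thesis
      using A[OF loop_br[of u v], of t] A[of u t] A[of v t] lam_br[OF \<psi>, of u v] by simp
  qed
  have "surj (A t)" for t
    unfolding surj_def
  proof (rule allI)
    fix y
    obtain v where v: "v \<in> L" "v t = y" using loop_through by blast
    obtain u where "u \<in> L" "lam \<psi> u = v" using lam_surj[OF \<psi> v(1)] by blast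
    then show "\<exists>x. y = A t x" using A[of u t] v by metis
  qed
  then have "lie_aut br (A t)" for t
    using clin clin_surj_imp_inj[OF clin] hom by (simp add: lie_aut_def bij_def clin_def)
  moreover have "\<exists>a'. \<psi> (u, a, 0) = ((\<lambda>t. A t (u (e * t + s))), a', 0)" if "u \<in> L" for u a
  proof -
    have "lam \<psi> u = (\<lambda>t. A t (u (e * t + s)))" using A[OF that] by blast
    then show ?thesis
      using fst_aut_hat[OF \<psi> that, of a] aut_hat_d_component[OF \<psi> that, of a]
      by (intro exI[of _ "fst (snd (\<psi> (u, a, 0)))"]) (simp add: prod_eq_iff)
  qed
  ultimately show ?thesis using es(1) by (intro exI[of _ e] exI[of _ s] exI[of _ A]) blast
qed

end

subsection \<open>The group of linear and antilinear automorphisms\<close>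

text \<open>The flag \<open>c\<close> marks antilinear maps. Off the affine algebra the maps are the identity, so that they are
  permutations of the whole type and can be composed and inverted there.\<close>

definition gaut :: "('n::finite gv \<Rightarrow> 'n gv \<Rightarrow> 'n gv) \<Rightarrow> ('n gv \<Rightarrow> 'n gv) \<Rightarrow> bool \<Rightarrow> ('n aff \<Rightarrow> 'n aff) \<Rightarrow> bool" where
  "gaut br \<sigma> c \<phi> \<longleftrightarrow> bij_betw \<phi> (LGhat \<sigma>) (LGhat \<sigma>) \<and> (\<forall>x. x \<notin> LGhat \<sigma> \<longrightarrow> \<phi> x = x) \<and>
     (\<forall>x\<in>LGhat \<sigma>. \<forall>y\<in>LGhat \<sigma>. \<phi> (aadd x y) = aadd (\<phi> x) (\<phi> y)) \<and>
     (\<forall>z. \<forall>x\<in>LGhat \<sigma>. \<phi> (ascale z x) = ascale (if c then cnj z else z) (\<phi> x)) \<and>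
     (\<forall>x\<in>LGhat \<sigma>. \<forall>y\<in>LGhat \<sigma>. \<phi> (abr br x y) = abr br (\<phi> x) (\<phi> y))"

text \<open>Pointwise action with the parameter kept fixed. The central coordinate is left free and
  d is not mentioned, so a linear automorphism is determined by \<open>T\<close> only up to
  \<open>shift\<close>.\<close>

definition pw :: "('n::finite gv \<Rightarrow> 'n gv) \<Rightarrow> (real \<Rightarrow> 'n gv \<Rightarrow> 'n gv) \<Rightarrow> ('n aff \<Rightarrow> 'n aff) \<Rightarrow> bool" where
  "pw \<sigma> T g \<longleftrightarrow> (\<forall>u\<in>loop_alg \<sigma>. \<forall>a. \<exists>a'. g (u, a, 0) = ((\<lambda>t. T t (u t)), a', 0))"

definition pos_aut :: "('n::finite gv \<Rightarrow> 'n gv \<Rightarrow> 'n gv) \<Rightarrow> ('n gv \<Rightarrow> 'n gv) \<Rightarrow> ('n aff \<Rightarrow> 'n aff) \<Rightarrow> bool" where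
  "pos_aut br \<sigma> g \<longleftrightarrow> gaut br \<sigma> False g \<and> (\<exists>T. (\<forall>t. posdiag (T t)) \<and> pw \<sigma> T g)"

definition omega :: "('n::finite gv \<Rightarrow> 'n gv) \<Rightarrow> 'n gv set \<Rightarrow> 'n aff \<Rightarrow> 'n aff" where
  "omega \<sigma> W x = (if x \<in> LGhat \<sigma> then ((\<lambda>t. rconj W (fst x t)), cnj (fst (snd x)), cnj (snd (snd x))) else x)"

text \<open>The automorphism that fixes loops and c and sends d to d + r c. These form the kernel of
  the passage from automorphisms to pointwise families, see \<open>pw_id_shift\<close>.\<close>

definition shift :: "('n::finite gv \<Rightarrow> 'n gv) \<Rightarrow> complex \<Rightarrow> 'n aff \<Rightarrow> 'n aff" where
  "shift \<sigma> r x = (if x \<in> LGhat \<sigma> then (fst x, fst (snd x) + r * snd (snd x), snd (snd x)) else x)"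

context simple_compact begin

abbreviation "\<Gamma> \<equiv> gaut br \<sigma>"
abbreviation "\<omega> \<equiv> omega \<sigma> U"

lemma gaut_G: "\<Gamma> c \<phi> \<Longrightarrow> x \<in> G \<Longrightarrow> \<phi> x \<in> G"
  and gaut_outside: "\<Gamma> c \<phi> \<Longrightarrow> x \<notin> G \<Longrightarrow> \<phi> x = x"
  and gaut_add: "\<Gamma> c \<phi> \<Longrightarrow> x \<in> G \<Longrightarrow> y \<in> G \<Longrightarrow> \<phi> (aadd x y) = aadd (\<phi> x) (\<phi> y)"
  and gaut_scale: "\<Gamma> c \<phi> \<Longrightarrow> x \<in> G \<Longrightarrow> \<phi> (ascale z x) = ascale (if c then cnj z else z) (\<phi> x)"
  and gaut_br: "\<Gamma> c \<phi> \<Longrightarrow> x \<in> G \<Longrightarrow> y \<in> G \<Longrightarrow> \<phi> (abr br x y) = abr br (\<phi> x) (\<phi> y)"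
  unfolding gaut_def by (blast dest: bij_betwE, blast, simp_all)

lemma gaut_bij:
  assumes "\<Gamma> c \<phi>"
  shows "bij \<phi>"
proof -
  have "bij_betw \<phi> (- G) (- G)"
    using assms by (intro bij_betw_byWitness[where f' = "\<lambda>x. x"]) (auto simp: gaut_def)
  with assms have "bij_betw \<phi> (G \<union> - G) (G \<union> - G)"
    unfolding gaut_def by (intro bij_betw_combine) auto
  then show ?thesis by simp
qed

lemma gaut_inv_apply: "\<Gamma> c \<phi> \<Longrightarrow> inv \<phi> (\<phi> x) = x" "\<Gamma> c \<phi> \<Longrightarrow> \<phi> (inv \<phi> x) = x"
  using gaut_bij by (metis bij_inv_eq_iff)+

lemma gaut_inv_G: "\<Gamma> c \<phi> \<Longrightarrow> x \<in> G \<Longrightarrow> inv \<phi> x \<in> G"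
  by (metis gaut_inv_apply(2) gaut_outside)

lemma gaut_comp:
  assumes a: "\<Gamma> a \<phi>" and b: "\<Gamma> b \<psi>"
  shows "\<Gamma> (a \<noteq> b) (\<phi> \<circ> \<psi>)"
proof -
  have "bij_betw (\<phi> \<circ> \<psi>) G G"
    using a b unfolding gaut_def by (intro bij_betw_trans) auto
  then show ?thesis
    unfolding gaut_def[of br \<sigma> "a \<noteq> b"]
    by (auto simp: gaut_outside[OF a] gaut_outside[OF b] gaut_G[OF b] gaut_add[OF a] gaut_add[OF b]
      gaut_scale[OF a] gaut_scale[OF b] gaut_br[OF a] gaut_br[OF b])
qed

lemma gaut_id: "\<Gamma> False id"
  by (simp add: gaut_def)

lemma gaut_inv:
  assumes a: "\<Gamma> c \<phi>"
  shows "\<Gamma> c (inv \<phi>)"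
proof -
  note i = gaut_inv_apply[OF a]
  have eq: "inv \<phi> x = y" if "\<phi> y = x" for x y using i that by blast
  have "bij_betw (inv \<phi>) G G"
    by (rule bij_betw_byWitness[where f' = \<phi>]) (auto simp: i gaut_G[OF a] gaut_inv_G[OF a])
  then show ?thesis
    unfolding gaut_def
  proof (intro conjI ballI allI impI)
    show "inv \<phi> x = x" if "x \<notin> G" for x by (rule eq) (rule gaut_outside[OF a that])
    fix x y assume xy: "x \<in> G" "y \<in> G"
    show "inv \<phi> (aadd x y) = aadd (inv \<phi> x) (inv \<phi> y)"
      by (rule eq) (simp add: gaut_add[OF a] gaut_inv_G[OF a] xy i)
    show "inv \<phi> (abr br x y) = abr br (inv \<phi> x) (inv \<phi> y)"
      by (rule eq) (simp add: gaut_br[OF a] gaut_inv_G[OF a] xy i)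
  next
    fix z x assume x: "x \<in> G"
    show "inv \<phi> (ascale z x) = ascale (if c then cnj z else z) (inv \<phi> x)"
      by (rule eq) (simp add: gaut_scale[OF a] gaut_inv_G[OF a] x i)
  qed
qed

lemma gaut_aut_hat: "\<Gamma> False \<phi> \<Longrightarrow> aut_hat br \<sigma> \<phi>"
  by (simp add: gaut_def aut_hat_def)

lemma aut_hat_gaut: "aut_hat br \<sigma> \<phi> \<Longrightarrow> \<Gamma> False (\<lambda>x. if x \<in> G then \<phi> x else x)"
proof -
  assume \<phi>: "aut_hat br \<sigma> \<phi>"
  then have "bij_betw (\<lambda>x. if x \<in> G then \<phi> x else x) G G"
    unfolding aut_hat_def by (auto cong: bij_betw_cong)
  then show ?thesis
    unfolding gaut_def by (simp add: aut_hat_props[OF \<phi>] G_aadd G_ascale G_abr)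
qed

lemma omega_G: "x \<in> G \<Longrightarrow> \<omega> x \<in> G"
  by (cases x) (simp add: omega_def G_iff loop_\<tau>)

lemma omega_omega: "\<omega> (\<omega> x) = x"
  using omega_G[of x] by (simp add: omega_def rconj_rconj)

lemma dt_\<tau>: "smooth u \<Longrightarrow> dt (\<lambda>t. \<tau> (u t)) t = \<tau> (dt u t)"
  by (rule dt_bounded_linear[OF bounded_linear_rconj])

lemma gaut_omega: "\<Gamma> True \<omega>"
  unfolding gaut_def
proof (intro conjI ballI allI impI)
  show "bij_betw \<omega> G G"
    by (rule bij_betw_byWitness[where f' = \<omega>]) (auto simp: omega_omega omega_G)
  show "\<omega> x = x" if "x \<notin> G" for x using that by (simp add: omega_def)
  fix x y assume xy: "x \<in> G" "y \<in> G"
  obtain u a b v a' b' where eq: "x = (u, a, b)" "y = (v, a', b')" by (metis prod_cases3)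
  have L: "u \<in> L" "v \<in> L" using xy eq by (simp_all add: G_iff)
  have s: "smooth u" "smooth v" "smooth (dt u)" using L by (auto intro: loop_smooth smooth_vector_derivative)
  show "\<omega> (aadd x y) = aadd (\<omega> x) (\<omega> y)"
    using xy G_aadd[OF xy] by (simp add: omega_def aadd_def rconj_add)
  have "ldot br (\<lambda>t. \<tau> (dt u t)) (\<lambda>t. \<tau> (v t)) = cnj (ldot br (dt u) v)"
    unfolding ldot_def killing_rconj
    using integral_linear[OF killing_integrable[OF s(3,2)] bounded_linear_cnj] by (simp add: o_def)
  then show "\<omega> (abr br x y) = abr br (\<omega> x) (\<omega> y)"
    using xy G_abr[OF xy] unfolding eq
    by (simp add: omega_def abr_eq rconj_add rconj_diff rconj_scale rconj_br dt_\<tau> s)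
next
  fix z x assume x: "x \<in> G"
  show "\<omega> (ascale z x) = ascale (if True then cnj z else z) (\<omega> x)"
    using x G_ascale[OF x] by (simp add: omega_def ascale_def rconj_scale)
qed

lemma omega_comp: "\<omega> \<circ> \<omega> = id"
  by (simp add: fun_eq_iff omega_omega)

lemma Uhat_omega: "Uhat \<sigma> U = {x \<in> G. \<omega> x = x}"
  unfolding Uhat_def omega_def
  by (auto simp: rconj_mem fun_eq_iff prod_eq_iff Reals_cnj_iff)

text \<open>An antilinear map becomes linear after composition with \<omega>, which acts on loops
  pointwise by \<tau>.\<close>

lemma gaut_pointwise:
  assumes a: "\<Gamma> c \<alpha>"
  shows "\<exists>e s A. (e = 1 \<or> e = - 1) \<and> (\<forall>t. bij (A t) \<and> (\<forall>x y. A t (x + y) = A t x + A t y) \<and>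
      (\<forall>z x. A t (z *s x) = (if c then cnj z else z) *s A t x)) \<and>
    (\<forall>u\<in>L. \<forall>a. \<exists>a'. \<alpha> (u, a, 0) = ((\<lambda>t. A t (u (e * t + s))), a', 0))"
proof -
  have lin: ?thesis if \<beta>: "aut_hat br \<sigma> \<beta>" and "\<alpha> = (if c then \<beta> \<circ> \<omega> else \<beta>)" for \<beta>
  proof -
    obtain e s A where *: "e = 1 \<or> e = - 1" "\<And>t. lie_aut br (A t)"
      "\<And>u a. u \<in> L \<Longrightarrow> \<exists>a'. \<beta> (u, a, 0) = ((\<lambda>t. A t (u (e * t + s))), a', 0)"
      using aut_hat_pointwise[OF \<beta>] by blast
    let ?A = "\<lambda>t x. if c then A t (\<tau> x) else A t x"
    have "bij (?A t)" for t
      using lie_aut_bij[OF *(2)[of t]] bij_comp[OF bij_rconj lie_aut_bij[OF *(2)[of t]]]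
      by (cases c) (simp_all add: o_def)
    moreover have "?A t (x + y) = ?A t x + ?A t y \<and> ?A t (z *s x) = (if c then cnj z else z) *s ?A t x" for t x y z
      using lie_aut_clin[OF *(2)[of t]] by (simp add: clin_add clin_scale rconj_add rconj_scale)
    moreover have "\<exists>a'. \<alpha> (u, a, 0) = ((\<lambda>t. ?A t (u (e * t + s))), a', 0)" if u: "u \<in> L" for u a
      using *(3)[OF u] *(3)[OF loop_\<tau>[OF u]] u \<open>\<alpha> = _\<close> by (cases c) (simp_all add: omega_def G_iff)
    ultimately show ?thesis using *(1) by (intro exI[of _ e] exI[of _ s] exI[of _ ?A]) blast
  qed
  show ?thesis
  proof (cases c)
    case True
    have "\<Gamma> False (\<alpha> \<circ> \<omega>)" using gaut_comp[OF a gaut_omega] True by simp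
    then show ?thesis
      by (rule lin[OF gaut_aut_hat]) (simp add: True comp_assoc omega_comp)
  next
    case False
    then have "\<Gamma> False \<alpha>" using a by simp
    then show ?thesis by (rule lin[OF gaut_aut_hat]) (simp add: False)
  qed
qed

section \<open>Automorphisms that act pointwise\<close>

lemma pw_unique: "pw \<sigma> T g \<Longrightarrow> pw \<sigma> T' g \<Longrightarrow> T = T'"
proof (intro ext)
  fix t x assume T: "pw \<sigma> T g" "pw \<sigma> T' g"
  obtain u where u: "u \<in> L" "u t = x" using loop_through by blast
  have "(\<lambda>t. T t (u t)) = (\<lambda>t. T' t (u t))"
    using T u(1) unfolding pw_def by (metis prod.inject)
  then show "T t x = T' t x" using u(2) by metis
qed

lemma pw_loop: "\<Gamma> False g \<Longrightarrow> pw \<sigma> T g \<Longrightarrow> u \<in> L \<Longrightarrow> (\<lambda>t. T t (u t)) \<in> L"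
proof -
  assume g: "\<Gamma> False g" "pw \<sigma> T g" and u: "u \<in> L"
  then obtain a where "g (u, 0, 0) = ((\<lambda>t. T t (u t)), a, 0)" unfolding pw_def by blast
  then show ?thesis using gaut_G[OF g(1), of "(u, 0, 0)"] u by (simp add: G_iff)
qed

lemma pw_comp: "pw \<sigma> S f \<Longrightarrow> \<Gamma> False g \<Longrightarrow> pw \<sigma> T g \<Longrightarrow> pw \<sigma> (\<lambda>t x. S t (T t x)) (f \<circ> g)"
  unfolding pw_def[of \<sigma> _ "f \<circ> g"]
proof (intro ballI allI)
  fix u a assume f: "pw \<sigma> S f" and g: "\<Gamma> False g" "pw \<sigma> T g" and u: "u \<in> L"
  then obtain a' where "g (u, a, 0) = ((\<lambda>t. T t (u t)), a', 0)" unfolding pw_def by blast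
  moreover obtain a'' where "f ((\<lambda>t. T t (u t)), a', 0) = ((\<lambda>t. S t (T t (u t))), a'', 0)"
    using f pw_loop[OF g u] unfolding pw_def by blast
  ultimately show "\<exists>a'. (f \<circ> g) (u, a, 0) = ((\<lambda>t. S t (T t (u t))), a', 0)" by simp
qed

text \<open>The parameter changes of \<alpha> and of its inverse cancel, so the conjugate is
  pointwise again, its value at t being conjugate to the old one at e t + s. This makes positivity
  invariant under the whole group.\<close>

lemma pw_conj:
  assumes a: "\<Gamma> c \<alpha>" and g: "\<Gamma> False g" "pw \<sigma> T g"
  shows "\<exists>e s A. (\<forall>t. bij (A t) \<and> (\<forall>x y. A t (x + y) = A t x + A t y) \<and>
      (\<forall>z x. A t (z *s x) = (if c then cnj z else z) *s A t x)) \<and>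
      pw \<sigma> (\<lambda>t x. A t (T (e * t + s) (inv (A t) x))) (\<alpha> \<circ> g \<circ> inv \<alpha>)"
proof -
  obtain e s A where A: "\<And>t. bij (A t)" "\<And>t x y. A t (x + y) = A t x + A t y"
      "\<And>t z x. A t (z *s x) = (if c then cnj z else z) *s A t x"
    "\<And>u a. u \<in> L \<Longrightarrow> \<exists>a'. \<alpha> (u, a, 0) = ((\<lambda>t. A t (u (e * t + s))), a', 0)"
    using gaut_pointwise[OF a] by blast
  have "pw \<sigma> (\<lambda>t x. A t (T (e * t + s) (inv (A t) x))) (\<alpha> \<circ> g \<circ> inv \<alpha>)"
    unfolding pw_def
  proof (intro ballI allI)
    fix v a0 assume v: "v \<in> L"
    obtain u a1 where u: "inv \<alpha> (v, a0, 0) = (u, a1, 0)"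
      using gaut_pointwise[OF gaut_inv[OF a]] v by blast
    have uL: "u \<in> L" using gaut_inv_G[OF a, of "(v, a0, 0)"] u v by (simp add: G_iff)
    have "\<alpha> (u, a1, 0) = (v, a0, 0)" using gaut_inv_apply(2)[OF a] u by metis
    then have vt: "v t = A t (u (e * t + s))" for t using A(4)[OF uL, of a1] by auto
    obtain a2 where a2: "g (u, a1, 0) = ((\<lambda>t. T t (u t)), a2, 0)" using g(2) uL unfolding pw_def by blast
    obtain a3 where "\<alpha> ((\<lambda>t. T t (u t)), a2, 0) = ((\<lambda>t. A t (T (e * t + s) (u (e * t + s)))), a3, 0)"
      using A(4)[OF pw_loop[OF g uL], of a2] by blast
    moreover have "inv (A t) (v t) = u (e * t + s)" for t
      unfolding vt using A(1) by (simp add: bij_is_inj)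
    ultimately show "\<exists>a'. (\<alpha> \<circ> g \<circ> inv \<alpha>) (v, a0, 0) = ((\<lambda>t. A t (T (e * t + s) (inv (A t) (v t)))), a', 0)"
      using u a2 by simp
  qed
  then show ?thesis using A(1-3) by (intro exI[of _ e] exI[of _ s] exI[of _ A]) blast
qed

lemma pos_aut_conj:
  assumes a: "\<Gamma> c \<alpha>" and g: "pos_aut br \<sigma> g"
  shows "pos_aut br \<sigma> (\<alpha> \<circ> g \<circ> inv \<alpha>)"
proof -
  obtain T where T: "\<Gamma> False g" "\<And>t. posdiag (T t)" "pw \<sigma> T g" using g unfolding pos_aut_def by blast
  obtain e s A where A: "\<And>t. bij (A t)" "\<And>t x y. A t (x + y) = A t x + A t y"
      "\<And>t z x. A t (z *s x) = (if c then cnj z else z) *s A t x"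
      "pw \<sigma> (\<lambda>t x. A t (T (e * t + s) (inv (A t) x))) (\<alpha> \<circ> g \<circ> inv \<alpha>)"
    using pw_conj[OF a T(1,3)] by blast
  have "posdiag (\<lambda>x. A t (T (e * t + s) (inv (A t) x)))" for t
  proof (rule posdiag_conj[OF T(2) A(1,2)])
    show "(\<forall>z x. A t (z *s x) = z *s A t x) \<or> (\<forall>z x. A t (z *s x) = cnj z *s A t x)"
      using A(3) by (cases c) simp_all
    show "A t (T (e * t + s) (inv (A t) (A t x))) = A t (T (e * t + s) x)" for x
      using A(1) by (simp add: bij_is_inj)
  qed
  moreover have "\<Gamma> False (\<alpha> \<circ> g \<circ> inv \<alpha>)"
    using gaut_comp[OF gaut_comp[OF a T(1)] gaut_inv[OF a]] by simp
  ultimately show ?thesis using A(4) unfolding pos_aut_def by (intro conjI exI allI)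
qed

lemma pw_inv:
  assumes g: "\<Gamma> False g" "pw \<sigma> T g" and T: "\<And>t. bij (T t)"
  shows "pw \<sigma> (\<lambda>t. inv (T t)) (inv g)"
  unfolding pw_def
proof (intro ballI allI)
  fix v a0 assume v: "v \<in> L"
  obtain u a1 where u: "inv g (v, a0, 0) = (u, a1, 0)"
    using gaut_pointwise[OF gaut_inv[OF g(1)]] v by blast
  have uL: "u \<in> L" using gaut_inv_G[OF g(1), of "(v, a0, 0)"] u v by (simp add: G_iff)
  have "g (u, a1, 0) = (v, a0, 0)" using gaut_inv_apply(2)[OF g(1)] u by metis
  then have "v t = T t (u t)" for t using g(2) uL unfolding pw_def by (metis prod.inject)
  then have "inv (T t) (v t) = u t" for t using T by (simp add: bij_is_inj)
  then show "\<exists>a'. inv g (v, a0, 0) = ((\<lambda>t. inv (T t) (v t)), a', 0)" using u by simp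
qed

lemma pos_aut_inv: "pos_aut br \<sigma> g \<Longrightarrow> pos_aut br \<sigma> (inv g)"
proof -
  assume "pos_aut br \<sigma> g"
  then obtain T where T: "\<Gamma> False g" "\<And>t. posdiag (T t)" "pw \<sigma> T g" unfolding pos_aut_def by blast
  show ?thesis
    unfolding pos_aut_def
    by (intro conjI exI[of _ "\<lambda>t. inv (T t)"] allI gaut_inv[OF T(1)] pw_inv[OF T(1,3)] posdiag_inv posdiag_bij T(2))
qed

context
  fixes g T
  assumes g: "\<Gamma> False g" and T: "pw \<sigma> T g"
begin

lemma lam_pw: "u \<in> L \<Longrightarrow> lam g u = (\<lambda>t. T t (u t))"
  using T unfolding lam_def pw_def by (metis fst_conv)

text \<open>The definition of \<open>pw\<close> puts no condition on \<open>T\<close>. Along every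
  loop its values agree with those of the automorphisms from \<open>aut_hat_pointwise\<close>, and
  loops pass through any given vectors, so the algebraic laws carry over.\<close>

lemma pw_lie_aut: "lie_aut br (T t)"
proof -
  obtain e s A where A: "\<And>t. lie_aut br (A t)"
    "\<And>u. u \<in> L \<Longrightarrow> \<exists>a'. g (u, 0, 0) = ((\<lambda>t. A t (u (e * t + s))), a', 0)"
    using aut_hat_pointwise[OF gaut_aut_hat[OF g]] by blast
  have eq: "T t (u t) = A t (u (e * t + s))" if "u \<in> L" for u t
    using fun_cong[OF lam_pw[OF that], of t] A(2)[OF that] by (auto simp: lam_def)
  have "surj (T t)"
    unfolding surj_def
  proof
    fix y
    obtain v where v: "v \<in> L" "v t = y" using loop_through by blast
    obtain u where "u \<in> L" "lam g u = v" using lam_surj[OF gaut_aut_hat[OF g] v(1)] by blast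
    then show "\<exists>x. y = T t x" using lam_pw[of u] v by metis
  qed
  moreover have "T t (x + y) = T t x + T t y \<and> T t (br x y) = br (T t x) (T t y) \<and> T t (c *s x) = c *s T t x" for x y c
  proof -
    obtain u v where uv: "u \<in> L" "u t = x" "v \<in> L" "v t = y" using loop_through by metis
    have *: "A t (u (e * t + s)) = T t x" "A t (v (e * t + s)) = T t y"
      using eq[OF uv(1), of t] eq[OF uv(3), of t] uv by simp_all
    show ?thesis
      using eq[OF loop_add[OF uv(1,3)], of t] eq[OF loop_br[OF uv(1,3)], of t] eq[OF loop_scale[OF uv(1), of c], of t]
      by (simp add: * uv(2,4) lie_aut_br[OF A(1)] clin_add[OF lie_aut_clin[OF A(1)]] clin_scale[OF lie_aut_clin[OF A(1)]])
  qed
  then have "clin (T t)" "\<And>x y. T t (br x y) = br (T t x) (T t y)" by (simp_all add: clin_def)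
  ultimately show ?thesis
    using clin_surj_imp_inj unfolding lie_aut_def bij_def by (simp add: clin_def)
qed

lemma pw_smooth: "smooth (\<lambda>t. T t x)"
proof -
  have "T t x = (\<Sum>i\<in>UNIV. frame (- t) x $ i *s T t (fr i t))" for t
  proof -
    have "x = frame t (frame (- t) x)" by (simp add: frame_inverse)
    also have "\<dots> = (\<Sum>i\<in>UNIV. frame (- t) x $ i *s fr i t)" by (rule clin_expand[OF clin_frame])
    finally have "T t x = T t (\<Sum>i\<in>UNIV. frame (- t) x $ i *s fr i t)" by simp
    then show ?thesis using lie_aut_clin[OF pw_lie_aut[of t]] by (simp add: clin_sum clin_scale)
  qed
  moreover have "smooth (\<lambda>t. \<Sum>i\<in>UNIV. frame (- t) x $ i *s T t (fr i t))"
    by (intro smooth_vec_sum smooth_vec_scale smooth_nth smooth_frame_neg loop_smooth pw_loop[OF g T] frame_loop)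
  ultimately show ?thesis by simp
qed

lemma pw_equivariant: "T (t + 2 * pi) (\<sigma> x) = \<sigma> (T t x)"
proof -
  obtain u where u: "u \<in> L" "u t = x" using loop_through by blast
  then show ?thesis
    using loop_shift[OF pw_loop[OF g T u(1)], of t] loop_shift[OF u(1), of t] by simp
qed

text \<open>With the parameter fixed, \<open>cent g\<close> is the identity, and
  \<open>cent_dt\<close> at \<open>ex\<close> then forces m = 1.\<close>

lemma pw_d: "\<exists>w n. w \<in> L \<and> g ((\<lambda>t. 0), 0, 1) = (w, n, 1)"
proof -
  have \<psi>: "aut_hat br \<sigma> g" by (rule gaut_aut_hat[OF g])
  obtain w n m where d: "g ((\<lambda>t. 0), 0, 1) = (w, n, m)" by (metis prod_cases3)
  have "cent g f = f" if f: "periodic_fun f" for f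
  proof (rule cent_eqI[OF \<psi> f])
    fix u t assume u: "u \<in> L"
    show "lam g (\<lambda>t. f t *s u t) t = f t *s lam g u t"
      using lam_pw[OF loop_scale_fun[OF f u]] lam_pw[OF u] clin_scale[OF lie_aut_clin[OF pw_lie_aut[of t]]] by simp
  qed
  then have "dt ex 0 = m * dt ex 0"
    using fun_cong[OF cent_dt[OF \<psi> d periodic_fun_exp], of 0] periodic_fun_exp periodic_fun_dt[OF periodic_fun_exp] by simp
  then have "m = 1" by (simp add: dt_exp)
  moreover have "w \<in> L" using gaut_G[OF g, of "((\<lambda>t. 0), 0, 1)"] d by (simp add: G_iff loop_0)
  ultimately show ?thesis using d by blast
qed

end

lemma pwD: "pw \<sigma> T g \<Longrightarrow> u \<in> L \<Longrightarrow> \<exists>a'. g (u, a, 0) = ((\<lambda>t. T t (u t)), a', 0)"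
  by (simp add: pw_def)

lemma ex_killing_nonzero: "\<exists>x. killing br x x \<noteq> 0"
proof (rule ccontr)
  assume "\<not> ?thesis"
  then have 0: "killing br x x = 0" for x by blast
  have "killing br x y = 0" for x y
    using 0[of "x + y"] 0[of x] 0[of y] killing_sym[of x y] by (simp add: killing_add_left killing_add_right)
  then have "x = 0" for x :: "complex^'n" using killing_nondegenerate by blast
  from this[of "axis undefined 1"] show False by (simp add: axis_eq_0_iff)
qed

lemma integral_cmod_square_zero:
  assumes q: "continuous_on UNIV q" and 0: "integral {0..2 * pi} (\<lambda>t. q t * cnj (q t)) = 0"
  shows "q 0 = 0"
proof -
  let ?f = "\<lambda>t. (norm (q t))\<^sup>2"
  have c: "continuous_on {0..2 * pi} ?f"
    by (intro continuous_intros continuous_on_subset[OF q]) auto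
  have "(?f has_integral integral {0..2 * pi} ?f) {0..2 * pi}"
    by (intro integrable_integral integrable_continuous_real c)
  then have "((\<lambda>t. complex_of_real (?f t)) has_integral complex_of_real (integral {0..2 * pi} ?f)) {0..2 * pi}"
    by (rule has_integral_of_real)
  then have "complex_of_real (integral {0..2 * pi} ?f) = 0"
    using 0 by (simp only: complex_norm_square integral_unique)
  then have "integral {0..2 * pi} ?f = 0" by simp
  then have "\<forall>t\<in>{0..2 * pi}. ?f t = 0"
    using integral_eq_0_iff[OF c] by simp
  then show ?thesis by simp
qed

text \<open>For the frame orbit u of x and for e^{it} u the two values differ by i (x, x), so they
  cannot both vanish.\<close>

lemma ex_killing_derivative_nonzero: "\<exists>u\<in>L. killing br (dt u 0) (u 0) \<noteq> 0"
proof -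
  obtain x where x: "killing br x x \<noteq> 0" using ex_killing_nonzero by blast
  let ?u = "\<lambda>t. frame t x"
  let ?v = "\<lambda>t. ex t *s ?u t"
  have "dt ?v 0 = dt ?u 0 + \<i> *s x"
    using dt_scale[OF smooth_exp smooth_frame, of \<i> x 0] by (simp add: dt_exp frame_0)
  then have "killing br (dt ?v 0) (?v 0) = killing br (dt ?u 0) (?u 0) + \<i> * killing br x x"
    by (simp add: killing_add_left killing_scale_left frame_0)
  then have "killing br (dt ?v 0) (?v 0) \<noteq> 0 \<or> killing br (dt ?u 0) (?u 0) \<noteq> 0"
    using x by auto
  then show ?thesis
    using frame_loop[of x] loop_scale_fun[OF periodic_fun_exp frame_loop[of x]] by (elim disjE) (rule bexI; assumption)+
qed

text \<open>Both sides are half the derivative of (u, u), which a family of automorphisms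
  preserves.\<close>

lemma killing_dt_aut:
  assumes g: "\<Gamma> False g" and T: "pw \<sigma> T g" and u: "u \<in> L"
  shows "killing br (dt (\<lambda>t. T t (u t)) t) (T t (u t)) = killing br (dt u t) (u t)"
proof -
  have s: "smooth u" "smooth (\<lambda>t. T t (u t))" using u pw_loop[OF g T u] by (auto intro: loop_smooth)
  have "((\<lambda>t. killing br (u t) (u t)) has_vector_derivative
      killing br (u t) (dt u t) + killing br (dt u t) (u t)) (at t)"
    by (rule dt_killing[OF s(1) s(1)])
  moreover have "((\<lambda>t. killing br (u t) (u t)) has_vector_derivative
      killing br (T t (u t)) (dt (\<lambda>t. T t (u t)) t) + killing br (dt (\<lambda>t. T t (u t)) t) (T t (u t))) (at t)"
    using dt_killing[OF s(2) s(2), of t] by (simp add: killing_aut[OF pw_lie_aut[OF g T]])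
  ultimately have "killing br (u t) (dt u t) + killing br (dt u t) (u t) =
      killing br (T t (u t)) (dt (\<lambda>t. T t (u t)) t) + killing br (dt (\<lambda>t. T t (u t)) t) (T t (u t))"
    by (rule vector_derivative_unique_at)
  then show ?thesis by (simp add: killing_sym[of _ "dt _ _"])
qed

text \<open>The factor k on c is detected by a bracket that is purely central and nonzero: with q =
  (u', u), the loops u and conj(q) u commute pointwise, and their bracket is c times the integral of
  |q|^2. Pointwise automorphisms preserve q, so k = 1.\<close>

lemma pw_central:
  assumes g: "\<Gamma> False g" and T: "pw \<sigma> T g"
  shows "g ((\<lambda>t. 0), a, 0) = ((\<lambda>t. 0), a, 0)"
proof -
  have \<psi>: "aut_hat br \<sigma> g" by (rule gaut_aut_hat[OF g])
  obtain k where k: "\<And>a. g ((\<lambda>t. 0), a, 0) = ((\<lambda>t. 0), k * a, 0)" using aut_hat_central[OF \<psi>] by blast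
  obtain u where u: "u \<in> L" "killing br (dt u 0) (u 0) \<noteq> 0" using ex_killing_derivative_nonzero by blast
  define q where "q t = killing br (dt u t) (u t)" for t
  have sm: "smooth q"
    unfolding q_def[abs_def] by (intro smooth_killing smooth_vector_derivative loop_smooth u)
  have "q (t + 2 * pi) = q t" for t
    using loop_shift[OF u(1)] loop_shift[OF loop_dt[OF u(1)]] by (simp add: q_def killing_aut[OF \<sigma>_aut])
  then have qp: "periodic_fun (\<lambda>t. cnj (q t))"
    using sm by (intro periodic_fun_cnj) (simp add: periodic_fun_def)
  let ?v = "\<lambda>t. cnj (q t) *s u t"
  have v: "?v \<in> L" by (rule loop_scale_fun[OF qp u(1)])
  have Tv: "T t (?v t) = cnj (q t) *s T t (u t)" for t
    by (rule clin_scale[OF lie_aut_clin[OF pw_lie_aut[OF g T]]])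
  have "abr br (u, 0, 0) (?v, 0, 0) = ((\<lambda>t. 0), ldot br (dt u) ?v, 0)"
    by (simp add: abr_eq br_scale_right br_self)
  moreover obtain a where a: "g (u, 0, 0) = ((\<lambda>t. T t (u t)), a, 0)"
    using pwD[OF T u(1), of 0] by blast
  obtain b where "g (?v, 0, 0) = ((\<lambda>t. T t (?v t)), b, 0)"
    using pwD[OF T v, of 0] by blast
  with a have "abr br (g (u, 0, 0)) (g (?v, 0, 0)) =
      ((\<lambda>t. 0), ldot br (dt (\<lambda>t. T t (u t))) (\<lambda>t. cnj (q t) *s T t (u t)), 0)"
    by (simp add: Tv abr_eq br_scale_right br_self)
  ultimately have "k * ldot br (dt u) ?v = ldot br (dt (\<lambda>t. T t (u t))) (\<lambda>t. cnj (q t) *s T t (u t))"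
    using aut_hat_props(4)[OF \<psi>, of "(u, 0, 0)" "(?v, 0, 0)"] u(1) v by (simp add: G_iff k)
  also have "\<dots> = ldot br (dt u) ?v"
    by (simp add: ldot_def killing_scale_right killing_dt_aut[OF g T u(1)])
  finally have "k * ldot br (dt u) ?v = ldot br (dt u) ?v" .
  moreover have "ldot br (dt u) ?v \<noteq> 0"
  proof
    assume "ldot br (dt u) ?v = 0"
    then have "integral {0..2 * pi} (\<lambda>t. q t * cnj (q t)) = 0"
      by (simp add: ldot_def killing_scale_right q_def mult.commute)
    then have "q 0 = 0" by (rule integral_cmod_square_zero[OF smooth_continuous[OF sm]])
    then show False using u(2) by (simp add: q_def)
  qed
  ultimately have "k = 1" by simp
  then show ?thesis using k by simp
qed

lemma pw_d_component:
  assumes g: "\<Gamma> False g" and T: "pw \<sigma> T g" and x: "x \<in> G"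
  shows "snd (snd (g x)) = snd (snd x)"
proof -
  obtain u a b where u: "x = (u, a, b)" by (metis prod_cases3)
  have L: "u \<in> L" using x u by (simp add: G_iff)
  obtain w n where d: "g ((\<lambda>t. 0), 0, 1) = (w, n, 1)" using pw_d[OF g T] by blast
  have dG: "((\<lambda>t. 0), 0, 1) \<in> G" by (simp add: G_iff loop_0)
  obtain a' where "g (u, a, 0) = ((\<lambda>t. T t (u t)), a', 0)" using T L unfolding pw_def by blast
  then have "g (aadd (u, a, 0) (ascale b ((\<lambda>t. 0), 0, 1))) = aadd ((\<lambda>t. T t (u t)), a', 0) (ascale b (w, n, 1))"
    using gaut_add[OF g, of "(u, a, 0)" "ascale b ((\<lambda>t. 0), 0, 1)"] gaut_scale[OF g dG, of b] L d dG
    by (simp add: G_iff G_ascale)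
  then show ?thesis using u by (simp add: aadd_eq ascale_eq)
qed

section \<open>Central shifts and the uniqueness of lifts\<close>

lemma shift_eq: "u \<in> L \<Longrightarrow> shift \<sigma> r (u, a, b) = (u, a + r * b, b)"
  by (simp add: shift_def G_iff)

lemma shift_shift: "shift \<sigma> r (shift \<sigma> s x) = shift \<sigma> (r + s) x"
  by (cases x) (auto simp: shift_def G_iff algebra_simps)

lemma shift_0: "shift \<sigma> 0 x = x"
  by (cases x) (auto simp: shift_def)

lemma gaut_shift: "\<Gamma> False (shift \<sigma> r)"
  unfolding gaut_def
proof (intro conjI ballI allI impI)
  have G: "shift \<sigma> s x \<in> G" if "x \<in> G" for s x using that by (cases x) (simp add: shift_eq G_iff)
  show "bij_betw (shift \<sigma> r) G G"
    by (rule bij_betw_byWitness[where f' = "shift \<sigma> (- r)"]) (auto simp: shift_shift shift_0 G)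
  show "shift \<sigma> r x = x" if "x \<notin> G" for x using that by (simp add: shift_def)
  fix x y assume xy: "x \<in> G" "y \<in> G"
  show "shift \<sigma> r (aadd x y) = aadd (shift \<sigma> r x) (shift \<sigma> r y)"
    using xy G_aadd[OF xy] by (simp add: shift_def aadd_def algebra_simps)
  show "shift \<sigma> r (abr br x y) = abr br (shift \<sigma> r x) (shift \<sigma> r y)"
    using xy G_abr[OF xy] by (simp add: shift_def abr_def)
next
  fix z x assume x: "x \<in> G"
  show "shift \<sigma> r (ascale z x) = ascale (if False then cnj z else z) (shift \<sigma> r x)"
    using x G_ascale[OF x] by (simp add: shift_def ascale_def algebra_simps)
qed

lemma pw_shift: "pw \<sigma> (\<lambda>t x. x) (shift \<sigma> r)"
  by (simp add: pw_def shift_eq)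

text \<open>\<open>g\<close> fixes c and keeps the d coordinate of every element.\<close>

lemma shift_commute:
  assumes g: "\<Gamma> False g" and T: "pw \<sigma> T g"
  shows "g (shift \<sigma> r x) = shift \<sigma> r (g x)"
proof (cases "x \<in> G")
  case True
  obtain u a b where u: "x = (u, a, b)" by (metis prod_cases3)
  have L: "u \<in> L" using True u by (simp add: G_iff)
  have "shift \<sigma> r x = aadd x ((\<lambda>t. 0), r * b, 0)" by (simp add: u shift_eq L aadd_eq)
  then have "g (shift \<sigma> r x) = aadd (g x) ((\<lambda>t. 0), r * b, 0)"
    using gaut_add[OF g True, of "((\<lambda>t. 0), r * b, 0)"] pw_central[OF g T] by (simp add: G_iff loop_0)
  also have "\<dots> = shift \<sigma> r (g x)"
    using gaut_G[OF g True] pw_d_component[OF g T True] u by (simp add: shift_def aadd_def)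
  finally show ?thesis .
next
  case False
  then show ?thesis using gaut_outside[OF g] by (simp add: shift_def)
qed

text \<open>The loop part w of the image of d centralises all loops, so w = 0. Each loop moves at
  most by a multiple of c, which brackets do not see; so brackets are fixed, and by the Casimir
  identity all loops are.\<close>

lemma pw_id_shift:
  assumes k: "\<Gamma> False k" and id: "pw \<sigma> (\<lambda>t x. x) k"
  shows "\<exists>r. k = shift \<sigma> r"
proof -
  have \<psi>: "aut_hat br \<sigma> k" by (rule gaut_aut_hat[OF k])
  obtain w n where d: "w \<in> L" "k ((\<lambda>t. 0), 0, 1) = (w, n, 1)" using pw_d[OF k id] by blast
  have lam: "lam k u = u" if "u \<in> L" for u using lam_pw[OF k id that] .
  have w: "w = (\<lambda>t. 0)"
  proof
    fix t
    show "w t = 0"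
    proof (rule centerless)
      fix y
      obtain u where u: "u \<in> L" "u t = y" using loop_through by blast
      then show "br (w t) y = 0"
        using lam_dt[OF \<psi> d(2) u(1), of t] lam[OF u(1)] lam[OF loop_dt[OF u(1)]] by simp
    qed
  qed
  have fix_add: "k (aadd x y) = aadd x y" if "x \<in> G" "y \<in> G" "k x = x" "k y = y" for x y
    using gaut_add[OF k that(1,2)] that by simp
  have fix_c: "k (u, a, 0) = (u, a, 0)" if "u \<in> L" "k (u, b, 0) = (u, b, 0)" for u a b
    using fix_add[of "(u, b, 0)" "((\<lambda>t. 0), a - b, 0)"] that pw_central[OF k id]
    by (simp add: G_iff loop_0 aadd_eq)
  have fix_br: "k ((\<lambda>t. br (u t) (v t)), 0, 0) = ((\<lambda>t. br (u t) (v t)), 0, 0)" if u: "u \<in> L" and v: "v \<in> L" for u v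
  proof (rule fix_c[OF loop_br[OF u v]])
    obtain a where a: "k (u, 0, 0) = (u, a, 0)" using pwD[OF id u, of 0] by blast
    obtain b where "k (v, 0, 0) = (v, b, 0)" using pwD[OF id v, of 0] by blast
    with a show "k ((\<lambda>t. br (u t) (v t)), ldot br (dt u) v, 0) = ((\<lambda>t. br (u t) (v t)), ldot br (dt u) v, 0)"
      using gaut_br[OF k, of "(u, 0, 0)" "(v, 0, 0)"] u v by (simp add: G_iff abr_eq)
  qed
  have fix_sum: "k ((\<lambda>t. \<Sum>i\<in>I. u i t), 0, 0) = ((\<lambda>t. \<Sum>i\<in>I. u i t), 0, 0)"
    if "\<And>i. u i \<in> L" "\<And>i. k (u i, 0, 0) = (u i, 0, 0)" for u :: "'n \<Rightarrow> real \<Rightarrow> complex^'n" and I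
  proof (induction I rule: infinite_finite_induct)
    case (insert i I)
    then show ?case
      using fix_add[of "(u i, 0, 0)" "((\<lambda>t. \<Sum>i\<in>I. u i t), 0, 0)"] that
      by (simp add: G_iff loop_sum aadd_eq)
  qed (use pw_central[OF k id, of 0] in simp_all)
  have fixL: "k (u, a, 0) = (u, a, 0)" if u: "u \<in> L" for u a
  proof (rule fix_c[OF u])
    have "k ((\<lambda>t. \<Sum>i\<in>UNIV. br (dframe i t) (br (fr i t) (u t))), 0, 0) = ((\<lambda>t. \<Sum>i\<in>UNIV. br (dframe i t) (br (fr i t) (u t))), 0, 0)"
    proof (rule fix_sum[of "\<lambda>i t. br (dframe i t) (br (fr i t) (u t))"])
      fix i
      show "(\<lambda>t. br (dframe i t) (br (fr i t) (u t))) \<in> L"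
        by (rule loop_br[OF dframe_loop loop_br[OF frame_loop u]])
      show "k ((\<lambda>t. br (dframe i t) (br (fr i t) (u t))), 0, 0) = ((\<lambda>t. br (dframe i t) (br (fr i t) (u t))), 0, 0)"
        by (rule fix_br[OF dframe_loop loop_br[OF frame_loop u]])
    qed
    then show "k (u, 0, 0) = (u, 0, 0)" by (simp add: casimir_frame)
  qed
  have "k x = shift \<sigma> n x" for x
  proof (cases "x \<in> G")
    case True
    obtain u a b where u: "x = (u, a, b)" by (metis prod_cases3)
    have L: "u \<in> L" using True u by (simp add: G_iff)
    have dG: "((\<lambda>t. 0), 0, 1) \<in> G" by (simp add: G_iff loop_0)
    have "x = aadd (u, a, 0) (ascale b ((\<lambda>t. 0), 0, 1))" by (simp add: u aadd_eq ascale_eq)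
    then have "k x = aadd (u, a, 0) (ascale b (w, n, 1))"
      using gaut_add[OF k, of "(u, a, 0)" "ascale b ((\<lambda>t. 0), 0, 1)"] gaut_scale[OF k dG, of b] L d dG fixL[OF L]
      by (simp add: G_iff G_ascale)
    then show ?thesis by (simp add: u w aadd_eq ascale_eq shift_eq L mult.commute)
  next
    case False
    then show ?thesis using gaut_outside[OF k] by (simp add: shift_def)
  qed
  then show ?thesis by blast
qed

lemma pw_same_shift:
  assumes g: "\<Gamma> False g" "pw \<sigma> T g" and h: "\<Gamma> False h" "pw \<sigma> T h"
  shows "\<exists>r. h = g \<circ> shift \<sigma> r"
proof -
  have b: "bij (T t)" for t by (rule lie_aut_bij[OF pw_lie_aut[OF g]])
  have "pw \<sigma> (\<lambda>t x. inv (T t) (T t x)) (inv g \<circ> h)"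
    by (rule pw_comp[OF pw_inv[OF g b] h])
  then have "pw \<sigma> (\<lambda>t x. x) (inv g \<circ> h)" using b by (simp add: bij_is_inj)
  moreover have "\<Gamma> False (inv g \<circ> h)" using gaut_comp[OF gaut_inv[OF g(1)] h(1)] by simp
  ultimately obtain r where "inv g \<circ> h = shift \<sigma> r" using pw_id_shift by blast
  then have "h = g \<circ> shift \<sigma> r"
    using gaut_inv_apply(2)[OF g(1)] by (metis comp_assoc fun.map_id gaut_bij[OF g(1)] bij_is_surj surj_iff id_comp)
  then show ?thesis by blast
qed

text \<open>The pointwise roots agree, so the two maps differ by a shift with some parameter r;
  equality of the squares gives 2 r = 0.\<close>

lemma pos_aut_sqrt_unique:
  assumes g: "pos_aut br \<sigma> g" and h: "pos_aut br \<sigma> h" and eq: "g \<circ> g = h \<circ> h"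
  shows "g = h"
proof -
  obtain T where T: "\<Gamma> False g" "\<And>t. posdiag (T t)" "pw \<sigma> T g" using g unfolding pos_aut_def by blast
  obtain S where S: "\<Gamma> False h" "\<And>t. posdiag (S t)" "pw \<sigma> S h" using h unfolding pos_aut_def by blast
  have "pw \<sigma> (\<lambda>t x. T t (T t x)) (g \<circ> g)" "pw \<sigma> (\<lambda>t x. S t (S t x)) (g \<circ> g)"
    using pw_comp[OF T(3,1,3)] pw_comp[OF S(3,1,3)] eq by simp_all
  from pw_unique[OF this] have "T t (T t x) = S t (S t x)" for t x by meson
  then have "T = S" using posdiag_sqrt_unique[OF T(2) S(2)] by blast
  then obtain r where r: "h = g \<circ> shift \<sigma> r" using pw_same_shift[OF T(1,3) S(1)] S(3) by blast
  have "h (h x) = g (g (shift \<sigma> (r + r) x))" for x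
    unfolding r by (simp add: shift_commute[OF T(1,3), symmetric] shift_shift)
  then have "g (g x) = g (g (shift \<sigma> (r + r) x))" for x
    using eq by (metis comp_apply)
  then have "shift \<sigma> (r + r) x = x" for x
    using gaut_bij[OF T(1)] by (metis bij_is_inj injD)
  from this[of "((\<lambda>t. 0), 0, 1)"] have "r = 0" by (simp add: shift_eq loop_0)
  then show ?thesis using r by (simp add: fun_eq_iff shift_0)
qed

subsection \<open>Lifting pointwise automorphisms\<close>

lemma dt_apply:
  assumes lin: "\<And>t. clin (A t)" and A: "\<And>x. smooth (\<lambda>t. A t x)" and u: "smooth u"
  shows "dt (\<lambda>t. A t (u t)) t = dt (\<lambda>s. A s (u t)) t + A t (dt u t)"
proof -
  have exp: "A s x = (\<Sum>i\<in>UNIV. x $ i *s A s (axis i 1))" for s x by (rule clin_expand[OF lin])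
  have comp: "((\<lambda>t. u t $ i) has_vector_derivative dt u t $ i) (at t)" for i
    by (rule bounded_linear.has_vector_derivative[OF bounded_linear_vec_nth smooth_has_vector_derivative[OF u]])
  have "((\<lambda>t. \<Sum>i\<in>UNIV. u t $ i *s A t (axis i 1)) has_vector_derivative
      (\<Sum>i\<in>UNIV. u t $ i *s dt (\<lambda>s. A s (axis i 1)) t + dt u t $ i *s A t (axis i 1))) (at t)"
    by (intro has_vector_derivative_sum bounded_bilinear.has_vector_derivative[OF bounded_bilinear_scale]
        comp smooth_has_vector_derivative A)
  moreover have "((\<lambda>s. \<Sum>i\<in>UNIV. u t $ i *s A s (axis i 1)) has_vector_derivative
      (\<Sum>i\<in>UNIV. u t $ i *s dt (\<lambda>s. A s (axis i 1)) t)) (at t)"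
    by (intro has_vector_derivative_sum smooth_has_vector_derivative A
        bounded_linear.has_vector_derivative[OF bounded_bilinear.bounded_linear_right[OF bounded_bilinear_scale]])
  ultimately show ?thesis
    using exp[of _ "u _", symmetric] exp[of t "dt u t"]
    by (simp add: vector_derivative_at sum.distrib)
qed

text \<open>The missing datum is the loop part w of the image of d. It has to satisfy T u' =
  [w, T u] + (T u)', that is, ad w = - T' T^-1. The right side is a derivation at each t, hence
  inner, and w inherits smoothness and twist from \<open>T\<close>.\<close>

lemma lift_exists:
  assumes T: "\<And>t. lie_aut br (T t)" and sT: "\<And>x. smooth (\<lambda>t. T t x)" and sI: "\<And>x. smooth (\<lambda>t. inv (T t) x)"
    and eqv: "\<And>t x. T (t + 2 * pi) (\<sigma> x) = \<sigma> (T t x)"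
  shows "\<exists>g. \<Gamma> False g \<and> pw \<sigma> T g"
proof -
  have lin: "clin (T t)" and b: "bij (T t)" and hom: "T t (br x y) = br (T t x) (T t y)" for t x y
    using T by (auto simp: lie_aut_clin lie_aut_bij lie_aut_br)
  have inv: "T t (inv (T t) x) = x" "inv (T t) (T t x) = x" for t x
    using b by (simp_all add: bij_is_surj surj_f_inv_f bij_is_inj)
  have lin': "clin (inv (T t))" for t by (rule clin_inv[OF lin b])
  define D where "D t x = dt (\<lambda>s. T s (inv (T t) x)) t" for t x
  have dT: "clin (\<lambda>x. dt (\<lambda>s. T s x) t)" for t
    by (simp add: clin_def clin_add[OF lin] clin_scale[OF lin] dt_add sT dt_const_scale)
  have linD: "clin (D t)" for t unfolding D_def by (rule clin_compose[OF dT lin'])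
  have der: "D t (br x y) = br (D t x) y + br x (D t y)" for t x y
  proof -
    have "inv (T t) (br x y) = br (inv (T t) x) (inv (T t) y)"
      by (metis hom inv)
    then have "D t (br x y) = dt (\<lambda>s. br (T s (inv (T t) x)) (T s (inv (T t) y))) t"
      unfolding D_def by (simp add: hom)
    also have "\<dots> = br x (D t y) + br (D t x) y"
      unfolding D_def dt_br[OF sT sT] by (simp add: inv)
    finally show ?thesis by simp
  qed
  define w where "w t = (\<Sum>i\<in>UNIV. (- tr (\<lambda>v. D t (br (axis i 1) v))) *s dual i)" for t
  have Dw: "D t x = - br (w t) x" for t x
    using derivation_inner[OF linD der, of t x] by (simp add: w_def sum_negf br_minus_left)
  have sD: "smooth (\<lambda>t. D t x)" for x
    unfolding D_def
    by (rule smooth_apply[OF dT smooth_vector_derivative[OF sT] sI])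
  have sw: "smooth w"
  proof -
    have "smooth (\<lambda>t. - tr (\<lambda>v. D t (br (axis i 1) v)))" for i
      unfolding tr_def
      by (intro smooth_bounded_linear[OF bounded_linear_minus[OF bounded_linear_ident]] smooth_sum smooth_nth sD)
    then show ?thesis
      unfolding w_def[abs_def] by (intro smooth_vec_sum smooth_vec_scale smooth_const)
  qed
  have w_shift: "w (t + 2 * pi) = \<sigma> (w t)" for t
  proof -
    have "br (w (t + 2 * pi) - \<sigma> (w t)) y = 0" for y
    proof -
      obtain x where y: "y = \<sigma> x" using \<sigma>_bij by (meson bij_pointE)
      have "inv (T (t + 2 * pi)) (\<sigma> x) = \<sigma> (inv (T t) x)"
        by (metis eqv inv)
      then have "D (t + 2 * pi) (\<sigma> x) = dt (\<lambda>s. \<sigma> (T s (inv (T t) x))) t"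
        unfolding D_def by (simp add: dt_shift[OF sT] eqv)
      also have "\<dots> = \<sigma> (D t x)"
        unfolding D_def by (rule dt_bounded_linear[OF clin_bounded_linear[OF \<sigma>_clin] sT])
      finally show ?thesis
        by (simp add: y Dw br_diff_left lie_aut_br[OF \<sigma>_aut] clin_minus[OF \<sigma>_clin])
    qed
    then show ?thesis using centerless[of "w (t + 2 * pi) - \<sigma> (w t)"] by simp
  qed
  have w: "w \<in> L" using sw w_shift by (simp add: loop_alg_def)
  let ?\<phi> = "\<lambda>u t. T t (u t)"
  have \<phi>L: "?\<phi> u \<in> L" if "u \<in> L" for u
    using that by (simp add: loop_alg_def smooth_apply[OF lin sT] eqv)
  have \<phi>iL: "(\<lambda>t. inv (T t) (u t)) \<in> L" if "u \<in> L" for u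
  proof -
    have "inv (T (t + 2 * pi)) (\<sigma> x) = \<sigma> (inv (T t) x)" for t x
      by (metis eqv inv)
    then show ?thesis using that by (simp add: loop_alg_def smooth_apply[OF lin' sI])
  qed
  have dt\<phi>: "dt (?\<phi> u) t = T t (dt u t) - br (w t) (T t (u t))" if u: "u \<in> L" for u t
    using dt_apply[OF lin sT loop_smooth[OF u], of t] Dw[of t "T t (u t)"] by (simp add: D_def inv)
  \<comment> \<open>The central correction is dictated by the cocycle: ((T u)', T v) = (u', v) -
    ([w, T u], T v) = (u', v) - (w, T [u, v]).\<close>
  define g where "g x = (if x \<in> G then ((\<lambda>t. T t (fst x t) + snd (snd x) *s w t), fst (snd x) - ldot br w (?\<phi> (fst x)), snd (snd x)) else x)" for x
  define h where "h x = (if x \<in> G then ((\<lambda>t. inv (T t) (fst x t - snd (snd x) *s w t)),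
      fst (snd x) + ldot br w (\<lambda>t. fst x t - snd (snd x) *s w t), snd (snd x)) else x)" for x
  have g_eq: "g (u, a, b) = ((\<lambda>t. T t (u t) + b *s w t), a - ldot br w (?\<phi> u), b)" if "u \<in> L" for u a b
    using that by (simp add: g_def G_iff)
  have h_eq: "h (u, a, b) = ((\<lambda>t. inv (T t) (u t - b *s w t)), a + ldot br w (\<lambda>t. u t - b *s w t), b)" if "u \<in> L" for u a b
    using that by (simp add: h_def G_iff)
  have gG: "g x \<in> G" if "x \<in> G" for x
    using that by (cases x) (simp add: g_eq G_iff loop_add \<phi>L loop_scale w)
  have hG: "h x \<in> G" if "x \<in> G" for x
    using that by (cases x) (simp add: h_eq G_iff \<phi>iL loop_diff loop_scale w)
  have gh: "g (h x) = x" if "x \<in> G" for x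
  proof -
    obtain u a b where x: "x = (u, a, b)" by (metis prod_cases3)
    then have "u \<in> L" using that by (simp add: G_iff)
    then show ?thesis unfolding x by (simp add: h_eq g_eq inv \<phi>iL loop_diff loop_scale w)
  qed
  have hg: "h (g x) = x" if "x \<in> G" for x
  proof -
    obtain u a b where x: "x = (u, a, b)" by (metis prod_cases3)
    then have "u \<in> L" using that by (simp add: G_iff)
    then show ?thesis unfolding x by (simp add: h_eq g_eq inv \<phi>L loop_add loop_scale w)
  qed
  have "\<Gamma> False g"
    unfolding gaut_def
  proof (intro conjI ballI allI impI)
    show "bij_betw g G G"
      by (rule bij_betw_byWitness[where f' = h]) (auto simp: gh hg gG hG)
    show "g x = x" if "x \<notin> G" for x using that by (simp add: g_def)
    fix x y assume xy: "x \<in> G" "y \<in> G"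
    obtain u a b v a' b' where eq: "x = (u, a, b)" "y = (v, a', b')" by (metis prod_cases3)
    have L: "u \<in> L" "v \<in> L" using xy eq by (simp_all add: G_iff)
    note sm = loop_smooth[OF w] loop_smooth[OF \<phi>L[OF L(1)]] loop_smooth[OF \<phi>L[OF L(2)]]
      loop_smooth[OF loop_dt[OF w]] loop_smooth[OF loop_dt[OF \<phi>L[OF L(1)]]] loop_smooth[OF loop_dt[OF \<phi>L[OF L(2)]]]
    show "g (aadd x y) = aadd (g x) (g y)"
      unfolding eq using L
      by (simp add: aadd_eq g_eq loop_add clin_add[OF lin] ldot_add_right sm vec.scale_left_distrib algebra_simps)
    show "g (abr br x y) = abr br (g x) (g y)"
    proof -
      let ?Tu = "?\<phi> u" and ?Tv = "?\<phi> v"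
      let ?Tdu = "\<lambda>t. T t (dt u t)" and ?Tdv = "\<lambda>t. T t (dt v t)"
      let ?z = "\<lambda>t. br (u t) (v t) + b *s dt v t - b' *s dt u t"
      have z: "?z \<in> L" using L by (intro loop_diff loop_add loop_br loop_scale loop_dt)
      have dg1: "dt (\<lambda>t. T t (u t) + b *s w t) t = dt ?Tu t + b *s dt w t"
        and dg2: "dt (\<lambda>t. T t (v t) + b' *s w t) t = dt ?Tv t + b' *s dt w t" for t
        using sm by (simp_all add: dt_add dt_const_scale smooth_vec_scale)
      have 1: "T t (?z t) = br (T t (u t) + b *s w t) (T t (v t) + b' *s w t) + b *s (dt ?Tv t + b' *s dt w t)
          - b' *s (dt ?Tu t + b *s dt w t)" for t
        unfolding dt\<phi>[OF L(1)] dt\<phi>[OF L(2)]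
        using br_antisym[of "T t (u t)" "w t"]
        by (simp add: hom clin_add[OF lin] clin_diff[OF lin] clin_scale[OF lin] br_add_left br_add_right
          br_scale_left br_scale_right br_self vec.scale_right_distrib vec.scale_right_diff_distrib algebra_simps)
      have dTL: "?Tdu \<in> L" "?Tdv \<in> L" using \<phi>L[OF loop_dt[OF L(1)]] \<phi>L[OF loop_dt[OF L(2)]] .
      have ww: "ldot br w (\<lambda>t. br (w t) (y t)) = 0" for y
        unfolding ldot_def by (simp add: killing_invariant[symmetric] br_self killing_0)
      have diff: "ldot br y (\<lambda>t. p t - q t) = ldot br y p - ldot br y q" if "smooth y" "smooth p" "smooth q" for y p q
        using ldot_add_right[of "\<lambda>t. p t - q t" q y] that smooth_vec_add[of p "\<lambda>t. (- 1) *s q t"]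
          smooth_vec_scale[OF smooth_const, of q "- 1"] by simp
      have diff': "ldot br (\<lambda>t. p t - q t) y = ldot br p y - ldot br q y" if "smooth y" "smooth p" "smooth q" for y p q
        using diff[OF that] by (simp add: ldot_sym[of _ y])
      note sm' = sm loop_smooth[OF dTL(1)] loop_smooth[OF dTL(2)] loop_smooth[OF loop_br[OF w \<phi>L[OF L(1)]]]
        loop_smooth[OF loop_br[OF w \<phi>L[OF L(2)]]]
      have uu: "dt ?Tu = (\<lambda>t. ?Tdu t - br (w t) (T t (u t)))" "dt ?Tv = (\<lambda>t. ?Tdv t - br (w t) (T t (v t)))"
        using dt\<phi>[OF L(1)] dt\<phi>[OF L(2)] by blast+
      have wdu: "ldot br w (dt ?Tu) = ldot br w ?Tdu" "ldot br w (dt ?Tv) = ldot br w ?Tdv"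
        unfolding uu by (simp_all add: diff sm' ww)
      have kT: "ldot br ?Tdu ?Tv = ldot br (dt u) v"
        unfolding ldot_def by (simp add: killing_aut[OF T])
      have inva: "ldot br (\<lambda>t. br (w t) (T t (u t))) ?Tv = ldot br w (\<lambda>t. T t (br (u t) (v t)))"
        unfolding ldot_def by (simp add: killing_invariant hom)
      have "ldot br (\<lambda>t. dt ?Tu t + b *s dt w t) (\<lambda>t. T t (v t) + b' *s w t)
          = ldot br (dt ?Tu) ?Tv + b' * ldot br (dt ?Tu) w + b * ldot br (dt w) ?Tv + b * b' * ldot br (dt w) w"
        by (simp add: ldot_add_left ldot_add_right sm smooth_vec_add smooth_vec_scale ldot_scale_left ldot_scale_right algebra_simps)
      also have "\<dots> = (ldot br (dt u) v - ldot br w (\<lambda>t. T t (br (u t) (v t)))) + b' * ldot br w ?Tdu - b * ldot br w ?Tdv"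
        using ldot_dt_self[OF w] ldot_parts[OF w \<phi>L[OF L(2)]] wdu ldot_sym[of "dt ?Tu" w]
        by (simp add: kT inva diff' sm' uu(1)[symmetric] flip: uu) (simp add: uu diff' sm' kT inva)
      also have "\<dots> = ldot br (dt u) v - ldot br w (\<lambda>t. T t (?z t))"
      proof -
        have "ldot br w (\<lambda>t. T t (?z t)) = ldot br w (\<lambda>t. T t (br (u t) (v t))) + b * ldot br w ?Tdv - b' * ldot br w ?Tdu"
          using \<phi>L[OF loop_br[OF L]] dTL
          by (simp add: clin_add[OF lin] clin_diff[OF lin] clin_scale[OF lin] diff ldot_add_right ldot_scale_right
            sm' smooth_vec_add smooth_vec_scale loop_smooth)
        then show ?thesis by simp
      qed
      finally have 2: "ldot br (dt u) v - ldot br w (\<lambda>t. T t (?z t)) =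
          ldot br (\<lambda>t. dt ?Tu t + b *s dt w t) (\<lambda>t. T t (v t) + b' *s w t)" by simp
      have lhs: "g (abr br x y) = ((\<lambda>t. T t (?z t)), ldot br (dt u) v - ldot br w (\<lambda>t. T t (?z t)), 0)"
        unfolding eq abr_eq g_eq[OF z] by simp
      have rhs: "abr br (g x) (g y) = ((\<lambda>t. br (T t (u t) + b *s w t) (T t (v t) + b' *s w t) + b *s (dt ?Tv t + b' *s dt w t)
          - b' *s (dt ?Tu t + b *s dt w t)), ldot br (\<lambda>t. dt ?Tu t + b *s dt w t) (\<lambda>t. T t (v t) + b' *s w t), 0)"
        unfolding eq g_eq[OF L(1)] g_eq[OF L(2)] abr_eq dg1 dg2 by (rule refl)
      show ?thesis
        unfolding lhs rhs 2[symmetric] by (simp only: 1)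
    qed
  next
    fix z x assume x: "x \<in> G"
    show "g (ascale z x) = ascale (if False then cnj z else z) (g x)"
      using x by (cases x) (simp add: ascale_eq g_eq G_iff loop_scale clin_scale[OF lin] ldot_scale_right
        vec.scale_right_distrib algebra_simps)
  qed
  moreover have "pw \<sigma> T g" by (simp add: pw_def g_eq)
  ultimately show ?thesis by blast
qed

end

subsection \<open>Square roots of positive automorphisms\<close>

context simple_compact begin

text \<open>If S v = l v and S w = m w, the automorphism S^2 has eigenvalue (l m)^2 on [v, w], so S
  has eigenvalue l m there; such eigenvectors span. The relation with \<tau> is uniqueness of the
  positive root of the inverse, and self-adjointness follows from it.\<close>

lemma sqrt_props:
  assumes S: "posdiag S" and T: "lie_aut br T" and sq: "\<And>x. S (S x) = T x" and \<tau>T: "\<And>x. \<tau> (T (\<tau> x)) = inv T x"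
  shows "lie_aut br S" "\<tau> (S (\<tau> x)) = inv S x" "hform (S x) y = hform x (S y)"
proof -
  let ?E = "{v. \<exists>l>0. S v = complex_of_real l *s v}"
  have lin: "clin S" and b: "bij S" using posdiag_clin[OF S] posdiag_bij[OF S] .
  have sp: "vec.span ?E = UNIV" using S by (simp add: posdiag_def)
  have inv: "S (inv S x) = x" "inv S (S x) = x" for x
    using b by (simp_all add: bij_is_surj surj_f_inv_f bij_is_inj)
  have eig: "S (br v w) = br (S v) (S w)" if v: "v \<in> ?E" and w: "w \<in> ?E" for v w
  proof -
    from v w obtain l m where l: "l > 0" "S v = complex_of_real l *s v" and m: "m > 0" "S w = complex_of_real m *s w"
      by blast
    have "S (S (br v w)) = br (S (S v)) (S (S w))" by (simp add: sq lie_aut_br[OF T])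
    also have "\<dots> = complex_of_real ((l * m)\<^sup>2) *s br v w"
      by (simp add: l(2) m(2) clin_scale[OF lin] br_scale_left br_scale_right power2_eq_square mult_ac)
    finally have "S (br v w) = complex_of_real (sqrt ((l * m)\<^sup>2)) *s br v w"
      by (rule posdiag_sqrt_eigenvector[OF S, rotated]) (use l(1) m(1) in simp)
    then show ?thesis using l m by (simp add: br_scale_left br_scale_right)
  qed
  have "S (br x y) = br (S x) (S y)" for x y
  proof -
    have 1: "S (br v y) = br (S v) (S y)" if v: "v \<in> ?E" for v y
      by (rule clin_eq_on_span[OF clin_compose[OF lin clin_br(1)] clin_compose[OF clin_br(1) lin] sp eig[OF v]])
    show ?thesis
      by (rule clin_eq_on_span[OF clin_compose[OF lin clin_br(2)] clin_compose[OF clin_br(2) lin] sp 1])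
  qed
  then show aut: "lie_aut br S" using lin b by (simp add: lie_aut_def clin_def)
  have "posdiag (\<lambda>x. \<tau> (S (\<tau> x)))"
    by (rule posdiag_conj[OF S bij_rconj rconj_add]) (auto simp: rconj_scale rconj_rconj)
  moreover have "\<tau> (S (\<tau> (\<tau> (S (\<tau> v))))) = inv S (inv S v)" for v
  proof -
    have "T (inv S (inv S v)) = v" by (simp add: inv flip: sq)
    then have "inv T v = inv S (inv S v)" using lie_aut_bij[OF T] by (metis bij_inv_eq_iff)
    then show ?thesis by (simp add: rconj_rconj sq \<tau>T)
  qed
  ultimately have "(\<lambda>x. \<tau> (S (\<tau> x))) = inv S"
    by (rule posdiag_sqrt_unique[OF _ posdiag_inv[OF S]])
  then show \<tau>S: "\<tau> (S (\<tau> x)) = inv S x" for x by (rule fun_cong)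
  have "killing br (S x) (\<tau> y) = killing br (S x) (S (inv S (\<tau> y)))" by (simp add: inv)
  also have "\<dots> = killing br x (\<tau> (S y))"
    by (simp add: killing_aut[OF aut] \<tau>S[symmetric] rconj_rconj)
  finally show "hform (S x) y = hform x (S y)" by (simp add: hform_def)
qed

lemma pw_omega_conj:
  assumes g: "\<Gamma> False g" and T: "pw \<sigma> T g"
  shows "pw \<sigma> (\<lambda>t x. \<tau> (T t (\<tau> x))) (\<omega> \<circ> g \<circ> \<omega>)"
  unfolding pw_def
proof (intro ballI allI)
  fix u a assume u: "u \<in> L"
  obtain a' where a': "g ((\<lambda>t. \<tau> (u t)), cnj a, 0) = ((\<lambda>t. T t (\<tau> (u t))), a', 0)"
    using pwD[OF T loop_\<tau>[OF u], of "cnj a"] by blast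
  have "(\<omega> \<circ> g \<circ> \<omega>) (u, a, 0) = ((\<lambda>t. \<tau> (T t (\<tau> (u t)))), cnj a', 0)"
    using u a' pw_loop[OF g T loop_\<tau>[OF u]] by (simp add: omega_def G_iff)
  then show "\<exists>a'. (\<omega> \<circ> g \<circ> \<omega>) (u, a, 0) = ((\<lambda>t. \<tau> (T t (\<tau> (u t)))), a', 0)" by blast
qed

text \<open>The pointwise positive roots form a smooth twisted family of automorphisms, which lifts.
  The square of the lift agrees with \<open>g\<close> up to a shift, and a shift can be
  halved.\<close>

lemma pos_aut_sqrt_exists:
  assumes g: "pos_aut br \<sigma> g" and \<omega>g: "\<omega> \<circ> g \<circ> \<omega> = inv g"
  shows "\<exists>r. pos_aut br \<sigma> r \<and> r \<circ> r = g"
proof -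
  obtain T where T: "\<Gamma> False g" "\<And>t. posdiag (T t)" "pw \<sigma> T g" using g unfolding pos_aut_def by blast
  have aut: "lie_aut br (T t)" for t by (rule pw_lie_aut[OF T(1,3)])
  have "(\<lambda>t x. \<tau> (T t (\<tau> x))) = (\<lambda>t. inv (T t))"
    using pw_omega_conj[OF T(1,3)] pw_inv[OF T(1,3) lie_aut_bij[OF aut]] unfolding \<omega>g by (rule pw_unique)
  then have \<tau>T: "\<tau> (T t (\<tau> x)) = inv (T t) x" for t x by (rule fun_cong[OF fun_cong])
  have "\<forall>t. \<exists>S. posdiag S \<and> (\<forall>v. S (S v) = T t v)" using posdiag_sqrt_exists[OF T(2)] by blast
  from choice[OF this] obtain S where S: "\<And>t. posdiag (S t)" "\<And>t x. S t (S t x) = T t x" by blast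
  note S_props = sqrt_props[OF S(1) aut S(2) \<tau>T]
  have nonneg: "Re (hform (S t x) x) \<ge> 0" for t x
  proof -
    \<comment> \<open>A further root \<open>R\<close> is self-adjoint as well, so h(S x, x) = h(R x,
      R x).\<close>
    obtain R where R: "posdiag R" "\<And>v. R (R v) = S t v" using posdiag_sqrt_exists[OF S(1)] by blast
    have "hform (R (R x)) x = hform (R x) (R x)"
      by (rule sqrt_props(3)[OF R(1) S_props(1) R(2) S_props(2)])
    then have "hform (S t x) x = hform (R x) (R x)" by (simp only: R(2))
    then show ?thesis
      using herm_pos[OF herm_hform, of "R x"] herm_0[OF herm_hform, of 0] by (cases "R x = 0") auto
  qed
  have smooth_S: "smooth (\<lambda>t. S t x)" for x
  proof (rule smooth_sqrt_family[OF S pw_smooth[OF T(1,3)]])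
    show "isCont (\<lambda>t. matrix (S t)) t" for t
      by (rule isCont_sqrt_family[OF herm_hform S S_props(3) nonneg smooth_continuous[OF pw_smooth[OF T(1,3)]]])
  qed
  have smooth_inv: "smooth (\<lambda>t. inv (S t) x)" for x
    unfolding S_props(2)[symmetric] by (rule smooth_bounded_linear[OF bounded_linear_rconj smooth_S])
  have eqv: "S (t + 2 * pi) (\<sigma> x) = \<sigma> (S t x)" for t x
  proof -
    have inv: "\<sigma> (inv \<sigma> y) = y" "inv \<sigma> (\<sigma> y) = y" for y
      using \<sigma>_bij by (simp_all add: bij_is_surj surj_f_inv_f bij_is_inj)
    \<comment> \<open>Uniqueness of the positive root turns the equivariance of \<open>T\<close>
      into that of \<open>S\<close>.\<close>
    have "posdiag (\<lambda>x. \<sigma> (S t (inv \<sigma> x)))"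
      by (rule posdiag_conj[OF S(1)[of t] \<sigma>_bij clin_add[OF \<sigma>_clin]]) (auto simp: clin_scale[OF \<sigma>_clin] inv)
    moreover have "S (t + 2 * pi) (S (t + 2 * pi) v) = \<sigma> (S t (inv \<sigma> (\<sigma> (S t (inv \<sigma> v)))))" for v
      using pw_equivariant[OF T(1,3), of t "inv \<sigma> v"] by (simp add: S(2) inv)
    ultimately have "S (t + 2 * pi) = (\<lambda>x. \<sigma> (S t (inv \<sigma> x)))"
      by (rule posdiag_sqrt_unique[OF S(1)])
    then show ?thesis by (simp add: inv)
  qed
  obtain r where r: "\<Gamma> False r" "pw \<sigma> S r"
    using lift_exists[OF S_props(1) smooth_S smooth_inv eqv] by blast
  have "pw \<sigma> T (r \<circ> r)" using pw_comp[OF r(2,1,2)] by (simp add: S(2))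
  moreover have "\<Gamma> False (r \<circ> r)" using gaut_comp[OF r(1) r(1)] by simp
  ultimately obtain c where c: "g = (r \<circ> r) \<circ> shift \<sigma> c" using pw_same_shift[OF _ _ T(1,3)] by blast
  \<comment> \<open>Half of the defect, because shifts commute with \<open>r\<close> and add up
    under composition.\<close>
  let ?r = "r \<circ> shift \<sigma> (c / 2)"
  have "?r \<circ> ?r = g"
    by (simp add: fun_eq_iff c shift_commute[OF r, symmetric] shift_shift)
  moreover have "pw \<sigma> S ?r" using pw_comp[OF r(2) gaut_shift pw_shift] .
  moreover have "\<Gamma> False ?r" using gaut_comp[OF r(1) gaut_shift] by simp
  ultimately show ?thesis unfolding pos_aut_def using S(1) by blast
qed

lemma pos_aut_omega_omega:
  assumes W: "compact_rf_g br W" "\<sigma> ` W = W"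
  shows "\<Gamma> True (omega \<sigma> W)" "omega \<sigma> W \<circ> omega \<sigma> W = id" "Uhat \<sigma> W = {x \<in> G. omega \<sigma> W x = x}"
    "pos_aut br \<sigma> (omega \<sigma> W \<circ> \<omega>)"
proof -
  interpret W: simple_compact br W \<sigma>
    by unfold_locales (use W simple \<sigma>_aut in auto)
  show g: "\<Gamma> True (omega \<sigma> W)" by (rule W.gaut_omega)
  show "omega \<sigma> W \<circ> omega \<sigma> W = id" by (rule W.omega_comp)
  show "Uhat \<sigma> W = {x \<in> G. omega \<sigma> W x = x}" by (rule W.Uhat_omega)
  have "posdiag (\<lambda>x. rconj W (\<tau> x))"
    by (rule two_compact_forms_posdiag) unfold_locales
  moreover have "pw \<sigma> (\<lambda>t x. rconj W (\<tau> x)) (omega \<sigma> W \<circ> \<omega>)"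
    by (simp add: pw_def omega_def G_iff loop_\<tau>)
  moreover have "\<Gamma> False (omega \<sigma> W \<circ> \<omega>)" using gaut_comp[OF g gaut_omega] by simp
  ultimately show "pos_aut br \<sigma> (omega \<sigma> W \<circ> \<omega>)" unfolding pos_aut_def by (intro conjI exI allI)
qed

text \<open>The parameter changes cancel, and at each t the conjugate of \<omega> acts as the
  conjugation of the image of \<open>U\<close> under \<open>A t\<close>, a compact form that moves
  with t. Positivity is then \<open>two_compact_forms_posdiag\<close> at each t.\<close>

lemma pos_aut_conj_omega:
  assumes \<psi>: "\<Gamma> False \<psi>"
  shows "pos_aut br \<sigma> (\<psi> \<circ> \<omega> \<circ> inv \<psi> \<circ> \<omega>)"
proof -
  obtain e s A where A: "\<And>t. lie_aut br (A t)"
    "\<And>u a. u \<in> L \<Longrightarrow> \<exists>a'. \<psi> (u, a, 0) = ((\<lambda>t. A t (u (e * t + s))), a', 0)"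
    using aut_hat_pointwise[OF gaut_aut_hat[OF \<psi>]] by blast
  have "posdiag (\<lambda>x. rconj (A t ` U) (\<tau> x))" for t
    by (rule two_compact_forms_posdiag) (use compact_rf_aut(1)[OF A(1)] in unfold_locales)
  moreover have "pw \<sigma> (\<lambda>t x. rconj (A t ` U) (\<tau> x)) (\<psi> \<circ> \<omega> \<circ> inv \<psi> \<circ> \<omega>)"
    unfolding pw_def
  proof (intro ballI allI)
    fix v a assume v: "v \<in> L"
    let ?v = "\<lambda>t. \<tau> (v t)"
    have vL: "?v \<in> L" by (rule loop_\<tau>[OF v])
    obtain u a1 where u: "inv \<psi> (?v, cnj a, 0) = (u, a1, 0)"
      using gaut_pointwise[OF gaut_inv[OF \<psi>]] vL by blast
    have uL: "u \<in> L" using gaut_inv_G[OF \<psi>, of "(?v, cnj a, 0)"] u vL by (simp add: G_iff)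
    have "\<psi> (u, a1, 0) = (?v, cnj a, 0)" using gaut_inv_apply(2)[OF \<psi>] u by metis
    then have vt: "\<tau> (v t) = A t (u (e * t + s))" for t using A(2)[OF uL, of a1] by (auto dest: fun_cong)
    obtain a2 where a2: "\<psi> ((\<lambda>t. \<tau> (u t)), cnj a1, 0) = ((\<lambda>t. A t (\<tau> (u (e * t + s)))), a2, 0)"
      using A(2)[OF loop_\<tau>[OF uL], of "cnj a1"] by blast
    have "A t (\<tau> (u (e * t + s))) = rconj (A t ` U) (\<tau> (v t))" for t
      by (simp add: vt compact_rf_aut(2)[OF A(1)])
    then show "\<exists>a'. (\<psi> \<circ> \<omega> \<circ> inv \<psi> \<circ> \<omega>) (v, a, 0) = ((\<lambda>t. rconj (A t ` U) (\<tau> (v t))), a', 0)"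
      using v u uL a2 by (simp add: omega_def G_iff)
  qed
  moreover have "\<Gamma> False (\<psi> \<circ> \<omega> \<circ> inv \<psi> \<circ> \<omega>)"
    using gaut_comp[OF gaut_comp[OF gaut_comp[OF \<psi> gaut_omega] gaut_inv[OF \<psi>]] gaut_omega] by simp
  ultimately show ?thesis unfolding pos_aut_def by (intro conjI exI allI)
qed

lemma pos_aut_id: "pos_aut br \<sigma> id"
proof -
  have "posdiag (\<lambda>x :: complex^'n. x)"
    using two_compact_forms_posdiag[OF compact_form_axioms compact_form_axioms] by (simp add: rconj_rconj)
  moreover have "pw \<sigma> (\<lambda>t x. x) id" by (simp add: pw_def)
  ultimately show ?thesis using gaut_id unfolding pos_aut_def by (intro conjI exI allI)
qed

end

subsection \<open>Polar decomposition and fixed points\<close>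

definition cj :: "('a \<Rightarrow> 'a) \<Rightarrow> ('a \<Rightarrow> 'a) \<Rightarrow> 'a \<Rightarrow> 'a" where
  "cj a x = a \<circ> x \<circ> inv a"

lemma bij_inv_comp: "bij a \<Longrightarrow> inv a \<circ> a = id" "bij a \<Longrightarrow> a \<circ> inv a = id"
  by (simp_all add: bij_is_inj bij_is_surj surj_iff[symmetric])

lemma cj_comp: "bij a \<Longrightarrow> cj a (x \<circ> y) = cj a x \<circ> cj a y"
  by (simp add: cj_def fun_eq_iff bij_is_inj)

lemma cj_cj: "bij a \<Longrightarrow> bij b \<Longrightarrow> cj (a \<circ> b) x = cj a (cj b x)"
  by (simp add: cj_def o_inv_distrib comp_assoc)

lemma cj_id: "bij a \<Longrightarrow> cj a id = id"
  by (simp add: cj_def bij_inv_comp)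

lemma cj_by_id: "cj id x = x"
  by (simp add: cj_def)

lemma cj_inv_cancel: "bij a \<Longrightarrow> cj (inv a) (cj a x) = x" "bij a \<Longrightarrow> cj a (cj (inv a) x) = x"
  using cj_cj[of "inv a" a x] cj_cj[of a "inv a" x] by (simp_all add: bij_imp_bij_inv bij_inv_comp cj_by_id)

lemma cj_commute: "bij a \<Longrightarrow> cj a x = x \<longleftrightarrow> a \<circ> x = x \<circ> a"
  unfolding cj_def by (metis bij_inv_comp comp_assoc comp_id)

lemma cj_eqI: "bij a \<Longrightarrow> a \<circ> x = y \<circ> a \<Longrightarrow> cj a x = y"
  unfolding cj_def by (simp add: comp_assoc bij_inv_comp)

lemma cj_inv: "bij a \<Longrightarrow> bij x \<Longrightarrow> cj a (inv x) = inv (cj a x)"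
  unfolding cj_def by (simp add: o_inv_distrib bij_comp bij_imp_bij_inv inv_inv_eq comp_assoc)

lemma involution_inv: "x \<circ> x = id \<Longrightarrow> inv x = x"
  by (rule inv_unique_comp)

context simple_compact begin

abbreviation "Pos \<equiv> pos_aut br \<sigma>"

lemma Pos_gaut: "Pos g \<Longrightarrow> \<Gamma> False g"
  by (simp add: pos_aut_def)

lemma gaut_cj: "\<Gamma> a \<alpha> \<Longrightarrow> \<Gamma> c x \<Longrightarrow> \<Gamma> c (cj \<alpha> x)"
  using gaut_comp[OF gaut_comp[of a \<alpha> c x] gaut_inv[of a \<alpha>]] unfolding cj_def by (cases a; cases c) auto

lemma Pos_cj: "\<Gamma> c \<alpha> \<Longrightarrow> Pos g \<Longrightarrow> Pos (cj \<alpha> g)"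
  unfolding cj_def by (rule pos_aut_conj)

lemma bij_omega: "bij \<omega>"
  by (rule gaut_bij[OF gaut_omega])

lemma inv_omega: "inv \<omega> = \<omega>"
  by (rule involution_inv[OF omega_comp])

lemma omega_cancel: "\<omega> \<circ> (\<omega> \<circ> x) = x"
  by (metis comp_assoc id_comp omega_comp)

text \<open>By uniqueness \<omega> inverts r just as it inverts g, and so r \<omega> r^-1 = r
  \<omega> (\<omega> r \<omega>) = g \<omega>.\<close>

lemma Pos_sqrt:
  assumes g: "Pos g" "\<omega> \<circ> g \<circ> \<omega> = inv g"
  shows "\<exists>r. Pos r \<and> r \<circ> r = g \<and> \<omega> \<circ> r \<circ> \<omega> = inv r \<and> cj r \<omega> = g \<circ> \<omega>"
proof -
  obtain r where r: "Pos r" "r \<circ> r = g" using pos_aut_sqrt_exists[OF g] by blast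
  have b: "bij r" by (rule gaut_bij[OF Pos_gaut[OF r(1)]])
  have "cj \<omega> r = inv r"
  proof (rule pos_aut_sqrt_unique[OF Pos_cj[OF gaut_omega r(1)] pos_aut_inv[OF r(1)]])
    have "cj \<omega> r \<circ> cj \<omega> r = cj \<omega> g" using r(2) by (simp add: cj_comp[OF bij_omega, symmetric])
    also have "\<dots> = inv g" using g(2) by (simp add: cj_def inv_omega)
    also have "\<dots> = inv r \<circ> inv r" using r(2) b by (metis o_inv_distrib)
    finally show "cj \<omega> r \<circ> cj \<omega> r = inv r \<circ> inv r" .
  qed
  then have \<omega>r: "\<omega> \<circ> r \<circ> \<omega> = inv r" by (simp add: cj_def inv_omega)
  have "cj r \<omega> = r \<circ> \<omega> \<circ> (\<omega> \<circ> r \<circ> \<omega>)" unfolding \<omega>r cj_def ..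
  also have "\<dots> = g \<circ> \<omega>" using r(2) by (metis comp_assoc omega_cancel)
  finally show ?thesis using r \<omega>r by blast
qed

text \<open>These are the conjugations of the compact real forms (\<open>compact_iff_cc\<close>).
  They play the role of the points of a symmetric space, and the maps of \<open>cc_polar\<close>
  that of its transvections.\<close>

definition cc :: "('n aff \<Rightarrow> 'n aff) \<Rightarrow> bool" where
  "cc \<xi> \<longleftrightarrow> (\<exists>\<psi>. \<Gamma> False \<psi> \<and> \<xi> = cj \<psi> \<omega>)"

lemma cc_gaut: "cc \<xi> \<Longrightarrow> \<Gamma> True \<xi>"
  unfolding cc_def using gaut_cj gaut_omega by blast

lemma cc_involution: "cc \<xi> \<Longrightarrow> \<xi> \<circ> \<xi> = id"
  unfolding cc_def using cj_comp[OF gaut_bij, of False _ \<omega> \<omega>] cj_id[OF gaut_bij] omega_comp by metis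

lemma cc_omega: "cc \<omega>"
  unfolding cc_def using gaut_id cj_by_id by metis

lemma cc_cj: "\<Gamma> c \<alpha> \<Longrightarrow> cc \<xi> \<Longrightarrow> cc (cj \<alpha> \<xi>)"
proof -
  assume \<alpha>: "\<Gamma> c \<alpha>" and "cc \<xi>"
  then obtain \<psi> where \<psi>: "\<Gamma> False \<psi>" "\<xi> = cj \<psi> \<omega>" unfolding cc_def by blast
  have eq: "cj \<alpha> \<xi> = cj (\<alpha> \<circ> \<psi>) \<omega>" using \<psi> by (simp add: cj_cj[OF gaut_bij[OF \<alpha>] gaut_bij[OF \<psi>(1)]])
  show ?thesis
  proof (cases c)
    case True
    have g1: "\<Gamma> True (\<alpha> \<circ> \<psi>)" using gaut_comp[OF \<alpha> \<psi>(1)] True by simp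
    \<comment> \<open>Appending \<omega>, which commutes with itself, makes the conjugating map
      linear without changing the conjugate.\<close>
    then have "\<Gamma> False (\<alpha> \<circ> \<psi> \<circ> \<omega>)" using gaut_comp[OF g1 gaut_omega] by simp
    moreover have "cj (\<alpha> \<circ> \<psi> \<circ> \<omega>) \<omega> = cj (\<alpha> \<circ> \<psi>) \<omega>"
      using cj_cj[OF gaut_bij[OF g1] bij_omega] cj_commute[OF bij_omega, of \<omega>] by simp
    ultimately show ?thesis unfolding cc_def eq by metis
  next
    case False
    then show ?thesis using gaut_comp[OF \<alpha> \<psi>(1)] eq unfolding cc_def by auto
  qed
qed

lemma cc_polar_omega:
  assumes \<xi>: "cc \<xi>"
  shows "\<exists>r. Pos r \<and> r \<circ> r = \<xi> \<circ> \<omega> \<and> \<omega> \<circ> r \<circ> \<omega> = inv r \<and> cj r \<omega> = \<xi>"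
proof -
  obtain \<psi> where \<psi>: "\<Gamma> False \<psi>" "\<xi> = cj \<psi> \<omega>" using \<xi> unfolding cc_def by blast
  have "Pos (\<xi> \<circ> \<omega>)" using pos_aut_conj_omega[OF \<psi>(1)] \<psi>(2) by (simp add: cj_def)
  moreover have "inv (\<xi> \<circ> \<omega>) = \<omega> \<circ> \<xi>"
    by (simp add: o_inv_distrib gaut_bij[OF cc_gaut[OF \<xi>]] bij_omega inv_omega involution_inv[OF cc_involution[OF \<xi>]])
  then have "\<omega> \<circ> (\<xi> \<circ> \<omega>) \<circ> \<omega> = inv (\<xi> \<circ> \<omega>)"
    by (simp add: comp_assoc omega_comp)
  ultimately obtain r where r: "Pos r" "r \<circ> r = \<xi> \<circ> \<omega>" "\<omega> \<circ> r \<circ> \<omega> = inv r" "cj r \<omega> = \<xi> \<circ> \<omega> \<circ> \<omega>"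
    using Pos_sqrt by blast
  have "\<xi> \<circ> \<omega> \<circ> \<omega> = \<xi>" by (simp add: comp_assoc omega_comp)
  then show ?thesis using r by metis
qed

text \<open>Transport of \<open>cc_polar_omega\<close> by a map that carries \<omega> to
  \<xi>1.\<close>

lemma cc_polar:
  assumes \<xi>: "cc \<xi>1" "cc \<xi>2"
  shows "\<exists>g. Pos g \<and> g \<circ> g = \<xi>2 \<circ> \<xi>1 \<and> cj g \<xi>1 = \<xi>2"
proof -
  obtain \<psi> where \<psi>: "\<Gamma> False \<psi>" "\<xi>1 = cj \<psi> \<omega>" using \<xi>(1) unfolding cc_def by blast
  have b: "bij \<psi>" by (rule gaut_bij[OF \<psi>(1)])
  obtain r where r: "Pos r" "r \<circ> r = cj (inv \<psi>) \<xi>2 \<circ> \<omega>" "cj r \<omega> = cj (inv \<psi>) \<xi>2"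
    using cc_polar_omega[OF cc_cj[OF gaut_inv[OF \<psi>(1)] \<xi>(2)]] by blast
  have br: "bij r" by (rule gaut_bij[OF Pos_gaut[OF r(1)]])
  let ?g = "cj \<psi> r"
  have "?g \<circ> ?g = \<xi>2 \<circ> \<xi>1"
    using r(2) \<psi>(2) by (simp add: cj_comp[OF b, symmetric]) (simp add: cj_comp[OF b] cj_inv_cancel[OF b])
  moreover have "cj ?g \<xi>1 = \<xi>2"
  proof -
    have "cj ?g \<xi>1 = cj \<psi> r \<circ> cj \<psi> \<omega> \<circ> cj \<psi> (inv r)"
      using \<psi>(2) by (simp add: cj_def[of "cj \<psi> r"] cj_inv[OF b br])
    also have "\<dots> = cj \<psi> (cj r \<omega>)" by (simp add: cj_comp[OF b, symmetric] cj_def[of r])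
    finally show ?thesis by (simp add: r(3) cj_inv_cancel[OF b])
  qed
  ultimately show ?thesis using Pos_cj[OF \<psi>(1) r(1)] by blast
qed

lemma cc_polar_commute:
  assumes \<alpha>: "\<Gamma> c \<alpha>" "cj \<alpha> \<xi>1 = \<xi>1" "cj \<alpha> \<xi>2 = \<xi>2" and g: "Pos g" "g \<circ> g = \<xi>2 \<circ> \<xi>1"
  shows "cj \<alpha> g = g"
proof (rule pos_aut_sqrt_unique[OF Pos_cj[OF \<alpha>(1) g(1)] g(1)])
  have b: "bij \<alpha>" by (rule gaut_bij[OF \<alpha>(1)])
  have "cj \<alpha> g \<circ> cj \<alpha> g = cj \<alpha> (\<xi>2 \<circ> \<xi>1)" using g(2) by (simp add: cj_comp[OF b, symmetric])
  also have "\<dots> = g \<circ> g" using \<alpha> g(2) by (simp add: cj_comp[OF b])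
  finally show "cj \<alpha> g \<circ> cj \<alpha> g = g \<circ> g" .
qed

text \<open>An involution \<open>\<alpha>\<close> fixes the midpoint of \<open>\<omega>\<close> and its image.\<close>

lemma involution_fixes_cc:
  assumes \<alpha>: "\<Gamma> c \<alpha>" "\<alpha> \<circ> \<alpha> = id"
  shows "\<exists>m. cc m \<and> cj \<alpha> m = m"
proof -
  have b: "bij \<alpha>" by (rule gaut_bij[OF \<alpha>(1)])
  let ?\<xi> = "cj \<alpha> \<omega>"
  have \<xi>: "cc ?\<xi>" by (rule cc_cj[OF \<alpha>(1) cc_omega])
  obtain r where r: "Pos r" "r \<circ> r = ?\<xi> \<circ> \<omega>" "\<omega> \<circ> r \<circ> \<omega> = inv r" "cj r \<omega> = ?\<xi>"
    using cc_polar_omega[OF \<xi>] by blast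
  have br: "bij r" by (rule gaut_bij[OF Pos_gaut[OF r(1)]])
  have \<alpha>\<xi>: "cj \<alpha> ?\<xi> = \<omega>" using cj_cj[OF b b, of \<omega>] \<alpha>(2) by (simp add: cj_by_id)
  \<comment> \<open>\<alpha> exchanges \<omega> and its image, so it inverts their product and, by
    uniqueness, the root r of that product.\<close>
  have \<alpha>r: "cj \<alpha> r = inv r"
  proof (rule pos_aut_sqrt_unique[OF Pos_cj[OF \<alpha>(1) r(1)] pos_aut_inv[OF r(1)]])
    have "cj \<alpha> r \<circ> cj \<alpha> r = cj \<alpha> (?\<xi> \<circ> \<omega>)" using r(2) by (simp add: cj_comp[OF b, symmetric])
    also have "\<dots> = \<omega> \<circ> ?\<xi>" by (simp add: cj_comp[OF b] \<alpha>\<xi>)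
    also have "\<dots> = inv (?\<xi> \<circ> \<omega>)"
      by (simp add: o_inv_distrib gaut_bij[OF cc_gaut[OF \<xi>]] bij_omega inv_omega involution_inv[OF cc_involution[OF \<xi>]])
    also have "\<dots> = inv r \<circ> inv r" using r(2) br by (metis o_inv_distrib)
    finally show "cj \<alpha> r \<circ> cj \<alpha> r = inv r \<circ> inv r" .
  qed
  \<comment> \<open>The root q of r carries \<omega> to r \<omega>, the midpoint on the way from
    \<omega> to r^2 \<omega> = \<open>?\<xi>\<close>.\<close>
  obtain q where q: "Pos q" "cj q \<omega> = r \<circ> \<omega>" using Pos_sqrt[OF r(1,3)] by blast
  have "cj \<alpha> (r \<circ> \<omega>) = inv r \<circ> ?\<xi>" by (simp add: cj_comp[OF b] \<alpha>r)
  also have "?\<xi> = r \<circ> (r \<circ> \<omega>)" using r(2) by (metis comp_assoc comp_id omega_comp)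
  also have "inv r \<circ> (r \<circ> (r \<circ> \<omega>)) = r \<circ> \<omega>" by (metis comp_assoc id_comp bij_inv_comp(1)[OF br])
  finally have "cj \<alpha> (r \<circ> \<omega>) = r \<circ> \<omega>" .
  moreover have "cc (r \<circ> \<omega>)" unfolding cc_def using q Pos_gaut by metis
  ultimately show ?thesis by blast
qed

text \<open>\<rho>2 fixes both \<omega> and its image under \<psi>, so it commutes with the positive
  g that carries one to the other. Removing this polar part, g^-1 \<psi> fixes \<omega> and still
  conjugates \<rho>1 to \<rho>2.\<close>

lemma conjugate_in_centralizer:
  assumes \<rho>: "\<Gamma> c \<rho>1" "\<Gamma> c \<rho>2" "cj \<rho>1 \<omega> = \<omega>" "cj \<rho>2 \<omega> = \<omega>" and \<psi>: "\<Gamma> False \<psi>" "cj \<psi> \<rho>1 = \<rho>2"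
  shows "\<exists>\<phi>. \<Gamma> False \<phi> \<and> cj \<phi> \<omega> = \<omega> \<and> cj \<phi> \<rho>1 = \<rho>2"
proof -
  have b\<psi>: "bij \<psi>" and b1: "bij \<rho>1" and b2: "bij \<rho>2" using \<psi>(1) \<rho>(1,2) by (auto intro: gaut_bij)
  let ?\<xi> = "cj \<psi> \<omega>"
  have \<xi>: "cc ?\<xi>" unfolding cc_def using \<psi>(1) by blast
  have "\<rho>2 \<circ> \<psi> = \<psi> \<circ> \<rho>1"
    using \<psi>(2)[symmetric] b\<psi> unfolding cj_def by (metis bij_inv_comp(1) comp_assoc comp_id)
  then have "cj \<rho>2 ?\<xi> = ?\<xi>"
    using cj_cj[OF b2 b\<psi>, of \<omega>] cj_cj[OF b\<psi> b1, of \<omega>] \<rho>(3) by simp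
  moreover obtain g where g: "Pos g" "g \<circ> g = ?\<xi> \<circ> \<omega>" "cj g \<omega> = ?\<xi>" using cc_polar[OF cc_omega \<xi>] by blast
  ultimately have "cj \<rho>2 g = g" by (intro cc_polar_commute[OF \<rho>(2,4) _ g(1,2)])
  have bg: "bij g" by (rule gaut_bij[OF Pos_gaut[OF g(1)]])
  have "cj g \<rho>2 = \<rho>2" using \<open>cj \<rho>2 g = g\<close> cj_commute[OF b2] cj_commute[OF bg] by metis
  then have g\<rho>: "cj (inv g) \<rho>2 = \<rho>2" using cj_inv_cancel(1)[OF bg, of \<rho>2] by simp
  let ?\<phi> = "inv g \<circ> \<psi>"
  have bi: "bij (inv g)" by (rule bij_imp_bij_inv[OF bg])
  have "cj ?\<phi> \<omega> = \<omega>" using cj_cj[OF bi b\<psi>] g(3) cj_inv_cancel(1)[OF bg, of \<omega>] by simp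
  moreover have "cj ?\<phi> \<rho>1 = \<rho>2" using cj_cj[OF bi b\<psi>] \<psi>(2) g\<rho> by simp
  moreover have "\<Gamma> False ?\<phi>" using gaut_comp[OF gaut_inv[OF Pos_gaut[OF g(1)]] \<psi>(1)] by simp
  ultimately show ?thesis by blast
qed

text \<open>The product with \<omega> is positive with square 1, so it is the positive root of the
  identity.\<close>

lemma cc_commuting_involution:
  assumes \<xi>: "cc \<xi>" "cj \<omega> \<xi> = \<xi>"
  shows "\<xi> = \<omega>"
proof -
  obtain \<psi> where \<psi>: "\<Gamma> False \<psi>" "\<xi> = cj \<psi> \<omega>" using \<xi>(1) unfolding cc_def by blast
  have P: "Pos (\<xi> \<circ> \<omega>)" using pos_aut_conj_omega[OF \<psi>(1)] \<psi>(2) by (simp add: cj_def)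
  have "\<omega> \<circ> \<xi> = \<xi> \<circ> \<omega>" using \<xi>(2) cj_commute[OF bij_omega] by blast
  then have "(\<xi> \<circ> \<omega>) \<circ> (\<xi> \<circ> \<omega>) = id \<circ> id"
    using cc_involution[OF \<xi>(1)] omega_comp by (metis comp_assoc comp_id)
  then have "\<xi> \<circ> \<omega> = id" using pos_aut_sqrt_unique[OF P pos_aut_id] by blast
  then show ?thesis using omega_comp by (metis comp_assoc comp_id id_comp)
qed

end

subsection \<open>Real forms as fixed points of antilinear involutions\<close>

lemma ascale_aadd: "ascale z (aadd x y) = aadd (ascale z x) (ascale z y)"
  by (cases x; cases y) (simp add: aadd_eq ascale_eq vec.scale_right_distrib algebra_simps)

lemma ascale_azero: "ascale z azero = azero"
  by (simp add: ascale_eq azero_def)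

lemma aadd_left_commute: "aadd x (aadd y z) = aadd y (aadd x z)"
  by (metis aadd_assoc aadd_commute)

lemmas aadd_ac = aadd_assoc aadd_commute aadd_left_commute

context simple_compact begin

lemma abr_add_left: "x \<in> G \<Longrightarrow> y \<in> G \<Longrightarrow> z \<in> G \<Longrightarrow> abr br (aadd x y) z = aadd (abr br x z) (abr br y z)"
  by (cases x; cases y; cases z)
    (simp add: aadd_eq abr_eq G_iff loop_smooth dt_add ldot_add_left smooth_vector_derivative br_add_left
      vec.scale_left_distrib vec.scale_right_distrib algebra_simps)

lemma abr_add_right: "x \<in> G \<Longrightarrow> y \<in> G \<Longrightarrow> z \<in> G \<Longrightarrow> abr br z (aadd x y) = aadd (abr br z x) (abr br z y)"
  by (cases x; cases y; cases z)
    (simp add: aadd_eq abr_eq G_iff loop_smooth dt_add ldot_add_right smooth_vector_derivative br_add_right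
      vec.scale_left_distrib vec.scale_right_distrib algebra_simps)

lemma abr_scale_left: "x \<in> G \<Longrightarrow> y \<in> G \<Longrightarrow> abr br (ascale c x) y = ascale c (abr br x y)"
  by (cases x; cases y)
    (simp add: ascale_eq abr_eq G_iff loop_smooth dt_const_scale ldot_scale_left br_scale_left
      vec.scale_right_distrib vec.scale_right_diff_distrib mult.commute)

lemma abr_scale_right: "x \<in> G \<Longrightarrow> y \<in> G \<Longrightarrow> abr br x (ascale c y) = ascale c (abr br x y)"
  by (cases x; cases y)
    (simp add: ascale_eq abr_eq G_iff loop_smooth dt_const_scale ldot_scale_right br_scale_right
      vec.scale_right_distrib vec.scale_right_diff_distrib mult.commute)

definition Fix :: "('n aff \<Rightarrow> 'n aff) \<Rightarrow> 'n aff set" where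
  "Fix \<rho> = {x \<in> G. \<rho> x = x}"

lemma real_form_Fix:
  assumes \<rho>: "\<Gamma> True \<rho>" "\<rho> \<circ> \<rho> = id"
  shows "real_form_hat br \<sigma> (Fix \<rho>)"
  unfolding real_form_hat_def
proof (intro conjI ballI allI)
  have \<rho>\<rho>: "\<rho> (\<rho> x) = x" for x using \<rho>(2) by (metis comp_apply id_apply)
  show "Fix \<rho> \<subseteq> G" by (auto simp: Fix_def)
  have "\<rho> azero = azero" using gaut_scale[OF \<rho>(1) G_azero, of 0] by (simp add: ascale_0)
  then show "azero \<in> Fix \<rho>" by (simp add: Fix_def G_azero)
  show "aadd x y \<in> Fix \<rho>" "abr br x y \<in> Fix \<rho>" if "x \<in> Fix \<rho>" "y \<in> Fix \<rho>" for x y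
    using that by (simp_all add: Fix_def G_aadd G_abr gaut_add[OF \<rho>(1)] gaut_br[OF \<rho>(1)])
  show "ascale (complex_of_real r) x \<in> Fix \<rho>" if "x \<in> Fix \<rho>" for r x
    using that by (simp add: Fix_def G_ascale gaut_scale[OF \<rho>(1)])
  fix x assume x: "x \<in> G"
  \<comment> \<open>Real and imaginary part of x for the conjugation \<rho>.\<close>
  let ?p = "ascale (1 / 2) (aadd x (\<rho> x))" and ?q = "ascale (- \<i> / 2) (aadd x (ascale (- 1) (\<rho> x)))"
  note \<rho>G = gaut_G[OF \<rho>(1)]
  have p: "?p \<in> Fix \<rho>"
    by (simp add: Fix_def G_ascale G_aadd x \<rho>G gaut_scale[OF \<rho>(1)] gaut_add[OF \<rho>(1)] \<rho>\<rho> aadd_commute)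
  have q: "?q \<in> Fix \<rho>"
    by (simp add: Fix_def G_ascale G_aadd x \<rho>G gaut_scale[OF \<rho>(1)] gaut_add[OF \<rho>(1)] \<rho>\<rho> ascale_aadd ascale_ascale aadd_commute)
  show "\<exists>!pq. fst pq \<in> Fix \<rho> \<and> snd pq \<in> Fix \<rho> \<and> x = aadd (fst pq) (ascale \<i> (snd pq))"
  proof (rule ex1I[of _ "(?p, ?q)"])
    have "x = aadd ?p (ascale \<i> ?q)"
      by (cases x; cases "\<rho> x") (simp add: aadd_eq ascale_eq vec_eq_iff fun_eq_iff field_simps)
    then show "fst (?p, ?q) \<in> Fix \<rho> \<and> snd (?p, ?q) \<in> Fix \<rho> \<and> x = aadd (fst (?p, ?q)) (ascale \<i> (snd (?p, ?q)))"
      using p q by simp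
  next
    fix pq assume "fst pq \<in> Fix \<rho> \<and> snd pq \<in> Fix \<rho> \<and> x = aadd (fst pq) (ascale \<i> (snd pq))"
    then obtain p' q' where pq: "pq = (p', q')" "p' \<in> G" "q' \<in> G" "\<rho> p' = p'" "\<rho> q' = q'" "x = aadd p' (ascale \<i> q')"
      by (cases pq) (auto simp: Fix_def)
    then have \<rho>x: "\<rho> x = aadd p' (ascale (- \<i>) q')"
      by (simp add: gaut_add[OF \<rho>(1)] gaut_scale[OF \<rho>(1)] G_ascale)
    show "pq = (?p, ?q)"
      unfolding \<rho>x unfolding pq(1,6)
      by (cases p'; cases q') (simp add: aadd_eq ascale_eq vec_eq_iff fun_eq_iff field_simps)
  qed
qed

context
  fixes R assumes R: "real_form_hat br \<sigma> R"
begin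

lemma rf_G: "x \<in> R \<Longrightarrow> x \<in> G"
  and rf_0: "azero \<in> R"
  and rf_add: "x \<in> R \<Longrightarrow> y \<in> R \<Longrightarrow> aadd x y \<in> R"
  and rf_scale: "x \<in> R \<Longrightarrow> ascale (complex_of_real r) x \<in> R"
  and rf_br: "x \<in> R \<Longrightarrow> y \<in> R \<Longrightarrow> abr br x y \<in> R"
  and rf_decomp: "x \<in> G \<Longrightarrow> \<exists>!pq. fst pq \<in> R \<and> snd pq \<in> R \<and> x = aadd (fst pq) (ascale \<i> (snd pq))"
  using R unfolding real_form_hat_def by blast+

lemma rf_obtain:
  assumes "x \<in> G" obtains p q where "p \<in> R" "q \<in> R" "x = aadd p (ascale \<i> q)"
  using rf_decomp[OF assms] by blast

lemma rf_minus: "x \<in> R \<Longrightarrow> ascale (- 1) x \<in> R"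
  using rf_scale[of x "- 1"] by simp

lemma rf_unique:
  assumes "p \<in> R" "q \<in> R" "p' \<in> R" "q' \<in> R" "aadd p (ascale \<i> q) = aadd p' (ascale \<i> q')"
  shows "p = p'" "q = q'"
proof -
  have "aadd p (ascale \<i> q) \<in> G" using assms by (intro G_aadd G_ascale rf_G)
  from rf_decomp[OF this] have "(p, q) = (p', q')"
    using assms by (metis fst_conv snd_conv)
  then show "p = p'" "q = q'" by auto
qed

lemma gaut_eqI:
  assumes a: "\<Gamma> c \<phi>" and b: "\<Gamma> c \<phi>'" and eq: "\<And>x. x \<in> R \<Longrightarrow> \<phi> x = \<phi>' x"
  shows "\<phi> = \<phi>'"
proof
  fix x
  show "\<phi> x = \<phi>' x"
  proof (cases "x \<in> G")
    case True
    obtain p q where pq: "p \<in> R" "q \<in> R" "x = aadd p (ascale \<i> q)" using rf_obtain[OF True] by blast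
    then show ?thesis
      by (simp add: gaut_add[OF a] gaut_add[OF b] gaut_scale[OF a] gaut_scale[OF b] rf_G G_ascale eq)
  next
    case False
    then show ?thesis using gaut_outside[OF a] gaut_outside[OF b] by simp
  qed
qed

text \<open>Linear and antilinear extension in one construction: p + i q goes to \<psi> p + j \<psi>
  q with j = i or j = -i, and compatibility with the bracket rests on j^2 = -1. The antilinear
  extension of the identity is the conjugation of \<open>R\<close>.\<close>

lemma real_aut_extend:
  assumes \<psi>: "real_aut_on br R \<psi>"
  shows "\<exists>\<phi>. \<Gamma> c \<phi> \<and> (\<forall>x\<in>R. \<phi> x = \<psi> x)"
proof -
  have \<psi>_add: "\<psi> (aadd x y) = aadd (\<psi> x) (\<psi> y)" and \<psi>_br: "\<psi> (abr br x y) = abr br (\<psi> x) (\<psi> y)"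
    and \<psi>_scale: "\<psi> (ascale (complex_of_real r) x) = ascale (complex_of_real r) (\<psi> x)"
    if "x \<in> R" "y \<in> R" for x y r
    using \<psi> that unfolding real_aut_on_def by blast+
  have bij: "bij_betw \<psi> R R" using \<psi> unfolding real_aut_on_def by blast
  then have \<psi>R: "\<psi> x \<in> R" if "x \<in> R" for x using that bij_betwE by blast
  have \<psi>_surj: "\<exists>y\<in>R. \<psi> y = x" if "x \<in> R" for x
  proof -
    have "x \<in> \<psi> ` R" using bij that by (simp add: bij_betw_def)
    then obtain y where "x = \<psi> y" "y \<in> R" by (rule imageE)
    then show ?thesis by (intro bexI[of _ y]) simp_all
  qed
  define j where "j = (if c then - \<i> else \<i>)"
  \<comment> \<open>The sign is kept as a real number because \<open>R\<close> is closed under real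
    multiples only.\<close>
  define s where "s = (if c then - 1 else 1 :: real)"
  have js: "j = \<i> * complex_of_real s" by (simp add: j_def s_def)
  have ss: "s * s = 1" by (simp add: s_def)
  have "\<exists>pq. fst pq \<in> R \<and> snd pq \<in> R \<and> x = aadd (fst pq) (ascale \<i> (snd pq))" if "x \<in> G" for x
    using rf_decomp[OF that] by blast
  then obtain d where d: "\<And>x. x \<in> G \<Longrightarrow> fst (d x) \<in> R \<and> snd (d x) \<in> R \<and> x = aadd (fst (d x)) (ascale \<i> (snd (d x)))"
    by metis
  define \<phi> where "\<phi> x = (if x \<in> G then aadd (\<psi> (fst (d x))) (ascale j (\<psi> (snd (d x)))) else x)" for x
  have \<phi>: "\<phi> (aadd p (ascale \<i> q)) = aadd (\<psi> p) (ascale j (\<psi> q))" if p: "p \<in> R" and q: "q \<in> R" for p q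
  proof -
    have g: "aadd p (ascale \<i> q) \<in> G" using p q by (intro G_aadd G_ascale rf_G)
    have "p = fst (d (aadd p (ascale \<i> q)))" "q = snd (d (aadd p (ascale \<i> q)))"
      using rf_unique[OF p q, of "fst (d (aadd p (ascale \<i> q)))" "snd (d (aadd p (ascale \<i> q)))"] d[OF g] by blast+
    then show ?thesis using g by (simp add: \<phi>_def)
  qed
  have j_form: "aadd (\<psi> p) (ascale j (\<psi> q)) = aadd (\<psi> p) (ascale \<i> (ascale (complex_of_real s) (\<psi> q)))" for p q
    by (simp add: js ascale_ascale)
  have \<phi>G: "\<phi> x \<in> G" if "x \<in> G" for x
    using d[OF that] that by (simp add: \<phi>_def G_aadd G_ascale rf_G \<psi>R)
  have "\<Gamma> c \<phi>"
    unfolding gaut_def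
  proof (intro conjI ballI allI impI)
    show "\<phi> x = x" if "x \<notin> G" for x using that by (simp add: \<phi>_def)
    show "bij_betw \<phi> G G"
      unfolding bij_betw_def
    proof
      show "inj_on \<phi> G"
      proof (rule inj_onI)
        fix x y assume x: "x \<in> G" and y: "y \<in> G" and eq: "\<phi> x = \<phi> y"
        obtain p q where pq: "p \<in> R" "q \<in> R" "x = aadd p (ascale \<i> q)" using rf_obtain[OF x] by blast
        obtain p' q' where pq': "p' \<in> R" "q' \<in> R" "y = aadd p' (ascale \<i> q')" using rf_obtain[OF y] by blast
        have *: "aadd (\<psi> p) (ascale \<i> (ascale (complex_of_real s) (\<psi> q))) = aadd (\<psi> p') (ascale \<i> (ascale (complex_of_real s) (\<psi> q')))"
          using eq pq pq' \<phi> by (simp add: j_form)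
        have 1: "\<psi> p = \<psi> p'" "ascale (complex_of_real s) (\<psi> q) = ascale (complex_of_real s) (\<psi> q')"
          using rf_unique[OF _ _ _ _ *] pq pq' \<psi>R rf_scale by blast+
        have "ascale (complex_of_real s) (ascale (complex_of_real s) (\<psi> q)) = \<psi> q" for q
          by (simp add: ascale_ascale ss ascale_1 flip: of_real_mult)
        then have "\<psi> q = \<psi> q'" using 1(2) by metis
        then have "p = p'" "q = q'"
          using 1(1) bij pq(1,2) pq'(1,2) unfolding bij_betw_def inj_on_def by blast+
        then show "x = y" using pq(3) pq'(3) by simp
      qed
      show "\<phi> ` G = G"
      proof (intro equalityI subsetI)
        fix y assume "y \<in> G"
        then obtain p q where pq: "p \<in> R" "q \<in> R" "y = aadd p (ascale \<i> q)" using rf_obtain by blast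
        obtain p' where p': "p' \<in> R" "\<psi> p' = p" using \<psi>_surj[OF pq(1)] by blast
        obtain q' where q': "q' \<in> R" "\<psi> q' = ascale (complex_of_real s) q"
          using \<psi>_surj[OF rf_scale[OF pq(2)]] by blast
        have "\<phi> (aadd p' (ascale \<i> q')) = y"
          unfolding \<phi>[OF p'(1) q'(1)] pq(3) p'(2) q'(2) by (simp add: js ascale_ascale mult.assoc ss flip: of_real_mult)
        then show "y \<in> \<phi> ` G" using p'(1) q'(1) by (intro image_eqI[of _ _ "aadd p' (ascale \<i> q')"] G_aadd G_ascale rf_G) auto
      qed (use \<phi>G in blast)
    qed
    fix x y assume x: "x \<in> G" and y: "y \<in> G"
    obtain p q where pq: "p \<in> R" "q \<in> R" "x = aadd p (ascale \<i> q)" using rf_obtain[OF x] by blast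
    obtain p' q' where pq': "p' \<in> R" "q' \<in> R" "y = aadd p' (ascale \<i> q')" using rf_obtain[OF y] by blast
    show "\<phi> (aadd x y) = aadd (\<phi> x) (\<phi> y)"
    proof -
      have "aadd x y = aadd (aadd p p') (ascale \<i> (aadd q q'))"
        unfolding pq pq' by (simp add: ascale_aadd aadd_ac)
      then have "\<phi> (aadd x y) = aadd (\<psi> (aadd p p')) (ascale j (\<psi> (aadd q q')))"
        using \<phi>[OF rf_add[OF pq(1) pq'(1)] rf_add[OF pq(2) pq'(2)]] by simp
      then show ?thesis
        using \<phi>[OF pq(1,2)] \<phi>[OF pq'(1,2)] pq pq' by (simp add: \<psi>_add ascale_aadd aadd_ac)
    qed
    show "\<phi> (abr br x y) = abr br (\<phi> x) (\<phi> y)"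
    proof -
      have expand: "abr br (aadd a (ascale z b)) (aadd a' (ascale z b')) =
          aadd (aadd (abr br a a') (ascale (z * z) (abr br b b'))) (ascale z (aadd (abr br a b') (abr br b a')))"
        if "a \<in> R" "b \<in> R" "a' \<in> R" "b' \<in> R" for a b a' b' z
        using that
        by (simp add: abr_add_left abr_add_right abr_scale_left abr_scale_right rf_G G_aadd G_ascale G_abr
          ascale_aadd ascale_ascale aadd_ac)
      let ?P = "aadd (abr br p p') (ascale (- 1) (abr br q q'))" and ?Q = "aadd (abr br p q') (abr br q p')"
      have PQ: "?P \<in> R" "?Q \<in> R" using pq pq' by (auto intro!: rf_add rf_minus rf_br)
      have "abr br x y = aadd ?P (ascale \<i> ?Q)"
        using expand[OF pq(1,2) pq'(1,2), of \<i>] pq pq' by simp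
      then have "\<phi> (abr br x y) = aadd (\<psi> ?P) (ascale j (\<psi> ?Q))" using \<phi>[OF PQ] by simp
      also have "\<psi> ?P = aadd (abr br (\<psi> p) (\<psi> p')) (ascale (- 1) (abr br (\<psi> q) (\<psi> q')))"
        using pq pq' \<psi>_scale[of "abr br q q'" "abr br q q'" "- 1"]
        by (simp add: \<psi>_add \<psi>_br rf_br rf_minus)
      also have "\<psi> ?Q = aadd (abr br (\<psi> p) (\<psi> q')) (abr br (\<psi> q) (\<psi> p'))"
        using pq pq' by (simp add: \<psi>_add \<psi>_br rf_br)
      finally show ?thesis
        using expand[of "\<psi> p" "\<psi> q" "\<psi> p'" "\<psi> q'" j] \<phi>[OF pq(1,2)] \<phi>[OF pq'(1,2)] pq pq' \<psi>R
        by (simp add: j_def split: if_splits)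
    qed
  next
    fix z x assume x: "x \<in> G"
    obtain p q where pq: "p \<in> R" "q \<in> R" "x = aadd p (ascale \<i> q)" using rf_obtain[OF x] by blast
    let ?a = "complex_of_real (Re z)" and ?b = "complex_of_real (Im z)" and ?b' = "complex_of_real (- Im z)"
    let ?P = "aadd (ascale ?a p) (ascale ?b' q)" and ?Q = "aadd (ascale ?a q) (ascale ?b p)"
    have PQ: "?P \<in> R" "?Q \<in> R" using pq by (auto intro!: rf_add rf_scale simp del: of_real_minus)
    have z: "z = ?a + \<i> * ?b" by (simp add: complex_eq_iff)
    have gen: "aadd (aadd (ascale ?a u) (ascale ?b' v)) (ascale k (aadd (ascale ?a v) (ascale ?b u))) =
        ascale (?a + k * ?b) (aadd u (ascale k v))" if "k * k = - 1" for k u v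
    proof -
      have kk: "k * (k * x) = - x" for x using that by (metis mult.assoc mult_minus1)
      show ?thesis
        by (cases u; cases v) (simp add: aadd_eq ascale_eq vec_eq_iff fun_eq_iff algebra_simps kk)
    qed
    have "ascale z x = aadd ?P (ascale \<i> ?Q)"
      using gen[of \<i> p q] pq(3) z by simp
    then have "\<phi> (ascale z x) = aadd (\<psi> ?P) (ascale j (\<psi> ?Q))" using \<phi>[OF PQ] by simp
    also have "\<psi> ?P = aadd (ascale ?a (\<psi> p)) (ascale ?b' (\<psi> q))"
      using pq rf_scale[of p "Re z"] rf_scale[of q "- Im z"]
      by (simp only: \<psi>_add \<psi>_scale)
    also have "\<psi> ?Q = aadd (ascale ?a (\<psi> q)) (ascale ?b (\<psi> p))"
      using pq rf_scale[of q "Re z"] rf_scale[of p "Im z"]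
      by (simp only: \<psi>_add \<psi>_scale)
    also have "aadd (aadd (ascale ?a (\<psi> p)) (ascale ?b' (\<psi> q))) (ascale j (aadd (ascale ?a (\<psi> q)) (ascale ?b (\<psi> p)))) =
        ascale (?a + j * ?b) (\<phi> x)"
      using gen[of j "\<psi> p" "\<psi> q"] \<phi>[OF pq(1,2)] pq(3) by (simp add: j_def split: if_splits)
    also have "?a + j * ?b = (if c then cnj z else z)" by (simp add: j_def complex_eq_iff)
    finally show "\<phi> (ascale z x) = ascale (if c then cnj z else z) (\<phi> x)" .
  qed
  moreover have "\<phi> x = \<psi> x" if "x \<in> R" for x
  proof -
    have "\<psi> azero = azero" using \<psi>_scale[OF rf_0 rf_0, of 0] by (simp add: ascale_0)
    then show ?thesis using \<phi>[OF that rf_0] by (simp add: ascale_azero aadd_azero)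
  qed
  ultimately show ?thesis by blast
qed

lemma ex_conjugation: "\<exists>\<rho>. \<Gamma> True \<rho> \<and> \<rho> \<circ> \<rho> = id \<and> R = Fix \<rho>"
proof -
  have "real_aut_on br R id" by (simp add: real_aut_on_def)
  then obtain \<rho> where \<rho>: "\<Gamma> True \<rho>" "\<And>x. x \<in> R \<Longrightarrow> \<rho> x = x" using real_aut_extend[of id True] by auto
  have "\<rho> \<circ> \<rho> = id"
    by (rule gaut_eqI[of False]) (use gaut_comp[OF \<rho>(1) \<rho>(1)] gaut_id \<rho>(2) in auto)
  moreover have "x \<in> R" if x: "x \<in> G" "\<rho> x = x" for x
  proof -
    obtain p q where pq: "p \<in> R" "q \<in> R" "x = aadd p (ascale \<i> q)" using rf_obtain[OF x(1)] by blast
    have "aadd p (ascale \<i> (ascale (- 1) q)) = \<rho> x"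
      unfolding pq(3) using pq(1,2) by (simp add: gaut_add[OF \<rho>(1)] gaut_scale[OF \<rho>(1)] rf_G G_ascale \<rho>(2) ascale_ascale)
    then have "ascale (- 1) q = q" using rf_unique(2)[OF pq(1) rf_minus[OF pq(2)] pq(1,2)] x(2) pq(3) by simp
    then have "q = azero"
      by (cases q) (auto simp: ascale_eq azero_def fun_eq_iff vec_eq_iff)
    then show ?thesis using pq by (simp add: ascale_azero aadd_azero)
  qed
  then have "R = Fix \<rho>" unfolding Fix_def using rf_G \<rho>(2) by blast
  ultimately show ?thesis using \<rho>(1) by blast
qed

end

lemma Fix_inj:
  assumes "\<Gamma> True \<rho>" "\<rho> \<circ> \<rho> = id" "\<Gamma> True \<rho>'" "Fix \<rho> = Fix \<rho>'"
  shows "\<rho> = \<rho>'"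
proof (rule gaut_eqI[OF real_form_Fix[OF assms(1,2)] assms(1,3)])
  fix x assume "x \<in> Fix \<rho>"
  then have "x \<in> Fix \<rho>" "x \<in> Fix \<rho>'" using assms(4) by simp_all
  then show "\<rho> x = \<rho>' x" by (simp add: Fix_def)
qed

lemma Fix_cj:
  assumes a: "\<Gamma> c \<phi>"
  shows "Fix (cj \<phi> \<rho>) = \<phi> ` Fix \<rho>"
proof (intro equalityI subsetI)
  fix x assume x: "x \<in> Fix (cj \<phi> \<rho>)"
  then have "inv \<phi> x \<in> Fix \<rho>"
    using gaut_inv_G[OF a, of x] gaut_inv_apply(1)[OF a, of "\<rho> (inv \<phi> x)"] by (simp add: Fix_def cj_def)
  then show "x \<in> \<phi> ` Fix \<rho>" using gaut_inv_apply(2)[OF a, of x] by (metis image_eqI)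
next
  fix x assume "x \<in> \<phi> ` Fix \<rho>"
  then show "x \<in> Fix (cj \<phi> \<rho>)"
    using gaut_G[OF a] gaut_inv_apply(1)[OF a] by (auto simp: Fix_def cj_def)
qed

lemma cj_involution: "bij a \<Longrightarrow> x \<circ> x = id \<Longrightarrow> cj a x \<circ> cj a x = id"
  by (metis cj_comp cj_id)

text \<open>An antilinear involution is determined by its fixed points, so conjugacy of real forms
  becomes conjugacy of their conjugations inside one group.\<close>

lemma conj_rf_Fix:
  assumes \<rho>: "\<Gamma> True \<rho>" "\<rho> \<circ> \<rho> = id" and \<rho>': "\<Gamma> True \<rho>'"
  shows "conj_rf br \<sigma> (Fix \<rho>) (Fix \<rho>') \<longleftrightarrow> (\<exists>\<phi>. \<Gamma> False \<phi> \<and> cj \<phi> \<rho> = \<rho>')"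
proof
  assume "conj_rf br \<sigma> (Fix \<rho>) (Fix \<rho>')"
  then obtain \<phi> where \<phi>: "aut_hat br \<sigma> \<phi>" "\<phi> ` Fix \<rho> = Fix \<rho>'" unfolding conj_rf_def by blast
  let ?\<phi> = "\<lambda>x. if x \<in> G then \<phi> x else x"
  have g: "\<Gamma> False ?\<phi>" by (rule aut_hat_gaut[OF \<phi>(1)])
  have "?\<phi> ` Fix \<rho> = \<phi> ` Fix \<rho>" by (rule image_cong) (auto simp: Fix_def)
  then have "Fix (cj ?\<phi> \<rho>) = Fix \<rho>'" using Fix_cj[OF g] \<phi>(2) by simp
  then have "cj ?\<phi> \<rho> = \<rho>'"
    by (rule Fix_inj[OF gaut_cj[OF g \<rho>(1)] cj_involution[OF gaut_bij[OF g] \<rho>(2)] \<rho>'])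
  then show "\<exists>\<phi>. \<Gamma> False \<phi> \<and> cj \<phi> \<rho> = \<rho>'" using g by blast
next
  assume "\<exists>\<phi>. \<Gamma> False \<phi> \<and> cj \<phi> \<rho> = \<rho>'"
  then obtain \<phi> where "\<Gamma> False \<phi>" "cj \<phi> \<rho> = \<rho>'" by blast
  then show "conj_rf br \<sigma> (Fix \<rho>) (Fix \<rho>')"
    unfolding conj_rf_def using gaut_aut_hat Fix_cj by metis
qed

lemma real_aut_on_Fix:
  assumes \<phi>: "\<Gamma> False \<phi>" and \<rho>: "\<Gamma> True \<rho>" "cj \<phi> \<rho> = \<rho>"
  shows "real_aut_on br (Fix \<rho>) \<phi>"
proof -
  have "\<phi> ` Fix \<rho> = Fix \<rho>" using Fix_cj[OF \<phi>, of \<rho>] \<rho>(2) by simp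
  moreover have "inj_on \<phi> (Fix \<rho>)" using gaut_bij[OF \<phi>] by (meson bij_is_inj inj_on_subset subset_UNIV)
  ultimately show ?thesis
    unfolding real_aut_on_def bij_betw_def
    by (simp add: Fix_def gaut_add[OF \<phi>] gaut_scale[OF \<phi>] gaut_br[OF \<phi>])
qed

lemma real_aut_extend_Fix:
  assumes \<rho>: "\<Gamma> True \<rho>" "\<rho> \<circ> \<rho> = id" and \<psi>: "real_aut_on br (Fix \<rho>) \<psi>"
  shows "\<exists>\<phi>. \<Gamma> False \<phi> \<and> cj \<phi> \<rho> = \<rho> \<and> (\<forall>x\<in>Fix \<rho>. \<phi> x = \<psi> x)"
proof -
  note rf = real_form_Fix[OF \<rho>]
  obtain \<phi> where \<phi>: "\<Gamma> False \<phi>" "\<And>x. x \<in> Fix \<rho> \<Longrightarrow> \<phi> x = \<psi> x" using real_aut_extend[OF rf \<psi>] by blast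
  have "\<psi> x \<in> Fix \<rho>" if "x \<in> Fix \<rho>" for x using \<psi> that unfolding real_aut_on_def by (meson bij_betwE)
  then have "\<phi> \<circ> \<rho> = \<rho> \<circ> \<phi>"
    using gaut_comp[OF \<phi>(1) \<rho>(1)] gaut_comp[OF \<rho>(1) \<phi>(1)] \<phi>(2)
    by (intro gaut_eqI[OF rf, of True]) (auto simp: Fix_def)
  then show ?thesis using \<phi> cj_commute[OF gaut_bij[OF \<phi>(1)]] by blast
qed

end

subsection \<open>Conjugacy classes\<close>

text \<open>The conjugacy relations live on whole types, where reflexivity and symmetry may fail, so
  these are asked on the carriers only. A class may contain elements outside its carrier, hence the
  choice of representatives inside.\<close>

lemma quotient_bijection:
  assumes rC: "\<And>x. x \<in> C \<Longrightarrow> (x, x) \<in> r" "\<And>x y. x \<in> C \<Longrightarrow> y \<in> C \<Longrightarrow> (x, y) \<in> r \<Longrightarrow> (y, x) \<in> r" "trans r"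
    and sA: "\<And>x. x \<in> A \<Longrightarrow> (x, x) \<in> s" "\<And>x y. x \<in> A \<Longrightarrow> y \<in> A \<Longrightarrow> (x, y) \<in> s \<Longrightarrow> (y, x) \<in> s" "trans s"
    and F: "\<And>c. c \<in> C \<Longrightarrow> F c \<in> A" "\<And>a. a \<in> A \<Longrightarrow> \<exists>c\<in>C. (F c, a) \<in> s"
      "\<And>c c'. c \<in> C \<Longrightarrow> c' \<in> C \<Longrightarrow> (c, c') \<in> r \<longleftrightarrow> (F c, F c') \<in> s"
  shows "\<exists>f. bij_betw f (C // r) (A // s)"
proof -
  have r_eq: "r `` {x} = r `` {y} \<longleftrightarrow> (x, y) \<in> r" if "x \<in> C" "y \<in> C" for x y
    using rC(1,2) transD[OF rC(3)] that by blast
  have s_eq: "s `` {x} = s `` {y} \<longleftrightarrow> (x, y) \<in> s" if "x \<in> A" "y \<in> A" for x y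
    using sA(1,2) transD[OF sA(3)] that by blast
  define rep where "rep X = (SOME c. c \<in> C \<and> X = r `` {c})" for X
  have rep: "rep X \<in> C \<and> X = r `` {rep X}" if "X \<in> C // r" for X
    unfolding rep_def by (rule someI_ex) (use that in \<open>auto simp: quotient_def\<close>)
  let ?f = "\<lambda>X. s `` {F (rep X)}"
  have "inj_on ?f (C // r)"
  proof (rule inj_onI)
    fix X Y assume X: "X \<in> C // r" and Y: "Y \<in> C // r" and eq: "?f X = ?f Y"
    then have "(rep X, rep Y) \<in> r"
      using rep[OF X] rep[OF Y] s_eq F(1,3) by blast
    then show "X = Y" using rep[OF X] rep[OF Y] r_eq by blast
  qed
  moreover have "?f ` (C // r) = A // s"
  proof (intro equalityI subsetI)
    fix Z assume "Z \<in> ?f ` (C // r)"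
    then show "Z \<in> A // s" using rep F(1) by (auto intro!: quotientI)
  next
    fix Z assume "Z \<in> A // s"
    then obtain a where a: "a \<in> A" "Z = s `` {a}" by (auto simp: quotient_def)
    obtain c where c: "c \<in> C" "(F c, a) \<in> s" using F(2)[OF a(1)] by blast
    have X: "r `` {c} \<in> C // r" using c(1) by (rule quotientI)
    have "(rep (r `` {c}), c) \<in> r" using rep[OF X] r_eq c(1) by blast
    then have "(F (rep (r `` {c})), a) \<in> s" using F(3) rep[OF X] c transD[OF sA(3)] by blast
    then have "Z = ?f (r `` {c})" using s_eq F(1) rep[OF X] a by blast
    then show "Z \<in> ?f ` (C // r)" using X by blast
  qed
  ultimately show ?thesis unfolding bij_betw_def by blast
qed

context simple_compact begin

lemma Uhat_Fix: "Uhat \<sigma> U = Fix \<omega>"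
  by (simp add: Uhat_omega Fix_def)

lemmas real_form_Uhat = real_form_Fix[OF gaut_omega omega_comp, folded Uhat_Fix]

lemma conj_rf_refl: "R \<subseteq> G \<Longrightarrow> conj_rf br \<sigma> R R"
  unfolding conj_rf_def using gaut_aut_hat[OF gaut_id] by (intro exI[of _ id]) simp

lemma conj_rf_sym: "R1 \<subseteq> G \<Longrightarrow> conj_rf br \<sigma> R1 R2 \<Longrightarrow> conj_rf br \<sigma> R2 R1"
proof -
  assume R: "R1 \<subseteq> G" and "conj_rf br \<sigma> R1 R2"
  then obtain \<phi> where \<phi>: "aut_hat br \<sigma> \<phi>" "\<phi> ` R1 = R2" unfolding conj_rf_def by blast
  obtain \<phi>' where \<phi>': "aut_hat br \<sigma> \<phi>'" "\<forall>x\<in>G. \<phi>' (\<phi> x) = x" using aut_hat_inverse[OF \<phi>(1)] by blast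
  have "\<phi>' ` R2 = R1" using \<phi>(2) \<phi>'(2) R by (force simp: image_iff)
  then show ?thesis unfolding conj_rf_def using \<phi>'(1) by blast
qed

lemma aut_hat_comp: "aut_hat br \<sigma> \<phi> \<Longrightarrow> aut_hat br \<sigma> \<psi> \<Longrightarrow> aut_hat br \<sigma> (\<phi> \<circ> \<psi>)"
proof -
  assume \<phi>: "aut_hat br \<sigma> \<phi>" and \<psi>: "aut_hat br \<sigma> \<psi>"
  then have "bij_betw (\<phi> \<circ> \<psi>) G G" unfolding aut_hat_def by (blast intro: bij_betw_trans)
  then show ?thesis
    unfolding aut_hat_def by (simp add: aut_hat_props[OF \<phi>] aut_hat_props[OF \<psi>])
qed

lemma conj_rf_trans: "conj_rf br \<sigma> R1 R2 \<Longrightarrow> conj_rf br \<sigma> R2 R3 \<Longrightarrow> conj_rf br \<sigma> R1 R3"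
proof -
  assume "conj_rf br \<sigma> R1 R2" "conj_rf br \<sigma> R2 R3"
  then obtain \<phi> \<psi> where *: "aut_hat br \<sigma> \<phi>" "\<phi> ` R1 = R2" "aut_hat br \<sigma> \<psi>" "\<psi> ` R2 = R3"
    unfolding conj_rf_def by blast
  then have "(\<psi> \<circ> \<phi>) ` R1 = R3" by (simp only: image_comp[symmetric])
  then show ?thesis unfolding conj_rf_def using aut_hat_comp[OF *(3,1)] by blast
qed

text \<open>The product of the two conjugations is positive at each t, and its positive root carries
  \<omega> to the conjugation of \<open>W\<close>. No prior conjugacy of \<open>U\<close> and
  \<open>W\<close> enters.\<close>

lemma compact_forms_conjugate:
  assumes W: "compact_rf_g br W" "\<sigma> ` W = W"
  shows "conj_rf br \<sigma> (Uhat \<sigma> U) (Uhat \<sigma> W)"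
proof -
  note * = pos_aut_omega_omega[OF W]
  let ?w = "omega \<sigma> W"
  have bw: "bij ?w" by (rule gaut_bij[OF *(1)])
  have "inv (?w \<circ> \<omega>) = \<omega> \<circ> ?w"
    by (simp add: o_inv_distrib bw bij_omega inv_omega involution_inv[OF *(2)])
  then have "\<omega> \<circ> (?w \<circ> \<omega>) \<circ> \<omega> = inv (?w \<circ> \<omega>)"
    by (simp add: comp_assoc omega_comp)
  then obtain r where r: "Pos r" "cj r \<omega> = ?w \<circ> \<omega> \<circ> \<omega>" using Pos_sqrt[OF *(4)] by blast
  have "cj r \<omega> = ?w" using r(2) by (simp add: comp_assoc omega_comp)
  then show ?thesis
    using conj_rf_Fix[OF gaut_omega omega_comp *(1)] Pos_gaut[OF r(1)] *(3)
    by (auto simp: Uhat_Fix) (auto simp: Fix_def)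
qed

text \<open>The \<open>\<omega>\<close>-commuting involutions \<open>\<theta>\<close> of the affine algebra parametrise both kinds of classes:
  they are the complexifications of the involutions of the compact form, and \<open>\<theta> \<circ> \<omega>\<close> runs through the
  antilinear involutions up to conjugacy.\<close>

definition complexify :: "('n aff \<Rightarrow> 'n aff) \<Rightarrow> 'n aff \<Rightarrow> 'n aff" where
  "complexify \<psi> = (SOME \<phi>. \<Gamma> False \<phi> \<and> cj \<phi> \<omega> = \<omega> \<and> (\<forall>x\<in>Fix \<omega>. \<phi> x = \<psi> x))"

lemma complexify:
  assumes "real_aut_on br (Uhat \<sigma> U) \<psi>"
  shows "\<Gamma> False (complexify \<psi>)" "cj (complexify \<psi>) \<omega> = \<omega>" "\<And>x. x \<in> Fix \<omega> \<Longrightarrow> complexify \<psi> x = \<psi> x"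
  using someI_ex[OF real_aut_extend_Fix[OF gaut_omega omega_comp assms[unfolded Uhat_Fix]]]
  unfolding complexify_def[symmetric] by blast+

lemma Fix_omega_eqI: "\<Gamma> c \<phi> \<Longrightarrow> \<Gamma> c \<phi>' \<Longrightarrow> (\<And>x. x \<in> Fix \<omega> \<Longrightarrow> \<phi> x = \<phi>' x) \<Longrightarrow> \<phi> = \<phi>'"
  by (rule gaut_eqI[OF real_form_Fix[OF gaut_omega omega_comp]])

lemma complexify_restrict:
  assumes "\<Gamma> False \<phi>" "cj \<phi> \<omega> = \<omega>"
  shows "real_aut_on br (Uhat \<sigma> U) \<phi>" "complexify \<phi> = \<phi>"
proof -
  show *: "real_aut_on br (Uhat \<sigma> U) \<phi>"
    unfolding Uhat_Fix by (rule real_aut_on_Fix[OF assms(1) gaut_omega assms(2)])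
  show "complexify \<phi> = \<phi>"
    by (rule Fix_omega_eqI[OF complexify(1)[OF *] assms(1) complexify(3)[OF *]])
qed

lemma inv_U_complexify:
  assumes "\<theta> \<in> inv_U br \<sigma> U"
  shows "\<Gamma> False (complexify \<theta>)" "cj (complexify \<theta>) \<omega> = \<omega>" "complexify \<theta> \<circ> complexify \<theta> = id" "complexify \<theta> \<noteq> id"
    "\<And>x. x \<in> Fix \<omega> \<Longrightarrow> complexify \<theta> x = \<theta> x" "\<And>x. x \<in> Fix \<omega> \<Longrightarrow> \<theta> x \<in> Fix \<omega>"
proof -
  have \<theta>: "real_aut_on br (Uhat \<sigma> U) \<theta>" "\<And>x. x \<in> Fix \<omega> \<Longrightarrow> \<theta> (\<theta> x) = x" "\<exists>x\<in>Fix \<omega>. \<theta> x \<noteq> x"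
    using assms unfolding inv_U_def Uhat_Fix by blast+
  note c = complexify[OF \<theta>(1)]
  show "\<Gamma> False (complexify \<theta>)" "cj (complexify \<theta>) \<omega> = \<omega>" "\<And>x. x \<in> Fix \<omega> \<Longrightarrow> complexify \<theta> x = \<theta> x"
    using c by blast+
  show F: "\<And>x. x \<in> Fix \<omega> \<Longrightarrow> \<theta> x \<in> Fix \<omega>"
    using \<theta>(1) unfolding real_aut_on_def Uhat_Fix by (meson bij_betwE)
  have "\<Gamma> False (complexify \<theta> \<circ> complexify \<theta>)" using gaut_comp[OF c(1) c(1)] by simp
  then show "complexify \<theta> \<circ> complexify \<theta> = id"
    by (rule Fix_omega_eqI[OF _ gaut_id]) (simp add: c(3) F \<theta>(2))
  show "complexify \<theta> \<noteq> id" using \<theta>(3) c(3) by force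
qed

lemma inv_U_I:
  assumes "\<Gamma> False \<theta>" "cj \<theta> \<omega> = \<omega>" "\<theta> \<circ> \<theta> = id" "\<theta> \<noteq> id"
  shows "\<theta> \<in> inv_U br \<sigma> U"
proof -
  have "\<exists>x\<in>Fix \<omega>. \<theta> x \<noteq> x"
  proof (rule ccontr)
    assume "\<not> ?thesis"
    then have "\<theta> = id" by (intro Fix_omega_eqI[OF assms(1) gaut_id]) simp
    then show False using assms(4) by simp
  qed
  then show ?thesis
    using complexify_restrict(1)[OF assms(1,2)] assms(3) unfolding inv_U_def Uhat_Fix
    by (auto simp: fun_eq_iff)
qed

text \<open>Moves conjugacy of maps on the compact form into the centraliser of \<omega>, where it
  can be compared with conjugacy in the full group.\<close>

lemma conj_U_iff:
  assumes \<theta>: "\<theta>1 \<in> inv_U br \<sigma> U" "\<theta>2 \<in> inv_U br \<sigma> U"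
  shows "(\<theta>1, \<theta>2) \<in> conj_U_rel br \<sigma> U \<longleftrightarrow>
    (\<exists>\<phi>. \<Gamma> False \<phi> \<and> cj \<phi> \<omega> = \<omega> \<and> cj \<phi> (complexify \<theta>1) = complexify \<theta>2)"
proof
  note c1 = inv_U_complexify[OF \<theta>(1)] and c2 = inv_U_complexify[OF \<theta>(2)]
  assume "(\<theta>1, \<theta>2) \<in> conj_U_rel br \<sigma> U"
  then obtain \<psi> where \<psi>: "real_aut_on br (Uhat \<sigma> U) \<psi>" "\<And>x. x \<in> Fix \<omega> \<Longrightarrow> \<psi> (\<theta>1 x) = \<theta>2 (\<psi> x)"
    unfolding conj_U_rel_def Uhat_Fix by blast
  note c = complexify[OF \<psi>(1)]
  have F: "\<And>x. x \<in> Fix \<omega> \<Longrightarrow> \<psi> x \<in> Fix \<omega>"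
    using \<psi>(1) unfolding real_aut_on_def Uhat_Fix by (meson bij_betwE)
  have b: "bij (complexify \<psi>)" by (rule gaut_bij[OF c(1)])
  have "complexify \<psi> \<circ> complexify \<theta>1 = complexify \<theta>2 \<circ> complexify \<psi>"
    using gaut_comp[OF c(1) c1(1)] gaut_comp[OF c2(1) c(1)]
    by (intro Fix_omega_eqI[of False]) (simp_all add: c(3) c1(5,6) c2(5) F \<psi>(2))
  then have "cj (complexify \<psi>) (complexify \<theta>1) = complexify \<theta>2"
    by (rule cj_eqI[OF b])
  then show "\<exists>\<phi>. \<Gamma> False \<phi> \<and> cj \<phi> \<omega> = \<omega> \<and> cj \<phi> (complexify \<theta>1) = complexify \<theta>2" using c by blast
next
  note c1 = inv_U_complexify[OF \<theta>(1)] and c2 = inv_U_complexify[OF \<theta>(2)]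
  assume "\<exists>\<phi>. \<Gamma> False \<phi> \<and> cj \<phi> \<omega> = \<omega> \<and> cj \<phi> (complexify \<theta>1) = complexify \<theta>2"
  then obtain \<phi> where \<phi>: "\<Gamma> False \<phi>" "cj \<phi> \<omega> = \<omega>" "cj \<phi> (complexify \<theta>1) = complexify \<theta>2" by blast
  have r: "real_aut_on br (Uhat \<sigma> U) \<phi>" by (rule complexify_restrict(1)[OF \<phi>(1,2)])
  have "\<phi> (\<theta>1 x) = \<theta>2 (\<phi> x)" if x: "x \<in> Fix \<omega>" for x
  proof -
    have "\<phi> x \<in> Fix \<omega>" using r x unfolding real_aut_on_def Uhat_Fix by (meson bij_betwE)
    then have "\<theta>2 (\<phi> x) = cj \<phi> (complexify \<theta>1) (\<phi> x)" using c2(5) \<phi>(3) by simp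
    then show ?thesis using c1(5)[OF x] gaut_inv_apply(1)[OF \<phi>(1)] by (simp add: cj_def)
  qed
  then show "(\<theta>1, \<theta>2) \<in> conj_U_rel br \<sigma> U" unfolding conj_U_rel_def Uhat_Fix using r Uhat_Fix by auto
qed

text \<open>\<rho> fixes some compact conjugation \<psi> \<omega> \<psi>^-1; moving that one back to
  \<omega> makes the conjugate of \<rho> commute with \<omega>.\<close>

lemma commuting_conjugate:
  assumes \<rho>: "\<Gamma> c \<rho>" "\<rho> \<circ> \<rho> = id"
  shows "\<exists>\<psi>. \<Gamma> False \<psi> \<and> cj (cj \<psi> \<rho>) \<omega> = \<omega>"
proof -
  obtain m where "cc m" "cj \<rho> m = m" using involution_fixes_cc[OF \<rho>] by blast
  then obtain \<psi> where \<psi>: "\<Gamma> False \<psi>" "cj \<rho> (cj \<psi> \<omega>) = cj \<psi> \<omega>" unfolding cc_def by blast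
  have b: "bij \<psi>" "bij \<rho>" "bij (inv \<psi>)" using gaut_bij \<psi>(1) \<rho>(1) bij_imp_bij_inv by blast+
  have "cj (cj (inv \<psi>) \<rho>) \<omega> = cj (inv \<psi>) (cj \<rho> (cj \<psi> \<omega>))"
    using b by (simp add: cj_def[of "inv \<psi>" \<rho>] cj_cj bij_comp inv_inv_eq)
  also have "\<dots> = \<omega>" by (simp add: \<psi>(2) cj_inv_cancel(1)[OF b(1)])
  finally show ?thesis using gaut_inv[OF \<psi>(1)] by blast
qed

lemma antilinear_decomp:
  assumes \<rho>: "\<Gamma> True \<rho>" "\<rho> \<circ> \<rho> = id" "cj \<rho> \<omega> = \<omega>"
  shows "\<Gamma> False (\<rho> \<circ> \<omega>)" "cj (\<rho> \<circ> \<omega>) \<omega> = \<omega>" "(\<rho> \<circ> \<omega>) \<circ> (\<rho> \<circ> \<omega>) = id" "(\<rho> \<circ> \<omega>) \<circ> \<omega> = \<rho>"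
proof -
  have b: "bij \<rho>" by (rule gaut_bij[OF \<rho>(1)])
  show "\<Gamma> False (\<rho> \<circ> \<omega>)" using gaut_comp[OF \<rho>(1) gaut_omega] by simp
  show "cj (\<rho> \<circ> \<omega>) \<omega> = \<omega>"
    using cj_cj[OF b bij_omega] \<rho>(3) cj_commute[OF bij_omega, of \<omega>] by simp
  have "\<rho> \<circ> \<omega> = \<omega> \<circ> \<rho>" using \<rho>(3) cj_commute[OF b] by blast
  then show "(\<rho> \<circ> \<omega>) \<circ> (\<rho> \<circ> \<omega>) = id" using \<rho>(2) by (metis comp_assoc omega_cancel)
  show "(\<rho> \<circ> \<omega>) \<circ> \<omega> = \<rho>" by (simp add: comp_assoc omega_comp)
qed

lemma linear_to_antilinear:
  assumes \<theta>: "\<Gamma> False \<theta>" "\<theta> \<circ> \<theta> = id" "cj \<theta> \<omega> = \<omega>"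
  shows "\<Gamma> True (\<theta> \<circ> \<omega>)" "cj (\<theta> \<circ> \<omega>) \<omega> = \<omega>" "(\<theta> \<circ> \<omega>) \<circ> (\<theta> \<circ> \<omega>) = id"
proof -
  have b: "bij \<theta>" by (rule gaut_bij[OF \<theta>(1)])
  show "\<Gamma> True (\<theta> \<circ> \<omega>)" using gaut_comp[OF \<theta>(1) gaut_omega] by simp
  show "cj (\<theta> \<circ> \<omega>) \<omega> = \<omega>"
    using cj_cj[OF b bij_omega] \<theta>(3) cj_commute[OF bij_omega, of \<omega>] by simp
  have "\<theta> \<circ> \<omega> = \<omega> \<circ> \<theta>" using \<theta>(3) cj_commute[OF b] by blast
  then show "(\<theta> \<circ> \<omega>) \<circ> (\<theta> \<circ> \<omega>) = id" using \<theta>(2) by (metis comp_assoc omega_cancel)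
qed

lemma compact_iff_cc:
  assumes \<rho>: "\<Gamma> True \<rho>" "\<rho> \<circ> \<rho> = id"
  shows "conj_rf br \<sigma> (Fix \<rho>) (Uhat \<sigma> U) \<longleftrightarrow> cc \<rho>"
  unfolding Uhat_Fix conj_rf_Fix[OF \<rho> gaut_omega] cc_def
  using gaut_inv gaut_bij cj_inv_cancel by metis

lemma inv_U_refl: "\<theta> \<in> inv_U br \<sigma> U \<Longrightarrow> (\<theta>, \<theta>) \<in> conj_U_rel br \<sigma> U"
  unfolding conj_U_iff using gaut_id cj_by_id by metis

lemma inv_U_sym:
  assumes "\<theta>1 \<in> inv_U br \<sigma> U" "\<theta>2 \<in> inv_U br \<sigma> U" "(\<theta>1, \<theta>2) \<in> conj_U_rel br \<sigma> U"
  shows "(\<theta>2, \<theta>1) \<in> conj_U_rel br \<sigma> U"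
proof -
  obtain \<phi> where \<phi>: "\<Gamma> False \<phi>" "cj \<phi> \<omega> = \<omega>" "cj \<phi> (complexify \<theta>1) = complexify \<theta>2"
    using assms(3) unfolding conj_U_iff[OF assms(1,2)] by blast
  then have "cj (inv \<phi>) \<omega> = \<omega>" "cj (inv \<phi>) (complexify \<theta>2) = complexify \<theta>1"
    using cj_inv_cancel(1)[OF gaut_bij[OF \<phi>(1)]] by metis+
  then show ?thesis unfolding conj_U_iff[OF assms(2,1)] using gaut_inv[OF \<phi>(1)] by blast
qed

lemma conj_U_trans: "trans (conj_U_rel br \<sigma> U)"
proof (rule transI)
  fix a b c assume "(a, b) \<in> conj_U_rel br \<sigma> U" "(b, c) \<in> conj_U_rel br \<sigma> U"
  then obtain \<phi> \<psi> where *: "real_aut_on br (Uhat \<sigma> U) \<phi>" "\<And>x. x \<in> Uhat \<sigma> U \<Longrightarrow> \<phi> (a x) = b (\<phi> x)"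
      "real_aut_on br (Uhat \<sigma> U) \<psi>" "\<And>x. x \<in> Uhat \<sigma> U \<Longrightarrow> \<psi> (b x) = c (\<psi> x)"
    unfolding conj_U_rel_def by blast
  have F: "\<And>x. x \<in> Uhat \<sigma> U \<Longrightarrow> \<phi> x \<in> Uhat \<sigma> U"
    using *(1) unfolding real_aut_on_def by (meson bij_betwE)
  have "bij_betw (\<psi> \<circ> \<phi>) (Uhat \<sigma> U) (Uhat \<sigma> U)"
    using *(1,3) unfolding real_aut_on_def by (blast intro: bij_betw_trans)
  then have "real_aut_on br (Uhat \<sigma> U) (\<psi> \<circ> \<phi>)"
    using *(1,3) F unfolding real_aut_on_def by simp
  moreover have "\<forall>x\<in>Uhat \<sigma> U. (\<psi> \<circ> \<phi>) (a x) = c ((\<psi> \<circ> \<phi>) x)" using *(2,4) F by simp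
  ultimately show "(a, c) \<in> conj_U_rel br \<sigma> U" unfolding conj_U_rel_def by blast
qed

lemma real_form_G: "real_form_hat br \<sigma> R \<Longrightarrow> R \<subseteq> G"
  by (simp add: real_form_hat_def)

text \<open>\<theta> is sent to the fixed points of \<theta> \<omega>. By
  \<open>cc_commuting_involution\<close>, this form is compact only for the identity, so
  nontriviality of \<theta> matches noncompactness. Surjectivity is
  \<open>commuting_conjugate\<close>; injectivity on classes is
  \<open>conjugate_in_centralizer\<close> for the antilinear maps.\<close>

lemma noncompact_classes:
  "\<exists>f. bij_betw f (inv_U br \<sigma> U // conj_U_rel br \<sigma> U) ({R. noncompact_hat br \<sigma> U R} // conj_rf_rel br \<sigma>)"
proof (rule quotient_bijection[where F = "\<lambda>\<theta>. Fix (complexify \<theta> \<circ> \<omega>)"])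
  show "trans (conj_rf_rel br \<sigma>)"
    unfolding conj_rf_rel_def trans_def using conj_rf_trans by blast
  show "(x, x) \<in> conj_rf_rel br \<sigma>" if "x \<in> {R. noncompact_hat br \<sigma> U R}" for x
    using that conj_rf_refl real_form_G unfolding conj_rf_rel_def noncompact_hat_def by blast
  show "(y, x) \<in> conj_rf_rel br \<sigma>" if "x \<in> {R. noncompact_hat br \<sigma> U R}" "(x, y) \<in> conj_rf_rel br \<sigma>" for x y
    using that conj_rf_sym real_form_G unfolding conj_rf_rel_def noncompact_hat_def by blast
next
  fix \<theta> assume \<theta>: "\<theta> \<in> inv_U br \<sigma> U"
  note c = inv_U_complexify[OF \<theta>]
  note a = linear_to_antilinear[OF c(1,3,2)]
  have "\<not> cc (complexify \<theta> \<circ> \<omega>)"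
  proof
    assume "cc (complexify \<theta> \<circ> \<omega>)"
    moreover have "cj \<omega> (complexify \<theta> \<circ> \<omega>) = complexify \<theta> \<circ> \<omega>"
      using a(2) cj_commute[OF gaut_bij[OF a(1)]] cj_commute[OF bij_omega] by metis
    ultimately have "complexify \<theta> \<circ> \<omega> = \<omega>" by (rule cc_commuting_involution)
    then have "complexify \<theta> = id" by (metis comp_assoc comp_id omega_comp)
    then show False using c(4) by simp
  qed
  then show "Fix (complexify \<theta> \<circ> \<omega>) \<in> {R. noncompact_hat br \<sigma> U R}"
    using real_form_Fix[OF a(1,3)] compact_iff_cc[OF a(1,3)] by (simp add: noncompact_hat_def)
next
  fix R assume "R \<in> {R. noncompact_hat br \<sigma> U R}"
  then have R: "real_form_hat br \<sigma> R" "\<not> conj_rf br \<sigma> R (Uhat \<sigma> U)" by (auto simp: noncompact_hat_def)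
  obtain \<rho> where \<rho>: "\<Gamma> True \<rho>" "\<rho> \<circ> \<rho> = id" "R = Fix \<rho>" using ex_conjugation[OF R(1)] by blast
  obtain \<psi> where \<psi>: "\<Gamma> False \<psi>" "cj (cj \<psi> \<rho>) \<omega> = \<omega>" using commuting_conjugate[OF \<rho>(1,2)] by blast
  let ?\<rho> = "cj \<psi> \<rho>"
  have \<rho>': "\<Gamma> True ?\<rho>" "?\<rho> \<circ> ?\<rho> = id"
    using gaut_cj[OF \<psi>(1) \<rho>(1)] cj_involution[OF gaut_bij[OF \<psi>(1)] \<rho>(2)] .
  note d = antilinear_decomp[OF \<rho>' \<psi>(2)]
  have "?\<rho> \<circ> \<omega> \<noteq> id"
  proof
    assume "?\<rho> \<circ> \<omega> = id"
    then have "?\<rho> = \<omega>" using d(4) by simp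
    then have "conj_rf br \<sigma> (Fix \<rho>) (Fix \<omega>)" using conj_rf_Fix[OF \<rho>(1,2) gaut_omega] \<psi>(1) by blast
    then show False using R(2) \<rho>(3) by (simp add: Uhat_Fix)
  qed
  then have "?\<rho> \<circ> \<omega> \<in> inv_U br \<sigma> U" by (rule inv_U_I[OF d(1-3)])
  moreover have "complexify (?\<rho> \<circ> \<omega>) \<circ> \<omega> = ?\<rho>"
    unfolding complexify_restrict(2)[OF d(1,2)] by (rule d(4))
  moreover have "(Fix ?\<rho>, R) \<in> conj_rf_rel br \<sigma>"
  proof -
    have "conj_rf br \<sigma> R (Fix ?\<rho>)" using conj_rf_Fix[OF \<rho>(1,2) \<rho>'(1)] \<psi>(1) \<rho>(3) by blast
    then show ?thesis using conj_rf_sym[OF real_form_G[OF R(1)]] by (simp add: conj_rf_rel_def)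
  qed
  ultimately show "\<exists>\<theta>\<in>inv_U br \<sigma> U. (Fix (complexify \<theta> \<circ> \<omega>), R) \<in> conj_rf_rel br \<sigma>" by metis
next
  fix \<theta>1 \<theta>2 assume \<theta>: "\<theta>1 \<in> inv_U br \<sigma> U" "\<theta>2 \<in> inv_U br \<sigma> U"
  note c1 = inv_U_complexify[OF \<theta>(1)] and c2 = inv_U_complexify[OF \<theta>(2)]
  note a1 = linear_to_antilinear[OF c1(1,3,2)] and a2 = linear_to_antilinear[OF c2(1,3,2)]
  have "(\<exists>\<phi>. \<Gamma> False \<phi> \<and> cj \<phi> \<omega> = \<omega> \<and> cj \<phi> (complexify \<theta>1) = complexify \<theta>2) \<longleftrightarrow>
    (\<exists>\<phi>. \<Gamma> False \<phi> \<and> cj \<phi> (complexify \<theta>1 \<circ> \<omega>) = complexify \<theta>2 \<circ> \<omega>)"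
  proof
    assume "\<exists>\<phi>. \<Gamma> False \<phi> \<and> cj \<phi> \<omega> = \<omega> \<and> cj \<phi> (complexify \<theta>1) = complexify \<theta>2"
    then show "\<exists>\<phi>. \<Gamma> False \<phi> \<and> cj \<phi> (complexify \<theta>1 \<circ> \<omega>) = complexify \<theta>2 \<circ> \<omega>"
      using cj_comp[OF gaut_bij] by metis
  next
    assume "\<exists>\<phi>. \<Gamma> False \<phi> \<and> cj \<phi> (complexify \<theta>1 \<circ> \<omega>) = complexify \<theta>2 \<circ> \<omega>"
    then obtain \<psi> where "\<Gamma> False \<psi>" "cj \<psi> (complexify \<theta>1 \<circ> \<omega>) = complexify \<theta>2 \<circ> \<omega>" by blast
    then obtain \<phi> where \<phi>: "\<Gamma> False \<phi>" "cj \<phi> \<omega> = \<omega>" "cj \<phi> (complexify \<theta>1 \<circ> \<omega>) = complexify \<theta>2 \<circ> \<omega>"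
      using conjugate_in_centralizer[OF a1(1) a2(1) a1(2) a2(2)] by blast
    then have "cj \<phi> (complexify \<theta>1) \<circ> \<omega> = complexify \<theta>2 \<circ> \<omega>"
      using cj_comp[OF gaut_bij[OF \<phi>(1)], of "complexify \<theta>1" \<omega>] by simp
    then have "cj \<phi> (complexify \<theta>1) = complexify \<theta>2" by (metis comp_assoc comp_id omega_comp)
    then show "\<exists>\<phi>. \<Gamma> False \<phi> \<and> cj \<phi> \<omega> = \<omega> \<and> cj \<phi> (complexify \<theta>1) = complexify \<theta>2" using \<phi> by blast
  qed
  then show "(\<theta>1, \<theta>2) \<in> conj_U_rel br \<sigma> U \<longleftrightarrow>
      (Fix (complexify \<theta>1 \<circ> \<omega>), Fix (complexify \<theta>2 \<circ> \<omega>)) \<in> conj_rf_rel br \<sigma>"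
    using conj_U_iff[OF \<theta>] conj_rf_Fix[OF a1(1,3) a2(1)] by (simp add: conj_rf_rel_def)
qed (use inv_U_refl inv_U_sym conj_U_trans in blast)+

text \<open>Members of \<open>inv_G\<close> are arbitrary off the affine algebra; resetting them to
  the identity there gives elements of the group of permutations.\<close>

lemma inv_G_normalize:
  assumes \<theta>: "\<theta> \<in> inv_G br \<sigma>"
  shows "\<exists>\<theta>'. \<Gamma> False \<theta>' \<and> \<theta>' \<circ> \<theta>' = id \<and> \<theta>' \<noteq> id \<and> (\<forall>x\<in>G. \<theta>' x = \<theta> x)"
proof -
  have *: "aut_hat br \<sigma> \<theta>" "\<And>x. x \<in> G \<Longrightarrow> \<theta> (\<theta> x) = x" "\<exists>x\<in>G. \<theta> x \<noteq> x"
    using \<theta> unfolding inv_G_def by blast+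
  let ?\<theta> = "\<lambda>x. if x \<in> G then \<theta> x else x"
  have "\<Gamma> False ?\<theta>" by (rule aut_hat_gaut[OF *(1)])
  moreover have "?\<theta> \<circ> ?\<theta> = id" using *(2) aut_hat_props(1)[OF *(1)] by (simp add: fun_eq_iff)
  moreover have "?\<theta> \<noteq> id"
  proof
    assume id: "?\<theta> = id"
    obtain x where "x \<in> G" "\<theta> x \<noteq> x" using *(3) by blast
    then show False using fun_cong[OF id, of x] by simp
  qed
  ultimately show ?thesis by (intro exI[of _ ?\<theta>]) simp
qed

lemma conj_G_trans: "trans (conj_G_rel br \<sigma>)"
proof (rule transI)
  fix a b c assume "(a, b) \<in> conj_G_rel br \<sigma>" "(b, c) \<in> conj_G_rel br \<sigma>"
  then obtain \<phi> \<psi> where *: "aut_hat br \<sigma> \<phi>" "\<And>x. x \<in> G \<Longrightarrow> \<phi> (a x) = b (\<phi> x)"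
      "aut_hat br \<sigma> \<psi>" "\<And>x. x \<in> G \<Longrightarrow> \<psi> (b x) = c (\<psi> x)"
    unfolding conj_G_rel_def by blast
  have "\<forall>x\<in>G. (\<psi> \<circ> \<phi>) (a x) = c ((\<psi> \<circ> \<phi>) x)" using *(2,4) aut_hat_props(1)[OF *(1)] by simp
  then show "(a, c) \<in> conj_G_rel br \<sigma>" unfolding conj_G_rel_def using aut_hat_comp[OF *(3,1)] by blast
qed

lemma conj_G_sym:
  assumes a: "a \<in> inv_G br \<sigma>" and ab: "(a, b) \<in> conj_G_rel br \<sigma>"
  shows "(b, a) \<in> conj_G_rel br \<sigma>"
proof -
  obtain \<phi> where \<phi>: "aut_hat br \<sigma> \<phi>" "\<And>x. x \<in> G \<Longrightarrow> \<phi> (a x) = b (\<phi> x)" using ab unfolding conj_G_rel_def by blast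
  obtain \<phi>' where \<phi>': "aut_hat br \<sigma> \<phi>'" "\<forall>x\<in>G. \<phi>' (\<phi> x) = x" "\<forall>x\<in>G. \<phi> (\<phi>' x) = x"
    using aut_hat_inverse[OF \<phi>(1)] by blast
  have aG: "a x \<in> G" if "x \<in> G" for x using a aut_hat_props(1) that unfolding inv_G_def by blast
  have "\<phi>' (b x) = a (\<phi>' x)" if x: "x \<in> G" for x
  proof -
    have y: "\<phi>' x \<in> G" by (rule aut_hat_props(1)[OF \<phi>'(1) x])
    have "\<phi>' (b x) = \<phi>' (\<phi> (a (\<phi>' x)))" using \<phi>(2)[OF y] \<phi>'(3) x by simp
    then show ?thesis using \<phi>'(2) aG[OF y] by simp
  qed
  then show ?thesis unfolding conj_G_rel_def using \<phi>'(1) by blast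
qed

lemma conj_G_iff:
  assumes "\<Gamma> False a" "\<Gamma> False b"
  shows "(a, b) \<in> conj_G_rel br \<sigma> \<longleftrightarrow> (\<exists>\<phi>. \<Gamma> False \<phi> \<and> cj \<phi> a = b)"
proof
  assume "(a, b) \<in> conj_G_rel br \<sigma>"
  then obtain \<phi> where \<phi>: "aut_hat br \<sigma> \<phi>" "\<And>x. x \<in> G \<Longrightarrow> \<phi> (a x) = b (\<phi> x)" unfolding conj_G_rel_def by blast
  let ?\<phi> = "\<lambda>x. if x \<in> G then \<phi> x else x"
  have g: "\<Gamma> False ?\<phi>" by (rule aut_hat_gaut[OF \<phi>(1)])
  have "?\<phi> \<circ> a = b \<circ> ?\<phi>"
    using \<phi>(2) gaut_G[OF assms(1)] gaut_outside[OF assms(1)] gaut_outside[OF assms(2)] by (simp add: fun_eq_iff)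
  then have "cj ?\<phi> a = b" by (rule cj_eqI[OF gaut_bij[OF g]])
  then show "\<exists>\<phi>. \<Gamma> False \<phi> \<and> cj \<phi> a = b" using g by blast
next
  assume "\<exists>\<phi>. \<Gamma> False \<phi> \<and> cj \<phi> a = b"
  then obtain \<phi> where \<phi>: "\<Gamma> False \<phi>" "cj \<phi> a = b" by blast
  then have "\<phi> (a x) = b (\<phi> x)" for x
    unfolding \<phi>(2)[symmetric] by (simp add: cj_def gaut_inv_apply(1)[OF \<phi>(1)])
  then show "(a, b) \<in> conj_G_rel br \<sigma>" unfolding conj_G_rel_def using gaut_aut_hat[OF \<phi>(1)] by blast
qed

text \<open>Again \<open>commuting_conjugate\<close> and \<open>conjugate_in_centralizer\<close>,
  this time for linear involutions.\<close>

lemma involution_classes: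
  "\<exists>f. bij_betw f (inv_U br \<sigma> U // conj_U_rel br \<sigma> U) (inv_G br \<sigma> // conj_G_rel br \<sigma>)"
proof (rule quotient_bijection[where F = complexify])
  show "(x, x) \<in> conj_G_rel br \<sigma>" if "x \<in> inv_G br \<sigma>" for x
    unfolding conj_G_rel_def using gaut_aut_hat[OF gaut_id] by auto
next
  fix \<theta> assume \<theta>: "\<theta> \<in> inv_U br \<sigma> U"
  note c = inv_U_complexify[OF \<theta>]
  obtain x where x: "complexify \<theta> x \<noteq> x" using c(4) by (metis eq_id_iff)
  then have "x \<in> G" using gaut_outside[OF c(1)] by blast
  moreover have "complexify \<theta> (complexify \<theta> x) = x" for x using c(3) by (metis comp_apply id_apply)
  ultimately show "complexify \<theta> \<in> inv_G br \<sigma>"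
    using x gaut_aut_hat[OF c(1)] unfolding inv_G_def by blast
next
  fix b assume "b \<in> inv_G br \<sigma>"
  then obtain b' where b': "\<Gamma> False b'" "b' \<circ> b' = id" "b' \<noteq> id" "\<And>x. x \<in> G \<Longrightarrow> b' x = b x"
    using inv_G_normalize by blast
  obtain \<psi> where \<psi>: "\<Gamma> False \<psi>" "cj (cj \<psi> b') \<omega> = \<omega>" using commuting_conjugate[OF b'(1,2)] by blast
  have bij: "bij \<psi>" by (rule gaut_bij[OF \<psi>(1)])
  let ?\<theta> = "cj \<psi> b'"
  have \<theta>: "\<Gamma> False ?\<theta>" "?\<theta> \<circ> ?\<theta> = id" using gaut_cj[OF \<psi>(1) b'(1)] cj_involution[OF bij b'(2)] .
  have "?\<theta> \<noteq> id" using b'(3) cj_inv_cancel(1)[OF bij, of b'] cj_id[OF bij_imp_bij_inv[OF bij]] by metis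
  then have "?\<theta> \<in> inv_U br \<sigma> U" by (rule inv_U_I[OF \<theta>(1) \<psi>(2) \<theta>(2)])
  moreover have "(?\<theta>, b) \<in> conj_G_rel br \<sigma>"
  proof -
    have "inv \<psi> (?\<theta> x) = b (inv \<psi> x)" if "x \<in> G" for x
      using b'(4)[OF gaut_inv_G[OF \<psi>(1) that]] gaut_inv_apply(1)[OF \<psi>(1)] by (simp add: cj_def)
    then show ?thesis unfolding conj_G_rel_def using gaut_aut_hat[OF gaut_inv[OF \<psi>(1)]] by blast
  qed
  ultimately show "\<exists>\<theta>\<in>inv_U br \<sigma> U. (complexify \<theta>, b) \<in> conj_G_rel br \<sigma>"
    using complexify_restrict(2)[OF \<theta>(1) \<psi>(2)] by metis
next
  fix \<theta>1 \<theta>2 assume \<theta>: "\<theta>1 \<in> inv_U br \<sigma> U" "\<theta>2 \<in> inv_U br \<sigma> U"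
  note c1 = inv_U_complexify[OF \<theta>(1)] and c2 = inv_U_complexify[OF \<theta>(2)]
  show "(\<theta>1, \<theta>2) \<in> conj_U_rel br \<sigma> U \<longleftrightarrow> (complexify \<theta>1, complexify \<theta>2) \<in> conj_G_rel br \<sigma>"
    unfolding conj_U_iff[OF \<theta>] conj_G_iff[OF c1(1) c2(1)]
    using conjugate_in_centralizer[OF c1(1) c2(1) c1(2) c2(2)] by blast
qed (use inv_U_refl inv_U_sym conj_U_trans conj_G_trans conj_G_sym in blast)+

subsection \<open>Cartan decompositions\<close>

text \<open>A compact conjugation m fixed by \<rho> commutes with it and restricts to
  \<open>R\<close>. The restriction is a Cartan involution, since K + i M is the fixed point set of
  m.\<close>

lemma cartan_exists:
  assumes R: "noncompact_hat br \<sigma> U R"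
  shows "\<exists>K M. cartan_dec br \<sigma> U R K M"
proof -
  have R: "real_form_hat br \<sigma> R" "\<not> conj_rf br \<sigma> R (Uhat \<sigma> U)" using R by (auto simp: noncompact_hat_def)
  obtain \<rho> where \<rho>: "\<Gamma> True \<rho>" "\<rho> \<circ> \<rho> = id" "R = Fix \<rho>" using ex_conjugation[OF R(1)] by blast
  obtain m where m: "cc m" "cj \<rho> m = m" using involution_fixes_cc[OF \<rho>(1,2)] by blast
  have gm: "\<Gamma> True m" and mm: "m \<circ> m = id" using cc_gaut[OF m(1)] cc_involution[OF m(1)] .
  have m_m: "m (m x) = x" for x using mm by (metis comp_apply id_apply)
  have comm: "\<rho> \<circ> m = m \<circ> \<rho>" using m(2) cj_commute[OF gaut_bij[OF \<rho>(1)]] by blast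
  have mR: "m x \<in> R" if "x \<in> R" for x
    using that fun_cong[OF comm, of x] gaut_G[OF gm] by (simp add: \<rho>(3) Fix_def)
  have RG: "x \<in> G" if "x \<in> R" for x using that by (simp add: \<rho>(3) Fix_def)
  have "bij_betw m R R"
    by (rule bij_betw_byWitness[where f' = m]) (use m_m mR in auto)
  then have aut: "real_aut_on br R m"
    unfolding real_aut_on_def by (simp add: gaut_add[OF gm] gaut_scale[OF gm] gaut_br[OF gm] RG)
  \<comment> \<open>If m fixed \<open>R\<close> pointwise, the antilinear maps \<rho> and m would
    agree on \<open>R\<close>, hence everywhere, and \<open>R\<close> would be compact.\<close>
  have nontriv: "\<exists>x\<in>R. m x \<noteq> x"
  proof (rule ccontr)
    assume "\<not> ?thesis"
    then have "\<rho> = m"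
      by (intro gaut_eqI[OF R(1) \<rho>(1) gm]) (auto simp: \<rho>(3) Fix_def)
    then show False using R(2) compact_iff_cc[OF \<rho>(1,2)] m(1) \<rho>(3) by simp
  qed
  let ?K = "{x\<in>R. m x = x}" and ?M = "{x\<in>R. m x = ascale (- 1) x}"
  have "{aadd k (ascale \<i> m') | k m'. k \<in> ?K \<and> m' \<in> ?M} = Fix m"
  proof (intro equalityI subsetI)
    fix y assume "y \<in> {aadd k (ascale \<i> m') | k m'. k \<in> ?K \<and> m' \<in> ?M}"
    then obtain k m' where k: "y = aadd k (ascale \<i> m')" "k \<in> R" "m k = k" "m' \<in> R" "m m' = ascale (- 1) m'" by blast
    then show "y \<in> Fix m"
      by (simp add: Fix_def G_aadd G_ascale RG gaut_add[OF gm] gaut_scale[OF gm] ascale_ascale)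
  next
    fix y assume y: "y \<in> Fix m"
    then have yG: "y \<in> G" and my: "m y = y" by (auto simp: Fix_def)
    obtain p q where pq: "p \<in> R" "q \<in> R" "y = aadd p (ascale \<i> q)" using rf_obtain[OF R(1) yG] by blast
    have "aadd (m p) (ascale \<i> (ascale (- 1) (m q))) = aadd p (ascale \<i> q)"
      using my unfolding pq(3) by (simp add: gaut_add[OF gm] gaut_scale[OF gm] RG pq(1,2) G_ascale ascale_ascale)
    from rf_unique[OF R(1) mR[OF pq(1)] rf_minus[OF R(1) mR[OF pq(2)]] pq(1,2) this]
    have "m p = p" "ascale (- 1) (m q) = q" by blast+
    then have "m q = ascale (- 1) q" by (metis ascale_1 ascale_ascale mult_minus1_right minus_minus)
    then show "y \<in> {aadd k (ascale \<i> m') | k m'. k \<in> ?K \<and> m' \<in> ?M}"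
      using pq \<open>m p = p\<close> by blast
  qed
  moreover have "compact_hat br \<sigma> U (Fix m)"
    using real_form_Fix[OF gm mm] compact_iff_cc[OF gm mm] m(1) by (simp add: compact_hat_def)
  ultimately have "cartan_dec br \<sigma> U R ?K ?M"
    unfolding cartan_dec_def using aut nontriv m_m by (intro exI[of _ m]) simp
  then show ?thesis by blast
qed

text \<open>Encodes the decomposition by a point fixed by \<rho>: the conjugation \<xi> of K + i M
  is 1 on K and -1 on M, so it extends the Cartan involution antilinearly.\<close>

lemma cartan_dec_cc:
  assumes R: "real_form_hat br \<sigma> R" and \<rho>: "\<Gamma> True \<rho>" "\<rho> \<circ> \<rho> = id" "R = Fix \<rho>"
    and dec: "cartan_dec br \<sigma> U R K M"
  shows "\<exists>\<xi>. cc \<xi> \<and> cj \<rho> \<xi> = \<xi> \<and> K = {x\<in>R. \<xi> x = x} \<and> M = {x\<in>R. \<xi> x = ascale (- 1) x}"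
proof -
  obtain \<theta> where \<theta>: "real_aut_on br R \<theta>" "\<And>x. x \<in> R \<Longrightarrow> \<theta> (\<theta> x) = x"
      "K = {x\<in>R. \<theta> x = x}" "M = {x\<in>R. \<theta> x = ascale (- 1) x}"
      "compact_hat br \<sigma> U {aadd k (ascale \<i> m) | k m. k \<in> K \<and> m \<in> M}"
    using dec unfolding cartan_dec_def by blast
  have \<theta>_add: "\<theta> (aadd x y) = aadd (\<theta> x) (\<theta> y)"
    and \<theta>_scale: "\<theta> (ascale (complex_of_real r) x) = ascale (complex_of_real r) (\<theta> x)"
    if "x \<in> R" "y \<in> R" for x y r
    using \<theta>(1) that unfolding real_aut_on_def by blast+
  have \<theta>R: "\<theta> x \<in> R" if "x \<in> R" for x using \<theta>(1) that unfolding real_aut_on_def by (meson bij_betwE)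
  let ?V = "{aadd k (ascale \<i> m) | k m. k \<in> K \<and> m \<in> M}"
  have V: "real_form_hat br \<sigma> ?V" "conj_rf br \<sigma> ?V (Uhat \<sigma> U)" using \<theta>(5) by (auto simp: compact_hat_def)
  obtain \<xi> where \<xi>: "\<Gamma> True \<xi>" "\<xi> \<circ> \<xi> = id" "?V = Fix \<xi>" using ex_conjugation[OF V(1)] by blast
  have cc: "cc \<xi>" using V(2) compact_iff_cc[OF \<xi>(1,2)] \<xi>(3) by simp
  have 0: "azero \<in> R" by (rule rf_0[OF R])
  have "\<theta> azero = azero" using \<theta>_scale[OF 0 0, of 0] by (simp add: ascale_0)
  then have 0: "azero \<in> K" "azero \<in> M" using 0 by (simp_all add: \<theta>(3,4) ascale_azero)
  have K: "\<xi> k = k" if "k \<in> K" for k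
  proof -
    have "aadd k (ascale \<i> azero) \<in> Fix \<xi>" unfolding \<xi>(3)[symmetric] using that 0(2) by blast
    then have "k \<in> Fix \<xi>" by (simp add: ascale_azero aadd_azero)
    then show ?thesis by (simp add: Fix_def)
  qed
  have M: "\<xi> m = ascale (- 1) m" if m: "m \<in> M" for m
  proof -
    have mG: "m \<in> G" using m rf_G[OF R] by (simp add: \<theta>(4))
    have "aadd azero (ascale \<i> m) \<in> Fix \<xi>" unfolding \<xi>(3)[symmetric] using that 0(1) by blast
    then have "ascale \<i> m \<in> Fix \<xi>" by (simp add: aadd_azero)
    then have "ascale (- \<i>) (\<xi> m) = ascale \<i> m" using gaut_scale[OF \<xi>(1) mG, of \<i>] by (simp add: Fix_def)
    then have "ascale \<i> (ascale (- \<i>) (\<xi> m)) = ascale \<i> (ascale \<i> m)" by simp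
    then show ?thesis by (simp add: ascale_ascale ascale_1)
  qed
  \<comment> \<open>Both maps agree on (x + \<theta> x) / 2 in K and on (x - \<theta> x) / 2 in M,
    whose sum is x.\<close>
  have eq: "\<xi> x = \<theta> x" if x: "x \<in> R" for x
  proof -
    let ?k = "ascale (complex_of_real (1 / 2)) (aadd x (\<theta> x))"
    let ?m = "ascale (complex_of_real (1 / 2)) (aadd x (ascale (complex_of_real (- 1)) (\<theta> x)))"
    note tR = \<theta>R[OF x]
    have sR: "ascale (complex_of_real (- 1)) (\<theta> x) \<in> R" by (rule rf_scale[OF R tR])
    have aR: "aadd x (\<theta> x) \<in> R" "aadd x (ascale (complex_of_real (- 1)) (\<theta> x)) \<in> R"
      by (intro rf_add[OF R] x tR sR)+
    have kR: "?k \<in> R" "?m \<in> R" by (intro rf_scale[OF R] aR)+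
    have "\<theta> ?k = ascale (complex_of_real (1 / 2)) (aadd (\<theta> x) x)"
      by (simp only: \<theta>_scale[OF aR(1) aR(1)] \<theta>_add[OF x tR] \<theta>(2)[OF x])
    then have k: "?k \<in> K" using kR(1) by (simp add: \<theta>(3) aadd_commute)
    have "\<theta> ?m = ascale (complex_of_real (1 / 2)) (aadd (\<theta> x) (ascale (complex_of_real (- 1)) x))"
      by (simp only: \<theta>_scale[OF aR(2) aR(2)] \<theta>_scale[OF tR tR] \<theta>_add[OF x sR] \<theta>(2)[OF x])
    then have "\<theta> ?m = ascale (- 1) ?m"
      by (simp add: ascale_aadd ascale_ascale aadd_commute)
    then have m: "?m \<in> M" using kR(2) by (simp add: \<theta>(4))
    have decomp: "x = aadd ?k ?m" "\<theta> x = aadd ?k (ascale (- 1) ?m)"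
      by (cases x; cases "\<theta> x"; simp add: aadd_eq ascale_eq vec_eq_iff fun_eq_iff field_simps)+
    have "\<xi> x = aadd (\<xi> ?k) (\<xi> ?m)"
      using gaut_add[OF \<xi>(1) rf_G[OF R kR(1)] rf_G[OF R kR(2)]] decomp(1) by simp
    then show ?thesis using K[OF k] M[OF m] decomp(2) by simp
  qed
  have "\<rho> \<circ> \<xi> = \<xi> \<circ> \<rho>"
    using gaut_comp[OF \<rho>(1) \<xi>(1)] gaut_comp[OF \<xi>(1) \<rho>(1)]
  proof (intro gaut_eqI[OF R, of False])
    fix x assume x: "x \<in> R"
    then have "\<rho> (\<xi> x) = \<xi> x" "\<rho> x = x" using eq[OF x] \<theta>R[OF x] by (simp_all add: \<rho>(3) Fix_def)
    then show "(\<rho> \<circ> \<xi>) x = (\<xi> \<circ> \<rho>) x" by simp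
  qed simp_all
  then have "cj \<rho> \<xi> = \<xi>" using cj_commute[OF gaut_bij[OF \<rho>(1)]] by blast
  moreover have "K = {x\<in>R. \<xi> x = x}" "M = {x\<in>R. \<xi> x = ascale (- 1) x}"
    using eq by (auto simp: \<theta>(3,4))
  ultimately show ?thesis using cc by blast
qed

text \<open>\<rho> fixes both conjugations, so it commutes with the positive g carrying the first to
  the second; hence g preserves \<open>R\<close> and maps eigenspaces to eigenspaces.\<close>

lemma cartan_unique:
  assumes R: "real_form_hat br \<sigma> R"
    and dec: "cartan_dec br \<sigma> U R K1 M1" "cartan_dec br \<sigma> U R K2 M2"
  shows "\<exists>\<psi>. real_aut_on br R \<psi> \<and> \<psi> ` K1 = K2 \<and> \<psi> ` M1 = M2"
proof -
  obtain \<rho> where \<rho>: "\<Gamma> True \<rho>" "\<rho> \<circ> \<rho> = id" "R = Fix \<rho>" using ex_conjugation[OF R] by blast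
  obtain \<xi>1 where 1: "cc \<xi>1" "cj \<rho> \<xi>1 = \<xi>1" "K1 = {x\<in>R. \<xi>1 x = x}" "M1 = {x\<in>R. \<xi>1 x = ascale (- 1) x}"
    using cartan_dec_cc[OF R \<rho> dec(1)] by blast
  obtain \<xi>2 where 2: "cc \<xi>2" "cj \<rho> \<xi>2 = \<xi>2" "K2 = {x\<in>R. \<xi>2 x = x}" "M2 = {x\<in>R. \<xi>2 x = ascale (- 1) x}"
    using cartan_dec_cc[OF R \<rho> dec(2)] by blast
  obtain g where g: "Pos g" "g \<circ> g = \<xi>2 \<circ> \<xi>1" "cj g \<xi>1 = \<xi>2" using cc_polar[OF 1(1) 2(1)] by blast
  note gg = Pos_gaut[OF g(1)]
  have "cj \<rho> g = g" by (rule cc_polar_commute[OF \<rho>(1) 1(2) 2(2) g(1,2)])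
  then have "cj g \<rho> = \<rho>" using cj_commute[OF gaut_bij[OF gg]] cj_commute[OF gaut_bij[OF \<rho>(1)]] by metis
  then have aut: "real_aut_on br R g" unfolding \<rho>(3) by (rule real_aut_on_Fix[OF gg \<rho>(1)])
  have gR: "g x \<in> R \<longleftrightarrow> x \<in> R" for x
  proof -
    have "g ` R = R" using aut unfolding real_aut_on_def bij_betw_def by blast
    then show ?thesis using gaut_bij[OF gg] by (metis bij_is_inj inj_image_mem_iff)
  qed
  have rel: "\<xi>2 (g x) = g (\<xi>1 x)" for x
    unfolding g(3)[symmetric] by (simp add: cj_def gaut_inv_apply(1)[OF gg])
  have inj: "g x = g y \<longleftrightarrow> x = y" for x y using gaut_bij[OF gg] by (meson bij_is_inj injD)
  have sc: "g (ascale (- 1) x) = ascale (- 1) (g x)" if "x \<in> R" for x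
    using gaut_scale[OF gg rf_G[OF R that], of "- 1"] by simp
  have surj: "\<exists>x. y = g x" for y using gaut_bij[OF gg] by (meson bij_pointE)
  have "g ` K1 = K2"
  proof (intro equalityI subsetI)
    fix y assume "y \<in> K2"
    obtain x where x: "y = g x" using surj by blast
    with \<open>y \<in> K2\<close> have "x \<in> K1" by (simp add: 1(3) 2(3) gR rel inj)
    then show "y \<in> g ` K1" using x by blast
  qed (auto simp: 1(3) 2(3) gR rel)
  moreover have "g ` M1 = M2"
  proof (intro equalityI subsetI)
    fix y assume "y \<in> M2"
    obtain x where x: "y = g x" using surj by blast
    then have "x \<in> R" using \<open>y \<in> M2\<close> gR by (simp add: 2(4))
    with \<open>y \<in> M2\<close> have "x \<in> M1" by (simp add: 1(4) 2(4) rel x inj flip: sc)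
    then show "y \<in> g ` M1" using x by blast
  next
    fix y assume "y \<in> g ` M1"
    then obtain x where "x \<in> R" "\<xi>1 x = ascale (- 1) x" "y = g x" by (auto simp: 1(4))
    then show "y \<in> M2" by (simp add: 2(4) gR rel sc)
  qed
  ultimately show ?thesis using aut by blast
qed

end

theorem theorem5p1:
  fixes br :: "complex^'n::finite \<Rightarrow> complex^'n \<Rightarrow> complex^'n"
    and \<sigma> :: "complex^'n \<Rightarrow> complex^'n"
    and U :: "(complex^'n) set"
  assumes "simple_lie br" and "lie_aut br \<sigma>"
    and "compact_rf_g br U" and "\<sigma> ` U = U"
  shows "real_form_hat br \<sigma> (Uhat \<sigma> U)
    \<and> (\<forall>U1 U2. compact_rf_g br U1 \<and> \<sigma> ` U1 = U1 \<and> compact_rf_g br U2 \<and> \<sigma> ` U2 = U2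
          \<longrightarrow> conj_rf br \<sigma> (Uhat \<sigma> U1) (Uhat \<sigma> U2))
    \<and> (\<exists>f. bij_betw f ({R. noncompact_hat br \<sigma> U R} // conj_rf_rel br \<sigma>)
                      (inv_U br \<sigma> U // conj_U_rel br \<sigma> U))
    \<and> (\<exists>f. bij_betw f ({R. noncompact_hat br \<sigma> U R} // conj_rf_rel br \<sigma>)
                      (inv_G br \<sigma> // conj_G_rel br \<sigma>))
    \<and> (\<forall>R. noncompact_hat br \<sigma> U R \<longrightarrow>
          (\<exists>K M. cartan_dec br \<sigma> U R K M) \<and>
          (\<forall>K1 M1 K2 M2. cartan_dec br \<sigma> U R K1 M1 \<and> cartan_dec br \<sigma> U R K2 M2 \<longrightarrow>
              (\<exists>\<psi>. real_aut_on br R \<psi> \<and> \<psi> ` K1 = K2 \<and> \<psi> ` M1 = M2)))"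
proof -
  have lie: "lie_alg br" using assms(1) by (simp add: simple_lie_def)
  interpret simple_compact br U \<sigma>
    by unfold_locales (use assms lie in auto)
  obtain f where f: "bij_betw f (inv_U br \<sigma> U // conj_U_rel br \<sigma> U) ({R. noncompact_hat br \<sigma> U R} // conj_rf_rel br \<sigma>)"
    using noncompact_classes by blast
  obtain h where h: "bij_betw h (inv_U br \<sigma> U // conj_U_rel br \<sigma> U) (inv_G br \<sigma> // conj_G_rel br \<sigma>)"
    using involution_classes by blast
  \<comment> \<open>Both bijections start from the involutions of the compact form; inverting the
    first makes the noncompact forms the source.\<close>
  note f' = bij_betw_inv_into[OF f]
  have "conj_rf br \<sigma> (Uhat \<sigma> U1) (Uhat \<sigma> U2)"
    if "compact_rf_g br U1" "\<sigma> ` U1 = U1" "compact_rf_g br U2" "\<sigma> ` U2 = U2" for U1 U2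
  proof -
    \<comment> \<open>Taking \<open>U1\<close> as the base form turns the claim for a pair into
      \<open>compact_forms_conjugate\<close>.\<close>
    interpret U1: simple_compact br U1 \<sigma>
      by unfold_locales (use that assms lie in auto)
    show ?thesis by (rule U1.compact_forms_conjugate[OF that(3,4)])
  qed
  moreover have "\<exists>f. bij_betw f ({R. noncompact_hat br \<sigma> U R} // conj_rf_rel br \<sigma>) (inv_G br \<sigma> // conj_G_rel br \<sigma>)"
    using bij_betw_trans[OF f' h] by blast
  moreover have "(\<exists>K M. cartan_dec br \<sigma> U R K M) \<and>
      (\<forall>K1 M1 K2 M2. cartan_dec br \<sigma> U R K1 M1 \<and> cartan_dec br \<sigma> U R K2 M2 \<longrightarrow>
        (\<exists>\<psi>. real_aut_on br R \<psi> \<and> \<psi> ` K1 = K2 \<and> \<psi> ` M1 = M2))" if "noncompact_hat br \<sigma> U R" for R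
    using cartan_exists[OF that] cartan_unique that unfolding noncompact_hat_def by blast
  ultimately show ?thesis
    using real_form_Uhat f' by (intro conjI allI impI) blast+
qed

end
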